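(* Fix $k\ge1$, and let $g(n,k)$ be the number of equivalence classes of permutations of the multiset $\{1^k,\dots,n^k\}$ under $\sim$ (with $g(0,k)=1$). Then there exist finitely many algebraic fractional series $y_1,\dots,y_q,z_1,\dots,z_q\in\mathbb{C}^{\mathrm{alg}}\{\{x\}\}$ and polynomials $P_1,\dots,P_q\in\mathbb{C}^{\mathrm{alg}}\{\{x\}\}[m]$ such that $$\sum_{n\ge0}g(n,k)x^n=\sum_{j=1}^q z_j(x)\sum_{m\ge0}m!\,P_j(m)\,y_j(x)^m$$ (as an identity of fractional Laurent series).
   Context: A permutation of a multiset $\{1^{r_1},\dots,n^{r_n}\}$ is a word in which each $i$ appears exactly $r_i$ times; two such words are equivalent ($\sim$) if one can be obtained from the other by a sequence of interchanges of two adjacent entries differing by exactly $1$. $\mathbb{C}\{\{x\}\}$ denotes the field of fractional Laurent series $f(x)=\sum_{j\ge j_0}a_jx^{j/N}$ with $j_0\in\mathbb{Z}$, $N\ge1$, $a_j\in\mathbb{C}$. Such a series is algebraic if it satisfies a nontrivial polynomial equation with coefficients in $\mathbb{C}[x]$; $\mathbb{C}^{\mathrm{alg}}\{\{x\}\}$ denotes the field of algebraic fractional Laurent series. *)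

theory Defs
  imports
    Complex_Main
    "HOL-Computational_Algebra.Formal_Laurent_Series"
    "HOL-Computational_Algebra.Polynomial_FPS"
    "HOL-Combinatorics.Multiset_Permutations"
begin

section \<open>Equivalence classes of multiset permutations\<close>

definition adj_swap :: "(nat list \<times> nat list) set" where
  "adj_swap = {(u @ [a, b] @ v, u @ [b, a] @ v) | u v a b. b = a + 1 \<or> a = b + 1}"

text \<open>The relation \<open>adj_swap\<close> is symmetric, so its reflexive transitive closure is the
  equivalence relation it generates; it preserves the multiset of letters.\<close>

definition equiv_words :: "(nat list \<times> nat list) set" where
  "equiv_words = adj_swap\<^sup>*"

definition num_classes :: "nat \<Rightarrow> nat \<Rightarrow> nat" where
  "num_classes n k = card (permutations_of_multiset (\<Sum>i=1..n. replicate_mset k i) // equiv_words)"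

lemma equiv_equiv_words: "equiv UNIV equiv_words"
proof -
  have "sym adj_swap"
    unfolding sym_def adj_swap_def by blast
  then show ?thesis
    unfolding equiv_words_def by (intro equivI refl_rtrancl sym_rtrancl trans_rtrancl) auto
qed

lemma equiv_words_mset: "(v, w) \<in> equiv_words \<Longrightarrow> mset v = mset w"
  unfolding equiv_words_def
  by (induction rule: rtrancl_induct) (auto simp: adj_swap_def)

lemma num_classes_0: "num_classes 0 k = 1"
  by (simp add: num_classes_def quotient_def)


section \<open>Fractional Laurent series\<close>

text \<open>A series \<open>\<Sum>j\<ge>j0. a j * x powr (j / N)\<close> is represented by its coefficient function
  on rational exponents.\<close>

typedef (overloaded) 'a puiseux =
  "{f :: rat \<Rightarrow> 'a::zero. \<exists>N>0. \<exists>j0::int. \<forall>e. f e \<noteq> 0 \<longrightarrow> (\<exists>j\<ge>j0. e = of_int j / of_nat N)}"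
  morphisms puiseux_nth Abs_puiseux
  by (rule exI[of _ "\<lambda>_. 0"]) auto

setup_lifting type_definition_puiseux

lemma puiseux_eqI: "(\<And>e. puiseux_nth f e = puiseux_nth h e) \<Longrightarrow> f = h"
  by transfer auto

lemma puiseux_support:
  "\<exists>N>0. \<exists>j0. \<forall>e. puiseux_nth f e \<noteq> 0 \<longrightarrow> (\<exists>j\<ge>j0. e = of_int j / of_nat N)"
  using puiseux_nth[of f] by simp

instantiation puiseux :: (zero) zero
begin
lift_definition zero_puiseux :: "'a puiseux" is "\<lambda>_. 0" by auto
instance ..
end

text \<open>Substitution of \<open>x powr (1 / N)\<close> into a Laurent series (for \<open>N > 0\<close>).\<close>

lift_definition puiseux_of_fls :: "nat \<Rightarrow> 'a::zero fls \<Rightarrow> 'a puiseux" is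
  "\<lambda>N F e. if N > 0 \<and> of_nat N * e \<in> \<int> then fls_nth F \<lfloor>of_nat N * e\<rfloor> else 0"
proof -
  fix N :: nat and F :: "'a fls"
  show "\<exists>M>0. \<exists>j0. \<forall>e::rat.
          (if N > 0 \<and> of_nat N * e \<in> \<int> then fls_nth F \<lfloor>of_nat N * e\<rfloor> else 0) \<noteq> 0 \<longrightarrow>
          (\<exists>j\<ge>j0. e = of_int j / of_nat M)"
  proof (cases "N > 0")
    case True
    have "\<exists>j\<ge>fls_subdegree F. e = of_int j / of_nat N"
      if e: "of_nat N * e \<in> \<int>" "fls_nth F \<lfloor>of_nat N * e\<rfloor> \<noteq> 0" for e :: rat
    proof (intro exI conjI)
      show "\<lfloor>of_nat N * e\<rfloor> \<ge> fls_subdegree F"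
        using that(2) by (rule fls_subdegree_leI)
      obtain n where n: "of_nat N * e = of_int n" using e(1) by (auto elim: Ints_cases)
      have "\<lfloor>of_nat N * e\<rfloor> = n" by (simp only: n floor_of_int)
      moreover have "e = of_int n / of_nat N" using True n by (simp add: field_simps)
      ultimately show "e = of_int \<lfloor>of_nat N * e\<rfloor> / of_nat N" by (simp only:)
    qed
    then show ?thesis using True by auto
  qed auto
qed

definition puiseux_of_fps :: "'a::zero fps \<Rightarrow> 'a puiseux" where
  "puiseux_of_fps F = puiseux_of_fls 1 (fps_to_fls F)"

definition puiseux_of_poly :: "'a::zero poly \<Rightarrow> 'a puiseux" where
  "puiseux_of_poly p = puiseux_of_fps (fps_of_poly p)"

lemma puiseux_nth_of_fls: "N > 0 \<Longrightarrow>
    puiseux_nth (puiseux_of_fls N F) (of_int j / of_nat N) = fls_nth F j"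
  by (simp add: puiseux_of_fls.rep_eq)

text \<open>Finitely many series have a common denominator \<open>N\<close>.\<close>

lemma puiseux_denominator: "\<exists>N>0. \<forall>M>0. \<exists>F. f = puiseux_of_fls (N * M) F"
proof -
  obtain N j0 where N: "N > 0"
    "\<And>e. puiseux_nth f e \<noteq> 0 \<Longrightarrow> \<exists>j\<ge>j0. e = of_int j / of_nat N"
    using puiseux_support[of f] by auto
  have "\<exists>F. f = puiseux_of_fls (N * M) F" if M: "M > 0" for M
  proof
    define F where "F = Abs_fls (\<lambda>j. puiseux_nth f (of_int j / of_nat (N * M)))"
    have F: "fls_nth F j = puiseux_nth f (of_int j / of_nat (N * M))" for j
      unfolding F_def
    proof (rule nth_Abs_fls_lower_bound[of "min 0 (j0 * int M)"], intro allI impI)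
      fix i assume i: "i < min 0 (j0 * int M)"
      show "puiseux_nth f (of_int i / of_nat (N * M)) = 0"
      proof (rule ccontr)
        assume "\<not> ?thesis"
        then obtain j where j: "j \<ge> j0" "of_int i / of_nat (N * M) = (of_int j / of_nat N :: rat)"
          using N(2) by blast
        then have "of_int i = (of_int (j * int M) :: rat)"
          using N(1) M by (simp add: field_simps)
        then have "i = j * int M" by (simp only: of_int_eq_iff)
        moreover have "j0 * int M \<le> j * int M" using j(1) by (intro mult_right_mono) auto
        ultimately show False using i by simp
      qed
    qed
    show "f = puiseux_of_fls (N * M) F"
    proof (rule puiseux_eqI)
      fix e
      show "puiseux_nth f e = puiseux_nth (puiseux_of_fls (N * M) F) e"
      proof (cases "of_nat (N * M) * e \<in> \<int>")
        case True
        then obtain j where "of_nat (N * M) * e = of_int j" by (auto elim: Ints_cases)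
        then have "e = of_int j / of_nat (N * M)" using N(1) M by (simp add: field_simps)
        then show ?thesis using N(1) M by (simp add: puiseux_nth_of_fls F del: of_nat_mult)
      next
        case False
        have "puiseux_nth f e = 0"
        proof (rule ccontr)
          assume "\<not> ?thesis"
          then obtain j where "e = of_int j / of_nat N" using N(2) by blast
          then have "of_nat (N * M) * e = of_int (j * int M)" using N(1) by simp
          then show False using False by (metis Ints_of_int)
        qed
        moreover have "puiseux_nth (puiseux_of_fls (N * M) F) e = 0"
          using False by (simp add: puiseux_of_fls.rep_eq del: of_nat_mult)
        ultimately show ?thesis by simp
      qed
    qed
  qed
  with N(1) show ?thesis by auto
qed

lemma puiseux_common1: obtains N F where "N > 0" "f = puiseux_of_fls N F"
proof -
  obtain N where N: "N > 0" "\<And>M. M > 0 \<Longrightarrow> \<exists>F. f = puiseux_of_fls (N * M) F"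
    using puiseux_denominator[of f] by auto
  then show ?thesis using that N(2)[of 1] by auto
qed

lemma puiseux_common3:
  obtains N F G H where "N > 0" "f = puiseux_of_fls N F" "g = puiseux_of_fls N G"
    "h = puiseux_of_fls N H"
proof -
  obtain N1 where N1: "N1 > 0" "\<And>M. M > 0 \<Longrightarrow> \<exists>F. f = puiseux_of_fls (N1 * M) F"
    using puiseux_denominator[of f] by auto
  obtain N2 where N2: "N2 > 0" "\<And>M. M > 0 \<Longrightarrow> \<exists>F. g = puiseux_of_fls (N2 * M) F"
    using puiseux_denominator[of g] by auto
  obtain N3 where N3: "N3 > 0" "\<And>M. M > 0 \<Longrightarrow> \<exists>F. h = puiseux_of_fls (N3 * M) F"
    using puiseux_denominator[of h] by auto
  obtain F where F: "f = puiseux_of_fls (N1 * (N2 * N3)) F" using N1(2)[of "N2 * N3"] N2(1) N3(1) by auto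
  obtain G where G: "g = puiseux_of_fls (N2 * (N1 * N3)) G" using N2(2)[of "N1 * N3"] N1(1) N3(1) by auto
  obtain H where H: "h = puiseux_of_fls (N3 * (N1 * N2)) H" using N3(2)[of "N1 * N2"] N1(1) N2(1) by auto
  show ?thesis
  proof (rule that)
    show "N1 * N2 * N3 > 0" using N1(1) N2(1) N3(1) by simp
    show "f = puiseux_of_fls (N1 * N2 * N3) F" using F by (simp add: mult_ac)
    show "g = puiseux_of_fls (N1 * N2 * N3) G" using G by (simp add: mult_ac)
    show "h = puiseux_of_fls (N1 * N2 * N3) H" using H by (simp add: mult_ac)
  qed
qed

lemma puiseux_of_fls_eq_iff: "N > 0 \<Longrightarrow> puiseux_of_fls N F = puiseux_of_fls N G \<longleftrightarrow> F = G"
  using puiseux_nth_of_fls[of N F] puiseux_nth_of_fls[of N G] by (auto intro: fls_eqI)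

lemma puiseux_of_fls_0: "puiseux_of_fls N 0 = 0"
  by (rule puiseux_eqI) (simp add: puiseux_of_fls.rep_eq zero_puiseux.rep_eq)

instantiation puiseux :: (zero_neq_one) zero_neq_one
begin
lift_definition one_puiseux :: "'a puiseux" is "\<lambda>e. if e = 0 then 1 else 0"
  by (intro exI[of _ "1::nat"] conjI exI[of _ "0::int"]) auto
instance
proof
  show "(0::'a puiseux) \<noteq> 1"
    by transfer (metis zero_neq_one)
qed
end

lemma puiseux_of_fls_1: "N > 0 \<Longrightarrow> puiseux_of_fls N 1 = 1"
  by (rule puiseux_eqI) (auto simp: puiseux_of_fls.rep_eq one_puiseux.rep_eq elim!: Ints_cases)

text \<open>Addition is pointwise, multiplication is convolution (a finite sum for each exponent).\<close>

instantiation puiseux :: (comm_ring_1) "{plus, minus, uminus, times}"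
begin

lift_definition plus_puiseux :: "'a puiseux \<Rightarrow> 'a puiseux \<Rightarrow> 'a puiseux" is
  "\<lambda>f h e. f e + h e"
proof -
  fix f h :: "rat \<Rightarrow> 'a"
  assume "\<exists>N>0. \<exists>j0::int. \<forall>e. f e \<noteq> 0 \<longrightarrow> (\<exists>j\<ge>j0. e = of_int j / of_nat N)"
    and "\<exists>N>0. \<exists>j0::int. \<forall>e. h e \<noteq> 0 \<longrightarrow> (\<exists>j\<ge>j0. e = of_int j / of_nat N)"
  then have FH: "f = puiseux_nth (Abs_puiseux f)" "h = puiseux_nth (Abs_puiseux h)"
    by (simp_all add: Abs_puiseux_inverse)
  obtain N A B where N: "N > 0" "Abs_puiseux f = puiseux_of_fls N A" "Abs_puiseux h = puiseux_of_fls N B"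
    by (rule puiseux_common3[of "Abs_puiseux f" "Abs_puiseux h"])
  have "(\<lambda>e. f e + h e) = puiseux_nth (puiseux_of_fls N (A + B))"
    by (subst FH(1), subst FH(2)) (rule ext, simp add: N puiseux_of_fls.rep_eq)
  then show "\<exists>N>0. \<exists>j0::int. \<forall>e. f e + h e \<noteq> 0 \<longrightarrow> (\<exists>j\<ge>j0. e = of_int j / of_nat N)"
    using puiseux_support[of "puiseux_of_fls N (A + B)"] by (simp add: fun_eq_iff)
qed

lift_definition uminus_puiseux :: "'a puiseux \<Rightarrow> 'a puiseux" is "\<lambda>f e. - f e"
  by auto

definition minus_puiseux :: "'a puiseux \<Rightarrow> 'a puiseux \<Rightarrow> 'a puiseux" where
  "minus_puiseux f h = f + (- h)"

lift_definition times_puiseux :: "'a puiseux \<Rightarrow> 'a puiseux \<Rightarrow> 'a puiseux" is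
  "\<lambda>f h e. \<Sum>a | f a \<noteq> 0 \<and> h (e - a) \<noteq> 0. f a * h (e - a)"
proof -
  fix f h :: "rat \<Rightarrow> 'a"
  assume "\<exists>N>0. \<exists>j0::int. \<forall>e. f e \<noteq> 0 \<longrightarrow> (\<exists>j\<ge>j0. e = of_int j / of_nat N)"
    and "\<exists>N>0. \<exists>j0::int. \<forall>e. h e \<noteq> 0 \<longrightarrow> (\<exists>j\<ge>j0. e = of_int j / of_nat N)"
  then obtain N M and j0 i0 :: int where N: "N > 0" and M: "M > 0"
    and f: "\<And>e. f e \<noteq> 0 \<Longrightarrow> \<exists>j\<ge>j0. e = of_int j / of_nat N"
    and h: "\<And>e. h e \<noteq> 0 \<Longrightarrow> \<exists>j\<ge>i0. e = of_int j / of_nat M"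
    by blast
  show "\<exists>N>0. \<exists>j0::int. \<forall>e. (\<Sum>a | f a \<noteq> 0 \<and> h (e - a) \<noteq> 0. f a * h (e - a)) \<noteq> 0 \<longrightarrow>
          (\<exists>j\<ge>j0. e = of_int j / of_nat N)"
  proof (rule exI[of _ "N * M"], rule conjI, goal_cases)
    case 1
    show ?case using N M by simp
  next
    case 2
    show ?case
    proof (rule exI[of _ "j0 * int M + i0 * int N"], intro allI impI)
      fix e assume "(\<Sum>a | f a \<noteq> 0 \<and> h (e - a) \<noteq> 0. f a * h (e - a)) \<noteq> 0"
      then have "{a. f a \<noteq> 0 \<and> h (e - a) \<noteq> 0} \<noteq> {}"
        by (intro notI) (simp only: sum.empty simp_thms)
      then obtain a where a: "f a \<noteq> 0" "h (e - a) \<noteq> 0" by blast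
      obtain j i where ji: "j \<ge> j0" "a = of_int j / of_nat N" "i \<ge> i0" "e - a = of_int i / of_nat M"
        using f[OF a(1)] h[OF a(2)] by blast
      have "e = of_int j / of_nat N + of_int i / of_nat M" using ji by simp
      then have "e = of_int (j * int M + i * int N) / of_nat (N * M)"
        using N M by (simp add: field_simps)
      moreover have "j0 * int M + i0 * int N \<le> j * int M + i * int N"
        using ji by (intro add_mono mult_right_mono) auto
      ultimately show "\<exists>j\<ge>j0 * int M + i0 * int N. e = of_int j / of_nat (N * M)" by blast
    qed
  qed
qed

instance ..
end

lemma puiseux_of_fls_add: "puiseux_of_fls N (F + G) = puiseux_of_fls N F + puiseux_of_fls N G"
  by (rule puiseux_eqI) (simp add: puiseux_of_fls.rep_eq plus_puiseux.rep_eq)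

lemma puiseux_of_fls_uminus: "puiseux_of_fls N (- F) = - puiseux_of_fls N F"
  by (rule puiseux_eqI) (simp add: puiseux_of_fls.rep_eq uminus_puiseux.rep_eq)

lemma puiseux_of_fls_mult:
  "puiseux_of_fls N (F * G) = puiseux_of_fls N F * puiseux_of_fls N G"
proof (cases "N > 0")
  case N: True
  define f where "f = puiseux_nth (puiseux_of_fls N F)"
  define h where "h = puiseux_nth (puiseux_of_fls N G)"
  have f_nth: "f (of_int j / of_nat N) = fls_nth F j" and
       h_nth: "h (of_int j / of_nat N) = fls_nth G j" for j
    using N by (simp_all add: f_def h_def puiseux_nth_of_fls)
  have int_multiple: "\<exists>j. a = of_int j / of_nat N" if a: "of_nat N * a \<in> \<int>" for a :: rat
  proof -
    obtain j where "of_nat N * a = of_int j" using a by (auto elim: Ints_cases)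
    then have "a = of_int j / of_nat N" using N by (simp add: field_simps)
    then show ?thesis by (rule exI)
  qed
  have f_int: "\<exists>j. a = of_int j / of_nat N" if "f a \<noteq> 0" for a
  proof -
    have "of_nat N * a \<in> \<int>" using that by (auto simp: f_def puiseux_of_fls.rep_eq split: if_splits)
    then show ?thesis by (rule int_multiple)
  qed
  have h_int: "\<exists>j. a = of_int j / of_nat N" if "h a \<noteq> 0" for a
  proof -
    have "of_nat N * a \<in> \<int>" using that by (auto simp: h_def puiseux_of_fls.rep_eq split: if_splits)
    then show ?thesis by (rule int_multiple)
  qed
  show ?thesis
  proof (rule puiseux_eqI)
    fix e
    have rhs: "puiseux_nth (puiseux_of_fls N F * puiseux_of_fls N G) e =
        (\<Sum>a | f a \<noteq> 0 \<and> h (e - a) \<noteq> 0. f a * h (e - a))"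
      by (simp add: f_def h_def times_puiseux.rep_eq)
    show "puiseux_nth (puiseux_of_fls N (F * G)) e =
        puiseux_nth (puiseux_of_fls N F * puiseux_of_fls N G) e"
    proof (cases "\<exists>n. e = of_int n / of_nat N")
      case True
      then obtain n where e: "e = of_int n / of_nat N" by blast
      have diff: "e - of_int i / of_nat N = of_int (n - i) / of_nat N" for i
        by (simp add: e diff_divide_distrib)
      let ?I = "{i. fls_nth F i \<noteq> 0 \<and> fls_nth G (n - i) \<noteq> 0}"
      have set: "{a. f a \<noteq> 0 \<and> h (e - a) \<noteq> 0} = (\<lambda>i. of_int i / of_nat N) ` ?I"
      proof (intro equalityI subsetI)
        fix a assume a: "a \<in> {a. f a \<noteq> 0 \<and> h (e - a) \<noteq> 0}"
        then obtain i where "a = of_int i / of_nat N" using f_int by blast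
        with a have "i \<in> ?I"
          using f_nth[of i] h_nth[of "n - i"] diff[of i] by simp
        then show "a \<in> (\<lambda>i. of_int i / of_nat N :: rat) ` ?I"
          using \<open>a = of_int i / of_nat N\<close> by blast
      next
        fix a assume "a \<in> (\<lambda>i. of_int i / of_nat N :: rat) ` ?I"
        then obtain i where "a = of_int i / of_nat N" "i \<in> ?I" by blast
        then show "a \<in> {a. f a \<noteq> 0 \<and> h (e - a) \<noteq> 0}"
          using f_nth[of i] h_nth[of "n - i"] diff[of i] by simp
      qed
      have inj: "inj_on (\<lambda>i. of_int i / of_nat N :: rat) ?I"
        using N by (auto simp: inj_on_def)
      have "(\<Sum>a | f a \<noteq> 0 \<and> h (e - a) \<noteq> 0. f a * h (e - a)) =
          (\<Sum>i\<in>?I. fls_nth F i * fls_nth G (n - i))"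
        unfolding set sum.reindex[OF inj] o_def diff f_nth h_nth ..
      also have "\<dots> = (\<Sum>i=fls_subdegree F..n - fls_subdegree G. fls_nth F i * fls_nth G (n - i))"
      proof (rule sum.mono_neutral_left)
        show "?I \<subseteq> {fls_subdegree F..n - fls_subdegree G}"
          using fls_subdegree_leI[of F] fls_subdegree_leI[of G] by force
      qed auto
      also have "\<dots> = fls_nth (F * G) n"
        by (simp add: fls_times_nth(2))
      also have "\<dots> = puiseux_nth (puiseux_of_fls N (F * G)) e"
        using N by (simp add: e puiseux_nth_of_fls)
      finally show ?thesis by (simp add: rhs)
    next
      case False
      have "{a. f a \<noteq> 0 \<and> h (e - a) \<noteq> 0} = {}"
      proof safe
        fix a assume "f a \<noteq> 0" "h (e - a) \<noteq> 0"
        then obtain i j where "a = of_int i / of_nat N" "e - a = of_int j / of_nat N"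
          using f_int h_int by blast
        then have "e = of_int (i + j) / of_nat N" by (simp add: add_divide_distrib)
        then show "a \<in> {}" using False by blast
      qed
      then have "puiseux_nth (puiseux_of_fls N F * puiseux_of_fls N G) e = 0"
        unfolding rhs by (metis sum.empty)
      moreover have "of_nat N * e \<notin> \<int>"
        using False int_multiple by blast
      then have "puiseux_nth (puiseux_of_fls N (F * G)) e = 0"
        by (simp add: puiseux_of_fls.rep_eq)
      ultimately show ?thesis by simp
    qed
  qed
next
  case False
  then show ?thesis
    by (intro puiseux_eqI) (simp add: puiseux_of_fls.rep_eq times_puiseux.rep_eq)
qed

lemmas puiseux_of_fls_hom = puiseux_of_fls_0 puiseux_of_fls_1 puiseux_of_fls_add
  puiseux_of_fls_uminus puiseux_of_fls_mult

instance puiseux :: (comm_ring_1) comm_ring_1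
proof
  fix a b c :: "'a puiseux"
  obtain N A B C where N: "N > 0"
    and [simp]: "a = puiseux_of_fls N A" "b = puiseux_of_fls N B" "c = puiseux_of_fls N C"
    by (rule puiseux_common3[of a b c])
  show "a * b * c = a * (b * c)" by (simp flip: puiseux_of_fls_mult add: mult.assoc)
  show "a * b = b * a" by (simp flip: puiseux_of_fls_mult add: mult.commute)
  show "1 * a = a" by (simp flip: puiseux_of_fls_1[OF N] puiseux_of_fls_mult)
  show "a + b + c = a + (b + c)" by (simp flip: puiseux_of_fls_add add: add.assoc)
  show "a + b = b + a" by (simp flip: puiseux_of_fls_add add: add.commute)
  show "0 + a = a" by (simp flip: puiseux_of_fls_0[of N] puiseux_of_fls_add)
  show "- a + a = 0"
    by (simp flip: puiseux_of_fls_0[of N] puiseux_of_fls_add puiseux_of_fls_uminus)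
  show "a - b = a + - b" by (simp add: minus_puiseux_def)
  show "(a + b) * c = a * c + b * c"
    by (simp flip: puiseux_of_fls_add puiseux_of_fls_mult add: distrib_right)
qed

instance puiseux :: (idom) idom
proof
  fix a b :: "'a puiseux"
  assume "a \<noteq> 0" "b \<noteq> 0"
  moreover obtain N A B where N: "N > 0" "a = puiseux_of_fls N A" "b = puiseux_of_fls N B"
    by (rule puiseux_common3[of a b])
  ultimately have "A * B \<noteq> 0" by (auto simp: puiseux_of_fls_0)
  then have "puiseux_of_fls N (A * B) \<noteq> puiseux_of_fls N 0"
    using N(1) by (simp add: puiseux_of_fls_eq_iff)
  then show "a * b \<noteq> 0" by (simp only: N puiseux_of_fls_mult puiseux_of_fls_0 not_False_eq_True)
qed

instantiation puiseux :: (field) inverse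
begin

definition inverse_puiseux :: "'a puiseux \<Rightarrow> 'a puiseux" where
  "inverse_puiseux f = (if f = 0 then 0 else (THE h. f * h = 1))"

definition divide_puiseux :: "'a puiseux \<Rightarrow> 'a puiseux \<Rightarrow> 'a puiseux" where
  "divide_puiseux f h = f * inverse h"

instance ..
end

instance puiseux :: (field) field
proof
  fix f h :: "'a puiseux"
  show "inverse (0::'a puiseux) = 0" by (simp add: inverse_puiseux_def)
  show "f / h = f * inverse h" by (simp add: divide_puiseux_def)
  assume f: "f \<noteq> 0"
  obtain N F where N: "N > 0" "f = puiseux_of_fls N F"
    by (rule puiseux_common1)
  with f have "F \<noteq> 0" by (auto simp: puiseux_of_fls_0)
  then have "f * puiseux_of_fls N (inverse F) = 1"
    using N by (simp flip: puiseux_of_fls_mult add: puiseux_of_fls_1)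
  then have "\<exists>!h. f * h = 1" using f by (metis mult_left_cancel)
  then have "f * (THE h. f * h = 1) = 1" by (rule theI')
  then show "inverse f * f = 1" using f by (simp add: inverse_puiseux_def mult.commute)
qed

instance puiseux :: ("{comm_ring_1,ring_char_0}") ring_char_0
proof
  have *: "of_nat n = puiseux_of_fls 1 (of_nat n :: 'a fls)" for n
    by (induction n) (simp_all add: puiseux_of_fls_hom)
  show "inj (of_nat :: nat \<Rightarrow> 'a puiseux)"
    by (rule injI) (simp add: * puiseux_of_fls_eq_iff)
qed

instance puiseux :: (field_char_0) field_char_0 ..


section \<open>The \<open>x\<close>-adic topology\<close>

text \<open>The basic neighbourhoods of \<open>f\<close> consist of the series that agree with \<open>f\<close> in all
  exponents up to a given bound. Infinite sums of series refer to this topology.\<close>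

instantiation puiseux :: (zero) topological_space
begin

definition open_puiseux :: "'a puiseux set \<Rightarrow> bool" where
  "open_puiseux U \<longleftrightarrow>
     (\<forall>f\<in>U. \<exists>c. \<forall>h. (\<forall>e\<le>c. puiseux_nth h e = puiseux_nth f e) \<longrightarrow> h \<in> U)"

instance
proof
  show "open (UNIV :: 'a puiseux set)" by (simp add: open_puiseux_def)
  fix S T :: "'a puiseux set"
  assume S: "open S" and T: "open T"
  show "open (S \<inter> T)" unfolding open_puiseux_def
  proof
    fix f assume "f \<in> S \<inter> T"
    then obtain c d where
      "\<forall>h. (\<forall>e\<le>c. puiseux_nth h e = puiseux_nth f e) \<longrightarrow> h \<in> S"
      "\<forall>h. (\<forall>e\<le>d. puiseux_nth h e = puiseux_nth f e) \<longrightarrow> h \<in> T"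
      using S T unfolding open_puiseux_def by blast
    then show "\<exists>c. \<forall>h. (\<forall>e\<le>c. puiseux_nth h e = puiseux_nth f e) \<longrightarrow> h \<in> S \<inter> T"
      by (intro exI[of _ "max c d"]) auto
  qed
next
  fix K :: "'a puiseux set set"
  assume "\<forall>S\<in>K. open S"
  then show "open (\<Union>K)" unfolding open_puiseux_def by (meson UnionE UnionI)
qed
end

lemma open_puiseux_nbhd:
  "open {h :: 'a::zero puiseux. \<forall>e\<le>c. puiseux_nth h e = puiseux_nth f e}"
  unfolding open_puiseux_def by (auto intro!: exI[of _ c])

instance puiseux :: (zero) t2_space
proof
  fix f g :: "'a puiseux"
  assume "f \<noteq> g"
  then obtain c where c: "puiseux_nth f c \<noteq> puiseux_nth g c" using puiseux_eqI by blast
  then show "\<exists>U V. open U \<and> open V \<and> f \<in> U \<and> g \<in> V \<and> U \<inter> V = {}"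
    by (intro exI[of _ "{h. \<forall>e\<le>c. puiseux_nth h e = puiseux_nth f e}"]
          exI[of _ "{h. \<forall>e\<le>c. puiseux_nth h e = puiseux_nth g e}"] conjI open_puiseux_nbhd)
       force+
qed

lemma tendsto_puiseux_iff:
  "(s \<longlongrightarrow> l) F \<longleftrightarrow> (\<forall>c. \<forall>\<^sub>F n in F. \<forall>e\<le>c. puiseux_nth (s n) e = puiseux_nth l e)"
proof
  assume lim: "(s \<longlongrightarrow> l) F"
  show "\<forall>c. \<forall>\<^sub>F n in F. \<forall>e\<le>c. puiseux_nth (s n) e = puiseux_nth l e"
    using topological_tendstoD[OF lim open_puiseux_nbhd[of _ l]] by simp
next
  assume *: "\<forall>c. \<forall>\<^sub>F n in F. \<forall>e\<le>c. puiseux_nth (s n) e = puiseux_nth l e"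
  show "(s \<longlongrightarrow> l) F"
  proof (rule topological_tendstoI)
    fix S assume "open S" "l \<in> S"
    then obtain c where c: "\<And>h. (\<forall>e\<le>c. puiseux_nth h e = puiseux_nth l e) \<Longrightarrow> h \<in> S"
      unfolding open_puiseux_def by blast
    show "\<forall>\<^sub>F n in F. s n \<in> S"
      using *[rule_format, of c] by (rule eventually_mono) (rule c)
  qed
qed


section \<open>Algebraic fractional Laurent series\<close>

text \<open>The witness is a nonzero polynomial with coefficients in \<open>\<complex>[x]\<close>, which are embedded
  into the fractional Laurent series coefficientwise.\<close>

definition algebraic_puiseux :: "complex puiseux \<Rightarrow> bool" where
  "algebraic_puiseux f \<longleftrightarrow>
     (\<exists>p :: complex poly poly. p \<noteq> 0 \<and> poly (map_poly puiseux_of_poly p) f = 0)"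

end

theory Submission
  imports
    Defs
    "HOL-Computational_Algebra.Field_as_Ring"
    "HOL-Computational_Algebra.Fundamental_Theorem_Algebra"
    "HOL-Computational_Algebra.Polynomial_Factorial"
begin

text \<open>Letters that differ by one commute, so the classes are the elements of a partially
  commutative monoid whose cliques are \<open>{i}\<close> and \<open>{i, i+1}\<close>. By Cartier--Foata their numbers are the
  coefficients of \<open>1 / (1 - \<Sum> x\<^sub>i + \<Sum> x\<^sub>i x\<^sub>i\<^sub>+\<^sub>1)\<close>, that is, the images of the coefficients of
  \<open>exp (t (\<Sum> x\<^sub>i - \<Sum> x\<^sub>i x\<^sub>i\<^sub>+\<^sub>1))\<close> under the functional \<open>t ^ m \<mapsto> m!\<close>. The coefficients of
  \<open>x\<^sub>1 ^ k \<cdots> x\<^sub>n ^ k\<close> are entries of the \<open>n\<close>-th power of a transfer matrix over \<open>\<complex>[t]\<close>, so their generating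
  function is a rational function \<open>M(x,t) / D(x,t)\<close> with \<open>D(0,t) = 1\<close>. Over the algebraically closed
  field of fractional Laurent series \<open>D\<close> splits into factors \<open>1 - y t\<close>, where \<open>y\<close> has positive order
  because \<open>D(0,t) = 1\<close>. Hence the coefficient of \<open>t ^ m\<close> is, for large \<open>m\<close>, of the form
  \<open>\<Sum> P\<^sub>j(m) y\<^sub>j ^ m\<close>, and applying the functional gives the claim.\<close>

section \<open>Equivalence classes as traces\<close>

text \<open>The factorials come from writing 1/(1 - F) as the integral of exp(-t) exp(t F) over t,
  with F the sum of all x_i minus all x_i x_{i+1}. Unlike 1/(1 - F), the exponential factors over
  the vertices and edges of a path, so that extracting the exponents k needs only k + 1 states. The
  Cartier-Foata identity is obtained by matching recurrences: counting the possible first letters of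
  a class yields the same recurrence as d/dt exp(t F) = F exp(t F) combined with integration by
  parts. Two requirements shape the second half. The sums over m must converge although fractional
  Laurent series are not complete, which forces a common denominator besides positive order. And all
  data must be algebraic: Newton-Puiseux only provides roots in the full field. The roots are
  algebraic because D has coefficients in C[x]; the polynomials P_j are algebraic because the
  recurrence for the coefficients of t^m is solved one root at a time by difference equations inside
  the subfield of algebraic series. The coefficients of small index, disturbed by the numerator M,
  are collected separately.\<close>

definition commuting :: "nat \<Rightarrow> nat \<Rightarrow> bool" where
  "commuting a b \<longleftrightarrow> b = Suc a \<or> a = Suc b"

text \<open>The projection criterion for traces: a trace is determined by its images on the pairs of
  letters that do not commute. The pair \<open>a = b\<close> is included and records the
  multiplicity of a letter.\<close>

definition same_projections :: "nat list \<Rightarrow> nat list \<Rightarrow> bool" where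
  "same_projections v w \<longleftrightarrow>
     (\<forall>a b. \<not> commuting a b \<longrightarrow> filter (\<lambda>x. x = a \<or> x = b) v = filter (\<lambda>x. x = a \<or> x = b) w)"

lemma equiv_words_refl [simp]: "(w, w) \<in> equiv_words"
  by (simp add: equiv_words_def)

lemma equiv_words_trans: "(u, v) \<in> equiv_words \<Longrightarrow> (v, w) \<in> equiv_words \<Longrightarrow> (u, w) \<in> equiv_words"
  using equiv_equiv_words by (meson equivE transD)

lemma equiv_words_sym: "(u, v) \<in> equiv_words \<Longrightarrow> (v, u) \<in> equiv_words"
  using equiv_equiv_words by (meson equivE symD)

lemma equiv_words_Cons: "(u, v) \<in> equiv_words \<Longrightarrow> (a # u, a # v) \<in> equiv_words"
  unfolding equiv_words_def
proof (induction rule: rtrancl_induct)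
  case (step v w)
  have "(a # v, a # w) \<in> adj_swap"
    using step(2) unfolding adj_swap_def by clarsimp (metis append_Cons)
  then show ?case using step(3) by simp
qed simp

lemma equiv_words_swap: "commuting a b \<Longrightarrow> (a # b # w, b # a # w) \<in> equiv_words"
  unfolding equiv_words_def
proof (rule r_into_rtrancl)
  assume "commuting a b"
  then have "\<exists>u v c d. (a # b # w, b # a # w) = (u @ [c, d] @ v, u @ [d, c] @ v) \<and> (d = c + 1 \<or> c = d + 1)"
    by (intro exI[of _ "[]"] exI[of _ w] exI[of _ a] exI[of _ b]) (auto simp: commuting_def)
  then show "(a # b # w, b # a # w) \<in> adj_swap" unfolding adj_swap_def by blast
qed

lemma equiv_words_move:
  "(\<And>x. x \<in> set p \<Longrightarrow> commuting x a) \<Longrightarrow> (p @ a # q, a # p @ q) \<in> equiv_words"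
proof (induction p)
  case (Cons x p)
  have "(x # p @ a # q, x # a # p @ q) \<in> equiv_words"
    using Cons by (intro equiv_words_Cons) auto
  moreover have "(x # a # p @ q, a # x # p @ q) \<in> equiv_words"
    using Cons by (intro equiv_words_swap) auto
  ultimately show ?case by (auto intro: equiv_words_trans)
qed simp

text \<open>An adjacent swap exchanges two commuting letters, and no projection in the criterion
  keeps both of them.\<close>

lemma same_projections_cong:
  "(v, w) \<in> equiv_words \<Longrightarrow> same_projections v w"
  unfolding equiv_words_def
proof (induction rule: rtrancl_induct)
  case (step v' w)
  have "same_projections v' w"
    using step(2) unfolding adj_swap_def same_projections_def commuting_def by auto
  then show ?case using step(3) by (auto simp: same_projections_def)
qed (simp add: same_projections_def)

lemma same_projections_Cons_iff: "same_projections (a # v) (a # w) \<longleftrightarrow> same_projections v w"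
  by (auto simp: same_projections_def split: if_splits)

text \<open>Split \<open>w\<close> at its first \<open>a\<close>. A letter before it that does not
  commute with \<open>a\<close> would come before \<open>a\<close> in their common projection,
  whereas the left-hand word starts with \<open>a\<close>.\<close>

lemma same_projections_ConsD:
  assumes "same_projections (a # u) w"
  shows "\<exists>p q. w = p @ a # q \<and> (\<forall>x\<in>set p. commuting x a) \<and> same_projections u (p @ q)"
proof -
  have filter_eq: "filter (\<lambda>x. x = b \<or> x = c) (a # u) = filter (\<lambda>x. x = b \<or> x = c) w"
    if "\<not> commuting b c" for b c
    using assms that unfolding same_projections_def by blast
  have "a \<in> set (filter (\<lambda>x. x = a \<or> x = a) (a # u))" by simp
  also have "filter (\<lambda>x. x = a \<or> x = a) (a # u) = filter (\<lambda>x. x = a \<or> x = a) w"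
    by (rule filter_eq) (simp add: commuting_def)
  finally have "a \<in> set w" by simp
  then obtain p q where w: "w = p @ a # q" "a \<notin> set p"
    by (meson split_list_first)
  have p: "commuting x a" if x: "x \<in> set p" for x
  proof (rule ccontr)
    assume "\<not> commuting x a"
    then have eq: "a # filter (\<lambda>y. y = x \<or> y = a) u =
        filter (\<lambda>y. y = x \<or> y = a) p @ a # filter (\<lambda>y. y = x \<or> y = a) q"
      using filter_eq[of x a] w by simp
    obtain y ys where ys: "filter (\<lambda>y. y = x \<or> y = a) p = y # ys"
      using x by (metis (mono_tags, lifting) filter_empty_conv neq_Nil_conv)
    then have "y \<in> set (filter (\<lambda>y. y = x \<or> y = a) p)" by simp
    then have "y \<in> set p" by simp
    moreover have "y = a" using eq ys by simp
    ultimately show False using w(2) by simp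
  qed
  have "same_projections u (p @ q)"
    unfolding same_projections_def
  proof (intro allI impI)
    fix b c assume bc: "\<not> commuting b c"
    show "filter (\<lambda>x. x = b \<or> x = c) u = filter (\<lambda>x. x = b \<or> x = c) (p @ q)"
    proof (cases "a = b \<or> a = c")
      case True
      then have "filter (\<lambda>x. x = b \<or> x = c) p = []"
        using p bc w(2) by (auto simp: filter_empty_conv commuting_def)
      then show ?thesis using filter_eq[OF bc] w True by auto
    next
      case False
      then show ?thesis using filter_eq[OF bc] w by auto
    qed
  qed
  then show ?thesis using w(1) p by blast
qed

lemma equiv_words_of_same_projections: "same_projections v w \<Longrightarrow> (v, w) \<in> equiv_words"
proof (induction v arbitrary: w)
  case Nil
  have "x \<notin> set w" for x
  proof -
    have "filter (\<lambda>y. y = x \<or> y = x) w = []"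
      using Nil[unfolded same_projections_def, rule_format, of x x] by (simp add: commuting_def)
    then show ?thesis by (auto simp: filter_empty_conv)
  qed
  then show ?case by (cases w) auto
next
  case (Cons a u)
  obtain p q where w: "w = p @ a # q" "\<And>x. x \<in> set p \<Longrightarrow> commuting x a" "same_projections u (p @ q)"
    using same_projections_ConsD[OF Cons.prems] by blast
  have "(a # u, a # p @ q) \<in> equiv_words" using Cons.IH w(3) equiv_words_Cons by blast
  moreover have "(a # p @ q, w) \<in> equiv_words"
    using w(1) equiv_words_move[OF w(2)] equiv_words_sym by blast
  ultimately show ?case by (rule equiv_words_trans)
qed

lemma equiv_words_iff: "(v, w) \<in> equiv_words \<longleftrightarrow> same_projections v w"
  using same_projections_cong equiv_words_of_same_projections by blast

text \<open>Left cancellation is not visible from the generating swaps; through projections it is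
  immediate.\<close>

lemma equiv_words_Cons_iff: "(a # v, a # w) \<in> equiv_words \<longleftrightarrow> (v, w) \<in> equiv_words"
  by (simp add: equiv_words_iff same_projections_Cons_iff)

text \<open>The head \<open>b\<close> of the second word stands before its first \<open>a\<close>;
  hence it commutes with \<open>a\<close>, and once that \<open>a\<close> is moved to the front it
  comes second.\<close>

lemma equiv_words_heads:
  assumes "(a # u, b # v) \<in> equiv_words" "a \<noteq> b"
  shows "commuting a b" and "\<exists>w. (a # u, a # b # w) \<in> equiv_words"
proof -
  obtain p q where w: "b # v = p @ a # q" "\<And>x. x \<in> set p \<Longrightarrow> commuting x a" "same_projections u (p @ q)"
    using same_projections_ConsD assms(1) unfolding equiv_words_iff by blast
  obtain p' where p: "p = b # p'" using w(1) assms(2) by (cases p) auto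
  show "commuting a b" using w(2)[of b] p by (auto simp: commuting_def)
  have "(a # u, a # b # (p' @ q)) \<in> equiv_words"
    using w(3) p by (simp add: equiv_words_iff same_projections_Cons_iff)
  then show "\<exists>w. (a # u, a # b # w) \<in> equiv_words" ..
qed

section \<open>Classes, their heads, and the recurrence for their number\<close>

abbreviation word_class :: "nat list \<Rightarrow> nat list set" where
  "word_class w \<equiv> equiv_words `` {w}"

lemma word_class_eq_iff: "word_class v = word_class w \<longleftrightarrow> (v, w) \<in> equiv_words"
  using equiv_equiv_words by (simp add: eq_equiv_class_iff)

definition classes :: "nat multiset \<Rightarrow> nat list set set" where
  "classes M = word_class ` permutations_of_multiset M"

lemma classes_eq_quotient: "classes M = permutations_of_multiset M // equiv_words"
  by (auto simp: classes_def quotient_def)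

lemma finite_classes [simp]: "finite (classes M)"
  by (simp add: classes_def)

lemma card_image_cong_eq:
  assumes "\<And>x y. x \<in> S \<Longrightarrow> y \<in> S \<Longrightarrow> f x = f y \<longleftrightarrow> g x = g y"
  shows "card (f ` S) = card (g ` S)"
proof -
  define h where "h = (\<lambda>z. g (inv_into S f z))"
  have h: "h (f x) = g x" if "x \<in> S" for x
    using that assms[of "inv_into S f (f x)" x] by (simp add: h_def inv_into_into f_inv_into_f)
  have "inj_on h (f ` S)" using assms by (auto simp: inj_on_def h)
  moreover have "h ` f ` S = g ` S" using h by (force simp: image_image)
  ultimately show ?thesis by (metis card_image)
qed

definition classes_headed :: "nat list \<Rightarrow> nat multiset \<Rightarrow> nat list set set" where
  "classes_headed p M = (\<lambda>w. word_class (p @ w)) ` permutations_of_multiset M"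

lemma card_classes_headed: "card (classes_headed p M) = card (classes M)"
proof -
  have "(p @ v, p @ w) \<in> equiv_words \<longleftrightarrow> (v, w) \<in> equiv_words" for v w
    by (induction p) (simp_all add: equiv_words_Cons_iff)
  then show ?thesis
    unfolding classes_headed_def classes_def
    by (intro card_image_cong_eq) (simp add: word_class_eq_iff)
qed

lemma classes_headed_subset: "classes_headed p M \<subseteq> classes (mset p + M)"
  by (auto simp: classes_headed_def classes_def permutations_of_multiset_def)

text \<open>The minimal letters of a trace, that is, its first Cartier-Foata layer.\<close>

definition class_heads :: "nat list set \<Rightarrow> nat set" where
  "class_heads X = {a. \<exists>w. a # w \<in> X}"

lemma class_heads_eq:
  assumes "X \<in> classes M"
  shows "class_heads X = {a\<in>set_mset M. X \<in> classes_headed [a] (M - {#a#})}"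
proof -
  obtain v where v: "mset v = M" "X = word_class v"
    using assms by (auto simp: classes_def permutations_of_multiset_def)
  show ?thesis
  proof (intro equalityI subsetI)
    fix a assume "a \<in> class_heads X"
    then obtain w where w: "(v, a # w) \<in> equiv_words" using v by (auto simp: class_heads_def)
    then have M: "M = add_mset a (mset w)" using equiv_words_mset[OF w] v by simp
    have "X = word_class ([a] @ w)" using w v word_class_eq_iff by simp
    then have "X \<in> classes_headed [a] (M - {#a#})"
      unfolding classes_headed_def M by (intro image_eqI[of _ _ w]) (auto intro: permutations_of_multisetI)
    with M show "a \<in> {a\<in>set_mset M. X \<in> classes_headed [a] (M - {#a#})}" by simp
  next
    fix a assume "a \<in> {a\<in>set_mset M. X \<in> classes_headed [a] (M - {#a#})}"
    then obtain w where "X = word_class (a # w)" by (auto simp: classes_headed_def)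
    then have "a # w \<in> X" by simp
    then show "a \<in> class_heads X" unfolding class_heads_def by blast
  qed
qed

text \<open>Two adjacent heads can be brought to the front simultaneously by
  \<open>equiv_words_heads\<close>, so pairs of heads are counted by the classes of a multiset with
  two letters fewer.\<close>

lemma class_heads_pair_eq:
  assumes "X \<in> classes M"
  shows "{a. a \<in> class_heads X \<and> Suc a \<in> class_heads X} =
    {a. a \<in># M \<and> Suc a \<in># M \<and> X \<in> classes_headed [a, Suc a] (M - {#a, Suc a#})}"
proof -
  obtain v where v: "mset v = M" "X = word_class v"
    using assms by (auto simp: classes_def permutations_of_multiset_def)
  show ?thesis
  proof (intro equalityI subsetI CollectI)
    fix a assume "a \<in> {a. a \<in> class_heads X \<and> Suc a \<in> class_heads X}"
    then obtain u w where uw: "(v, a # u) \<in> equiv_words" "(v, Suc a # w) \<in> equiv_words"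
      using v by (auto simp: class_heads_def)
    then have "(a # u, Suc a # w) \<in> equiv_words" by (meson equiv_words_sym equiv_words_trans)
    then obtain w' where "(a # u, a # Suc a # w') \<in> equiv_words"
      using equiv_words_heads(2) n_not_Suc_n by blast
    then have w': "(v, a # Suc a # w') \<in> equiv_words" using uw equiv_words_trans by blast
    then have M: "M = {#a, Suc a#} + mset w'" using equiv_words_mset[OF w'] v by simp
    have "X = word_class ([a, Suc a] @ w')" using w' v word_class_eq_iff by simp
    then have "X \<in> classes_headed [a, Suc a] (M - {#a, Suc a#})"
      unfolding classes_headed_def M by (intro image_eqI[of _ _ w']) (auto intro: permutations_of_multisetI)
    with M show "a \<in># M \<and> Suc a \<in># M \<and> X \<in> classes_headed [a, Suc a] (M - {#a, Suc a#})" by simp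
  next
    fix a assume "a \<in> {a. a \<in># M \<and> Suc a \<in># M \<and> X \<in> classes_headed [a, Suc a] (M - {#a, Suc a#})}"
    then obtain w where X: "X = word_class (a # Suc a # w)" by (auto simp: classes_headed_def)
    have "(a # Suc a # w, Suc a # a # w) \<in> equiv_words"
      by (intro equiv_words_swap) (simp add: commuting_def)
    then have "a # Suc a # w \<in> X" "Suc a # a # w \<in> X" using X by simp_all
    then show "a \<in> class_heads X \<and> Suc a \<in> class_heads X"
      unfolding class_heads_def by blast
  qed
qed

text \<open>The heads of a class form a nonempty clique of the commutation graph, which is a path.\<close>

lemma card_class_heads:
  assumes "X \<in> classes M" "M \<noteq> {#}"
  shows "card (class_heads X) = card {a. a \<in> class_heads X \<and> Suc a \<in> class_heads X} + 1"
proof -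
  obtain v where v: "mset v = M" "X = word_class v"
    using assms by (auto simp: classes_def permutations_of_multiset_def)
  have comm: "commuting a b" if ab: "a \<in> class_heads X" "b \<in> class_heads X" "a \<noteq> b" for a b
  proof -
    obtain u w where "(v, a # u) \<in> equiv_words" "(v, b # w) \<in> equiv_words"
      using ab v by (auto simp: class_heads_def)
    then have "(a # u, b # w) \<in> equiv_words" by (meson equiv_words_sym equiv_words_trans)
    then show ?thesis using equiv_words_heads(1) ab(3) by blast
  qed
  obtain a w where aw: "v = a # w" using v assms(2) by (cases v) auto
  have "a # w \<in> X" using v aw by simp
  then have "class_heads X \<noteq> {}" unfolding class_heads_def by blast
  moreover define h where "h = (LEAST a. a \<in> class_heads X)"
  ultimately have h: "h \<in> class_heads X" "\<And>a. a \<in> class_heads X \<Longrightarrow> h \<le> a"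
    by (auto intro: LeastI Least_le)
  have heads: "a = h \<or> a = Suc h" if "a \<in> class_heads X" for a
    using comm[OF h(1) that] h(2)[OF that] by (auto simp: commuting_def)
  show ?thesis
  proof (cases "Suc h \<in> class_heads X")
    case True
    have "Suc (Suc h) \<notin> class_heads X" using heads[of "Suc (Suc h)"] by auto
    then have "{a. a \<in> class_heads X \<and> Suc a \<in> class_heads X} = {h}"
      using True h heads by auto
    moreover have "class_heads X = {h, Suc h}" using True h heads by blast
    ultimately show ?thesis by simp
  next
    case False
    then have "class_heads X = {h}" using h heads by blast
    then show ?thesis by simp
  qed
qed

lemma sum_card_double_count:
  assumes "finite I" "finite Q" "\<And>i. i \<in> I \<Longrightarrow> F i \<subseteq> Q"
  shows "(\<Sum>i\<in>I. card (F i)) = (\<Sum>X\<in>Q. card {i\<in>I. X \<in> F i})"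
proof -
  have "(\<Sum>i\<in>I. card (F i)) = (\<Sum>i\<in>I. card {X\<in>Q. X \<in> F i})"
    using assms(3) by (intro sum.cong refl arg_cong[of _ _ card]) auto
  also have "\<dots> = (\<Sum>X\<in>Q. card {i\<in>I. X \<in> F i})"
    by (intro sum_multicount_gen assms ballI refl)
  finally show ?thesis .
qed

text \<open>By \<open>card_class_heads\<close> every class contributes 1 to the number of its heads
  minus the number of its adjacent pairs of heads. Summing over all classes and counting doubly,
  each head or pair is removed from the front.\<close>

lemma card_classes_rec:
  assumes "M \<noteq> {#}"
  shows "int (card (classes M)) = (\<Sum>a\<in>set_mset M. int (card (classes (M - {#a#})))) -
    (\<Sum>a | a \<in># M \<and> Suc a \<in># M. int (card (classes (M - {#a, Suc a#}))))"
proof -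
  let ?J = "{a. a \<in># M \<and> Suc a \<in># M}"
  have finJ: "finite ?J" by (rule finite_subset[of _ "set_mset M"]) auto
  have "(\<Sum>a\<in>set_mset M. card (classes (M - {#a#}))) =
      (\<Sum>a\<in>set_mset M. card (classes_headed [a] (M - {#a#})))"
    by (simp add: card_classes_headed)
  also have "\<dots> = (\<Sum>X\<in>classes M. card {a\<in>set_mset M. X \<in> classes_headed [a] (M - {#a#})})"
  proof (intro sum_card_double_count)
    fix a assume "a \<in> set_mset M"
    then show "classes_headed [a] (M - {#a#}) \<subseteq> classes M"
      using classes_headed_subset[of "[a]" "M - {#a#}"] by simp
  qed auto
  also have "\<dots> = (\<Sum>X\<in>classes M. card (class_heads X))"
    by (intro sum.cong refl arg_cong[of _ _ card]) (simp add: class_heads_eq)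
  also have "\<dots> = (\<Sum>X\<in>classes M. card {a. a \<in> class_heads X \<and> Suc a \<in> class_heads X} + 1)"
    by (intro sum.cong refl card_class_heads) (use assms in auto)
  also have "\<dots> = (\<Sum>X\<in>classes M. card {a. a \<in> class_heads X \<and> Suc a \<in> class_heads X}) + card (classes M)"
    unfolding sum.distrib by simp
  also have "(\<Sum>X\<in>classes M. card {a. a \<in> class_heads X \<and> Suc a \<in> class_heads X}) =
      (\<Sum>X\<in>classes M. card {a\<in>?J. X \<in> classes_headed [a, Suc a] (M - {#a, Suc a#})})"
    by (intro sum.cong refl arg_cong[of _ _ card]) (auto simp: class_heads_pair_eq)
  also have "\<dots> = (\<Sum>a\<in>?J. card (classes_headed [a, Suc a] (M - {#a, Suc a#})))"
  proof (intro sum_card_double_count[symmetric] finJ)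
    fix a assume "a \<in> ?J"
    then have "{#a, Suc a#} \<subseteq># M"
      by (auto simp: subseteq_mset_def)
    then have "{#a, Suc a#} + (M - {#a, Suc a#}) = M"
      by (rule subset_mset.add_diff_inverse)
    then have "mset [a, Suc a] + (M - {#a, Suc a#}) = M" by (simp only: mset.simps)
    then show "classes_headed [a, Suc a] (M - {#a, Suc a#}) \<subseteq> classes M"
      using classes_headed_subset[of "[a, Suc a]" "M - {#a, Suc a#}"] by argo
  qed auto
  also have "\<dots> = (\<Sum>a\<in>?J. card (classes (M - {#a, Suc a#})))"
    by (simp only: card_classes_headed)
  finally show ?thesis
    by (simp only: of_nat_add flip: of_nat_sum)
qed

lemma num_classes_eq: "num_classes n k = card (classes (\<Sum>i=1..n. replicate_mset k i))"
  by (simp add: num_classes_def classes_eq_quotient)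


section \<open>Counting classes with a transfer matrix\<close>

definition content :: "int list \<Rightarrow> nat multiset" where
  "content l = (\<Sum>i<length l. replicate_mset (nat (l ! i)) (Suc i))"

text \<open>Negative entries are admitted so that the recurrences below hold without side conditions.\<close>

definition class_count :: "int list \<Rightarrow> int" where
  "class_count l = (if \<exists>x\<in>set l. x < 0 then 0 else int (card (classes (content l))))"

definition dec :: "nat \<Rightarrow> int list \<Rightarrow> int list" where
  "dec i l = l[i := l ! i - 1]"

lemma length_dec [simp]: "length (dec i l) = length l"
  by (simp add: dec_def)

lemma nth_dec: "j < length l \<Longrightarrow> dec i l ! j = (if i = j then l ! j - 1 else l ! j)"
  by (auto simp: dec_def nth_list_update)

lemma count_content: "count (content l) a = (if 0 < a \<and> a \<le> length l then nat (l ! (a - 1)) else 0)"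
proof -
  have "count (content l) a = (\<Sum>i<length l. if Suc i = a then nat (l ! i) else 0)"
    unfolding content_def count_sum by (intro sum.cong) (auto simp: count_replicate_mset)
  also have "\<dots> = (\<Sum>i\<in>{i. i < length l \<and> Suc i = a}. nat (l ! i))"
    by (simp add: sum.If_cases lessThan_def Int_def)
  also have "{i. i < length l \<and> Suc i = a} = (if 0 < a \<and> a \<le> length l then {a - 1} else {})"
    by auto
  finally show ?thesis by simp
qed

lemma content_dec:
  assumes "i < length l" "l ! i > 0"
  shows "content (dec i l) = content l - {#Suc i#}"
proof (rule multiset_eqI)
  fix a show "count (content (dec i l)) a = count (content l - {#Suc i#}) a"
    using assms by (cases a) (auto simp: count_content nth_dec nat_diff_distrib)
qed

lemma class_count_dec:
  assumes "\<forall>x\<in>set l. x \<ge> 0" "i < length l"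
  shows "class_count (dec i l) = (if l ! i > 0 then int (card (classes (content l - {#Suc i#}))) else 0)"
proof (cases "l ! i > 0")
  case True
  then have "dec i l ! j \<ge> 0" if "j < length l" for j
    using assms that by (auto simp: nth_dec)
  then have "\<not> (\<exists>x\<in>set (dec i l). x < 0)"
    by (auto simp: in_set_conv_nth) (metis not_le)
  then show ?thesis using True assms content_dec unfolding class_count_def by simp
next
  case False
  then have "dec i l ! i < 0" using assms by (simp add: nth_dec)
  then have "\<exists>x\<in>set (dec i l). x < 0" using assms(2) by (metis length_dec nth_mem)
  then show ?thesis using False by (simp add: class_count_def)
qed

text \<open>This is \<open>card_classes_rec\<close> in terms of exponent vectors. The zero vector is
  excluded: its count is 1, while every term on the right has a negative entry and vanishes.\<close>

lemma class_count_rec: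
  assumes "\<forall>x\<in>set l. x \<ge> 0" "\<exists>x\<in>set l. x \<noteq> 0"
  shows "class_count l = (\<Sum>i<length l. class_count (dec i l)) -
    (\<Sum>i<length l - 1. class_count (dec i (dec (Suc i) l)))"
proof -
  have nonneg: "l ! i \<ge> 0" if "i < length l" for i using assms(1) that by auto
  have mem: "Suc i \<in># content l \<longleftrightarrow> i < length l \<and> l ! i > 0" for i
    by (auto simp: count_content simp flip: count_greater_zero_iff)
  have mem0: "0 \<notin># content l" by (simp add: count_content flip: count_greater_zero_iff)
  have set: "set_mset (content l) = Suc ` {i. i < length l \<and> l ! i > 0}"
  proof (intro equalityI subsetI)
    fix a assume "a \<in># content l"
    then show "a \<in> Suc ` {i. i < length l \<and> l ! i > 0}" using mem mem0 by (cases a) auto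
  qed (use mem in auto)
  have pairs: "{a. a \<in># content l \<and> Suc a \<in># content l} =
      Suc ` {i. Suc i < length l \<and> l ! i > 0 \<and> l ! Suc i > 0}"
  proof (intro equalityI subsetI)
    fix a assume "a \<in> {a. a \<in># content l \<and> Suc a \<in># content l}"
    then show "a \<in> Suc ` {i. Suc i < length l \<and> l ! i > 0 \<and> l ! Suc i > 0}"
      using mem mem0 by (cases a) auto
  next
    fix a assume "a \<in> Suc ` {i. Suc i < length l \<and> l ! i > 0 \<and> l ! Suc i > 0}"
    then obtain i where "a = Suc i" "Suc i < length l" "l ! i > 0" "l ! Suc i > 0" by blast
    then show "a \<in> {a. a \<in># content l \<and> Suc a \<in># content l}" by (simp add: mem)
  qed
  obtain i where "i < length l" "l ! i \<noteq> 0" using assms(2) by (auto simp: in_set_conv_nth)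
  then have "Suc i \<in># content l" using mem nonneg[of i] by auto
  then have ne: "content l \<noteq> {#}" by auto
  have one: "(\<Sum>a\<in>set_mset (content l). int (card (classes (content l - {#a#})))) =
      (\<Sum>i<length l. class_count (dec i l))"
  proof -
    have "(\<Sum>a\<in>set_mset (content l). int (card (classes (content l - {#a#})))) =
        (\<Sum>i | i < length l \<and> l ! i > 0. int (card (classes (content l - {#Suc i#}))))"
      unfolding set by (subst sum.reindex) auto
    also have "\<dots> = (\<Sum>i | i < length l \<and> l ! i > 0. class_count (dec i l))"
      by (intro sum.cong refl) (simp add: class_count_dec assms(1))
    also have "\<dots> = (\<Sum>i<length l. class_count (dec i l))"
      by (intro sum.mono_neutral_left) (auto simp: class_count_dec assms(1))
    finally show ?thesis .
  qed
  have "class_count (dec i (dec (Suc i) l)) =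
      (if l ! i > 0 \<and> l ! Suc i > 0 then int (card (classes (content l - {#Suc i, Suc (Suc i)#}))) else 0)"
    if i: "Suc i < length l" for i
  proof (cases "l ! Suc i > 0")
    case True
    then have "dec (Suc i) l ! j \<ge> 0" if "j < length l" for j
      using nonneg that i by (auto simp: nth_dec)
    then have "\<forall>x\<in>set (dec (Suc i) l). x \<ge> 0" by (auto simp: in_set_conv_nth)
    moreover have "content (dec (Suc i) l) - {#Suc i#} = content l - {#Suc i, Suc (Suc i)#}"
      using i True by (subst content_dec) (auto simp: multiset_eq_iff)
    ultimately show ?thesis using class_count_dec[of "dec (Suc i) l" i] i True
      by (simp add: nth_dec)
  next
    case False
    then have "dec i (dec (Suc i) l) ! Suc i < 0" using i by (simp add: nth_dec)
    moreover have "dec i (dec (Suc i) l) ! Suc i \<in> set (dec i (dec (Suc i) l))"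
      using i by (intro nth_mem) simp
    ultimately have "\<exists>x\<in>set (dec i (dec (Suc i) l)). x < 0" by blast
    then show ?thesis using False by (simp add: class_count_def)
  qed
  note two' = this
  have two: "(\<Sum>a | a \<in># content l \<and> Suc a \<in># content l. int (card (classes (content l - {#a, Suc a#})))) =
      (\<Sum>i<length l - 1. class_count (dec i (dec (Suc i) l)))"
  proof -
    have "(\<Sum>a | a \<in># content l \<and> Suc a \<in># content l. int (card (classes (content l - {#a, Suc a#})))) =
        (\<Sum>i | Suc i < length l \<and> l ! i > 0 \<and> l ! Suc i > 0.
           int (card (classes (content l - {#Suc i, Suc (Suc i)#}))))"
      unfolding pairs by (subst sum.reindex) auto
    also have "\<dots> = (\<Sum>i | Suc i < length l \<and> l ! i > 0 \<and> l ! Suc i > 0. class_count (dec i (dec (Suc i) l)))"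
      by (intro sum.cong refl) (simp add: two')
    also have "\<dots> = (\<Sum>i<length l - 1. class_count (dec i (dec (Suc i) l)))"
      by (intro sum.mono_neutral_left) (auto simp: two' split: if_splits)
    finally show ?thesis .
  qed
  have "class_count l = int (card (classes (content l)))"
    using assms(1) by (auto simp: class_count_def)
  with card_classes_rec[OF ne] show ?thesis by (simp only: one two)
qed

lemma class_count_zeros:
  assumes "\<forall>x\<in>set l. x = 0"
  shows "class_count l = 1"
proof -
  have zero: "l ! i = 0" if "i < length l" for i using that assms by simp
  have "content l = {#}"
  proof (rule multiset_eqI)
    fix a show "count (content l) a = count {#} a"
      by (cases a) (auto simp: count_content Suc_le_eq zero)
  qed
  moreover have "\<not> (\<exists>x\<in>set l. x < 0)" using assms by force
  ultimately show ?thesis by (simp add: class_count_def classes_def)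
qed

text \<open>The linear functional \<open>t ^ m \<mapsto> m!\<close>, that is, \<open>p \<mapsto> \<integral>\<^sub>0\<^sup>\<infinity> p(t) e\<^sup>-\<^sup>t dt\<close>.\<close>

definition laplace :: "complex poly \<Rightarrow> complex" where
  "laplace p = (\<Sum>i\<le>degree p. fact i * coeff p i)"

lemma laplace_eq: "degree p \<le> N \<Longrightarrow> laplace p = (\<Sum>i\<le>N. fact i * coeff p i)"
  unfolding laplace_def by (rule sum.mono_neutral_left) (auto simp: coeff_eq_0)

lemma laplace_0 [simp]: "laplace 0 = 0"
  by (simp add: laplace_def)

lemma laplace_add: "laplace (p + q) = laplace p + laplace q"
proof -
  define N where "N = max (degree p) (degree q)"
  have "degree p \<le> N" "degree q \<le> N" "degree (p + q) \<le> N"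
    by (simp_all add: N_def degree_add_le_max)
  then show ?thesis
    by (simp add: laplace_eq[of _ N] sum.distrib algebra_simps)
qed

lemma laplace_smult: "laplace (smult c p) = c * laplace p"
  by (simp add: laplace_eq[of "smult c p" "degree p"] laplace_def degree_smult_le sum_distrib_left mult_ac)

lemma laplace_diff: "laplace (p - q) = laplace p - laplace q"
  using laplace_add[of p "- q"] laplace_smult[of "-1" q] by simp

lemma laplace_sum: "laplace (sum f A) = (\<Sum>x\<in>A. laplace (f x))"
  by (induction A rule: infinite_finite_induct) (simp_all add: laplace_add)

text \<open>Integration by parts for the integral of p(t) exp(-t).\<close>

lemma laplace_pderiv: "laplace p = coeff p 0 + laplace (pderiv p)"
proof -
  have "laplace p = (\<Sum>i\<le>Suc (degree p). fact i * coeff p i)" by (rule laplace_eq) simp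
  also have "\<dots> = coeff p 0 + (\<Sum>i\<le>degree p. fact (Suc i) * coeff p (Suc i))"
    by (subst sum.atMost_Suc_shift) simp
  also have "(\<Sum>i\<le>degree p. fact (Suc i) * coeff p (Suc i)) = (\<Sum>i\<le>degree p. fact i * coeff (pderiv p) i)"
    by (intro sum.cong refl) (simp add: coeff_pderiv)
  also have "\<dots> = laplace (pderiv p)"
    by (rule laplace_eq[symmetric]) (simp add: degree_pderiv)
  finally show ?thesis .
qed

section \<open>Coefficients of the exponential series\<close>

lemma pderiv_sum: "pderiv (sum f A) = (\<Sum>x\<in>A. pderiv (f x))"
  by (induction A rule: infinite_finite_induct) (simp_all add: pderiv_add)

text \<open>The value 0 at negative indices makes differentiation a shift of the index at every
  integer.\<close>

definition divided_power :: "int \<Rightarrow> complex poly" where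
  "divided_power a = (if a < 0 then 0 else monom (1 / fact (nat a)) (nat a))"

lemma pderiv_divided_power: "pderiv (divided_power a) = divided_power (a - 1)"
proof (cases "a > 0")
  case True
  define m where "m = nat (a - 1)"
  have a: "nat a = Suc m" "nat (a - 1) = m" "\<not> a < 0" "\<not> a - 1 < 0"
    using True by (auto simp: m_def)
  have "divided_power a = monom (1 / fact (Suc m)) (Suc m)" "divided_power (a - 1) = monom (1 / fact m) m"
    using a by (simp_all only: divided_power_def if_False)
  then show ?thesis by (simp add: pderiv_monom del: of_nat_Suc)
next
  case False
  then show ?thesis by (auto simp: divided_power_def pderiv_monom)
qed

lemma coeff_divided_power_0: "coeff (divided_power a) 0 = (if a = 0 then 1 else 0)"
  by (auto simp: divided_power_def)

text \<open>The coefficient (-t)^b / b! contributed by exp(-t x_i x_{i+1}).\<close>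

definition divided_power_neg :: "int \<Rightarrow> complex poly" where
  "divided_power_neg b = smult ((-1) ^ nat b) (divided_power b)"

lemma pderiv_divided_power_neg: "pderiv (divided_power_neg b) = - divided_power_neg (b - 1)"
proof (cases "b > 0")
  case True
  then have "nat b = Suc (nat (b - 1))" by simp
  then show ?thesis
    by (simp add: divided_power_neg_def pderiv_smult pderiv_divided_power pderiv_minus)
next
  case False
  then show ?thesis
    by (simp add: divided_power_neg_def pderiv_smult pderiv_divided_power) (simp add: divided_power_def)
qed

text \<open>Applied to the exponents of x_2, x_3, ..., it removes the degree in x_2 that is used up
  by \<open>b\<close> factors x_1 x_2.\<close>

definition shift_head :: "int \<Rightarrow> int list \<Rightarrow> int list" where
  "shift_head b l = (case l of [] \<Rightarrow> [] | s # l' \<Rightarrow> (s - b) # l')"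

lemma length_shift_head [simp]: "length (shift_head b l) = length l"
  by (simp add: shift_head_def split: list.splits)

lemma shift_head_eq_Nil [simp]: "shift_head b l = [] \<longleftrightarrow> l = []"
  by (simp add: shift_head_def split: list.splits)

lemma dec_shift_head: "dec i (shift_head b l) = shift_head b (dec i l)"
  by (cases l; cases i) (simp_all add: shift_head_def dec_def)

lemma shift_head_shift_head: "shift_head a (shift_head b l) = shift_head (a + b) l"
  by (simp add: shift_head_def split: list.splits)

lemma dec_0: "l \<noteq> [] \<Longrightarrow> dec 0 l = shift_head 1 l"
  by (cases l) (simp_all add: dec_def shift_head_def)

lemma dec_0_Cons: "dec 0 (r # l) = (r - 1) # l"
  by (simp add: dec_def)

lemma dec_Suc_Cons: "dec (Suc i) (r # l) = r # dec i l"
  by (simp add: dec_def)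

text \<open>\<open>weight [r\<^sub>1, \<dots>, r\<^sub>n]\<close> is the coefficient of \<open>x\<^sub>1 ^ r\<^sub>1 \<cdots> x\<^sub>n ^ r\<^sub>n\<close> in
  \<open>exp (t (\<Sum> x\<^sub>i - \<Sum> x\<^sub>i x\<^sub>i\<^sub>+\<^sub>1))\<close>. The summation index \<open>b\<close> is the exponent of
  \<open>x\<^sub>1 x\<^sub>2\<close>.\<close>

function weight :: "int list \<Rightarrow> complex poly" where
  "weight [] = 1"
| "weight [r] = divided_power r"
| "weight (r # s # l) =
    (\<Sum>b\<in>{0..r}. divided_power_neg b * divided_power (r - b) * weight ((s - b) # l))"
  by pat_completeness auto
termination by (relation "measure length") auto

lemma weight_Cons: "l \<noteq> [] \<Longrightarrow> weight (r # l) =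
    (\<Sum>b\<in>{0..r}. divided_power_neg b * divided_power (r - b) * weight (shift_head b l))"
  by (cases l) (simp_all add: shift_head_def)

lemma weight_neg: "\<exists>x\<in>set l. x < 0 \<Longrightarrow> weight l = 0"
proof (induction l rule: weight.induct)
  case (2 r)
  then show ?case by (simp add: divided_power_def)
next
  case (3 r s l)
  show ?case
  proof (cases "r < 0")
    case False
    then have "\<exists>x\<in>set ((s - b) # l). x < 0" if "b \<in> {0..r}" for b
      using 3(2) that by auto
    then show ?thesis using 3(1) by simp
  qed simp
qed simp

text \<open>At t = 0 the exponential is 1.\<close>

lemma coeff_weight_0: "coeff (weight l) 0 = (if \<forall>x\<in>set l. x = 0 then 1 else 0)"
proof (induction l rule: weight.induct)
  case (2 r)
  then show ?case by (simp add: coeff_divided_power_0)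
next
  case (3 r s l)
  have "coeff (weight (r # s # l)) 0 =
      (\<Sum>b\<in>{0..r}. if b = 0 then (if r = 0 then coeff (weight (s # l)) 0 else 0) else 0)"
    unfolding weight.simps(3) coeff_sum
    by (intro sum.cong refl) (simp add: coeff_mult divided_power_neg_def coeff_divided_power_0)
  also have "\<dots> = (if r = 0 then coeff (weight (s # l)) 0 else 0)" by simp
  finally show ?case using 3[of 0] by (auto simp del: weight.simps split: if_splits)
qed simp

text \<open>Coefficientwise form of d/dt exp(t F) = F exp(t F): each monomial of F lowers the
  exponents of its variables. In the product rule for the recursion, the three factors yield in
  order the monomial x_1 x_2, the monomial x_1, and the monomials in the remaining
  variables.\<close>

lemma pderiv_weight: "pderiv (weight l) = (\<Sum>i<length l. weight (dec i l)) -
    (\<Sum>i<length l - 1. weight (dec i (dec (Suc i) l)))"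
proof (induction "length l" arbitrary: l)
  case 0
  then show ?case by simp
next
  case (Suc n l')
  then obtain r l where l': "l' = r # l" "length l = n" by (cases l') auto
  show ?case
  proof (cases "l = []")
    case True
    then show ?thesis by (simp add: l' pderiv_divided_power dec_def)
  next
    case False
    then obtain m where m: "length l = Suc m" by (cases l) auto
    let ?E = divided_power_neg and ?M = divided_power
    \<comment> \<open>The sum may run past \<open>q\<close> because \<open>divided_power\<close>
      vanishes at negative indices; thus heads \<open>r\<close> and \<open>r - 1\<close> can share
      one range.\<close>
    have sum0: "weight (q # l) = (\<Sum>b\<in>{0..r}. ?E b * ?M (q - b) * weight (shift_head b l))"
      if "q \<le> r" "l \<noteq> []" for q l
      unfolding weight_Cons[OF that(2)]
      by (intro sum.mono_neutral_left) (use that in \<open>auto simp: divided_power_def\<close>)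
    have "pderiv (weight (r # l)) =
        (\<Sum>b\<in>{0..r}. - (?E (b - 1) * ?M (r - b) * weight (shift_head b l))) +
        (\<Sum>b\<in>{0..r}. ?E b * ?M (r - 1 - b) * weight (shift_head b l)) +
        (\<Sum>b\<in>{0..r}. ?E b * ?M (r - b) * pderiv (weight (shift_head b l)))"
      unfolding weight_Cons[OF False] pderiv_sum pderiv_mult pderiv_divided_power
        pderiv_divided_power_neg sum.distrib[symmetric]
      by (intro sum.cong refl) (simp add: algebra_simps)
    also have "(\<Sum>b\<in>{0..r}. - (?E (b - 1) * ?M (r - b) * weight (shift_head b l))) =
        - (\<Sum>b\<in>{0..r}. ?E (b - 1) * ?M (r - b) * weight (shift_head b l))"
      by (rule sum_negf)
    \<comment> \<open>Shifting \<open>b\<close> turns one factor x_1 x_2 into a decrease of both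
      exponents. The extra term at \<open>b = -1\<close> is zero.\<close>
    also have "(\<Sum>b\<in>{0..r}. ?E (b - 1) * ?M (r - b) * weight (shift_head b l)) =
        (\<Sum>b\<in>{-1..r-1}. ?E b * ?M (r - 1 - b) * weight (shift_head b (shift_head 1 l)))"
      by (rule sum.reindex_bij_witness[of _ "\<lambda>b. b + 1" "\<lambda>b. b - 1"])
         (auto simp: shift_head_shift_head)
    also have "\<dots> = weight ((r - 1) # shift_head 1 l)"
    proof -
      have "weight ((r - 1) # shift_head 1 l) =
          (\<Sum>b\<in>{0..r-1}. ?E b * ?M (r - 1 - b) * weight (shift_head b (shift_head 1 l)))"
        using False by (intro weight_Cons) simp
      also have "\<dots> = (\<Sum>b\<in>{-1..r-1}. ?E b * ?M (r - 1 - b) * weight (shift_head b (shift_head 1 l)))"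
        by (intro sum.mono_neutral_left) (auto simp: divided_power_neg_def divided_power_def)
      finally show ?thesis ..
    qed
    also have "(\<Sum>b\<in>{0..r}. ?E b * ?M (r - 1 - b) * weight (shift_head b l)) = weight ((r - 1) # l)"
      using False by (intro sum0[symmetric]) auto
    also have "(\<Sum>b\<in>{0..r}. ?E b * ?M (r - b) * pderiv (weight (shift_head b l))) =
      (\<Sum>b\<in>{0..r}. ?E b * ?M (r - b) * ((\<Sum>i<length l. weight (shift_head b (dec i l))) -
         (\<Sum>i<length l - 1. weight (shift_head b (dec i (dec (Suc i) l))))))"
      using Suc l' by (simp add: dec_shift_head)
    also have "\<dots> = (\<Sum>i<length l. \<Sum>b\<in>{0..r}. ?E b * ?M (r - b) * weight (shift_head b (dec i l))) -
       (\<Sum>i<length l - 1. \<Sum>b\<in>{0..r}. ?E b * ?M (r - b) * weight (shift_head b (dec i (dec (Suc i) l))))"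
      unfolding right_diff_distrib sum_distrib_left sum_subtractf
      by (subst (1 2) sum.swap) simp
    also have "\<dots> = (\<Sum>i<length l. weight (r # dec i l)) -
        (\<Sum>i<length l - 1. weight (r # dec i (dec (Suc i) l)))"
    proof -
      have "weight (r # dec i l) = (\<Sum>b\<in>{0..r}. ?E b * ?M (r - b) * weight (shift_head b (dec i l)))"
        "weight (r # dec i (dec (Suc i) l)) =
         (\<Sum>b\<in>{0..r}. ?E b * ?M (r - b) * weight (shift_head b (dec i (dec (Suc i) l))))" for i
        using False by (auto intro!: weight_Cons simp: dec_def)
      then show ?thesis by simp
    qed
    finally have "pderiv (weight (r # l)) = weight ((r - 1) # l) - weight ((r - 1) # shift_head 1 l) +
        ((\<Sum>i<length l. weight (r # dec i l)) -
         (\<Sum>i<length l - 1. weight (r # dec i (dec (Suc i) l))))" by simp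
    moreover have "(\<Sum>i<length (r # l). weight (dec i (r # l))) =
        weight ((r - 1) # l) + (\<Sum>i<length l. weight (r # dec i l))"
      by (simp add: sum.lessThan_Suc_shift dec_0_Cons dec_Suc_Cons del: sum.lessThan_Suc)
    moreover have "(\<Sum>i<length l. weight (dec i (dec (Suc i) (r # l)))) =
        weight ((r - 1) # shift_head 1 l) + (\<Sum>i<length l - 1. weight (r # dec i (dec (Suc i) l)))"
      unfolding m using False
      by (simp add: sum.lessThan_Suc_shift dec_0_Cons dec_Suc_Cons dec_0 del: sum.lessThan_Suc)
    ultimately show ?thesis by (simp add: l')
  qed
qed

text \<open>The Cartier-Foata identity. By \<open>laplace_pderiv\<close> and
  \<open>pderiv_weight\<close> the right-hand side obeys the recurrence of
  \<open>class_count_rec\<close>, and the constant coefficient supplies the value 1 at the zero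
  vector.\<close>

lemma of_int_class_count: "of_int (class_count l) = laplace (weight l)"
proof (induction "nat (sum_list l)" arbitrary: l rule: less_induct)
  case less
  show ?case
  proof (cases "\<exists>x\<in>set l. x < 0")
    case True
    then show ?thesis by (simp add: class_count_def weight_neg)
  next
    case False
    then have nonneg: "\<forall>x\<in>set l. x \<ge> 0" by auto
    have rec: "laplace (weight l) = coeff (weight l) 0 + (\<Sum>i<length l. laplace (weight (dec i l))) -
        (\<Sum>i<length l - 1. laplace (weight (dec i (dec (Suc i) l))))"
      by (subst laplace_pderiv) (simp add: pderiv_weight laplace_diff laplace_sum)
    show ?thesis
    proof (cases "\<forall>x\<in>set l. x = 0")
      case True
      have neg: "\<exists>x\<in>set (dec i l'). x < 0" if "i < length l'" "l' ! i = 0" for i l'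
        using that nth_mem[of i "dec i l'"] by (intro bexI[of _ "dec i l' ! i"]) (auto simp: nth_dec)
      have "weight (dec i l) = 0" if "i < length l" for i
        using that True by (intro weight_neg neg) auto
      moreover have "weight (dec i (dec (Suc i) l)) = 0" if "i < length l - 1" for i
        using that True by (intro weight_neg neg) (auto simp: nth_dec)
      ultimately show ?thesis using rec True by (simp add: class_count_zeros coeff_weight_0)
    next
      case nonzero: False
      have sum_dec: "sum_list (dec i l') = sum_list l' - 1" if "i < length l'" for i and l' :: "int list"
        using that unfolding dec_def
      proof (induction l' arbitrary: i)
        case (Cons a l') then show ?case by (cases i) auto
      qed simp
      have "sum_list l \<noteq> 0" using nonzero nonneg by (subst sum_list_nonneg_eq_0_iff) auto
      moreover have "sum_list l \<ge> 0" using nonneg by (intro sum_list_nonneg) auto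
      ultimately have pos: "sum_list l > 0" by simp
      have "of_int (class_count (dec i l)) = laplace (weight (dec i l))" if "i < length l" for i
        using that pos by (intro less) (simp add: sum_dec)
      moreover have "of_int (class_count (dec i (dec (Suc i) l))) = laplace (weight (dec i (dec (Suc i) l)))"
        if "i < length l - 1" for i
        using that pos by (intro less) (simp add: sum_dec)
      ultimately show ?thesis
        using rec nonzero nonneg by (subst class_count_rec) (auto simp: coeff_weight_0)
    qed
  qed
qed

text \<open>Of the \<open>k\<close> occurrences of a letter, \<open>c\<close> are used by products
  with its predecessor, \<open>b\<close> by products with its successor, and
  \<open>k - c - b\<close> by the linear monomial. The entry collects the resulting sign and
  factorials; the power of t, which depends on \<open>c\<close> only, is split off in
  \<open>transfer_vec\<close>.\<close>

definition transfer :: "nat \<Rightarrow> nat \<Rightarrow> nat \<Rightarrow> complex" where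
  "transfer k c b = (if b \<le> k - c then (-1) ^ b / (fact b * fact (k - c - b)) else 0)"

text \<open>The initial vector expresses that the last letter has no products with a
  successor.\<close>

fun transfer_vec :: "nat \<Rightarrow> nat \<Rightarrow> nat \<Rightarrow> complex poly" where
  "transfer_vec k 0 c = (if c = 0 then 1 else 0)"
| "transfer_vec k (Suc n) c =
    monom 1 (k - c) * (\<Sum>b\<le>k. smult (transfer k c b) (transfer_vec k n b))"

lemma transfer_vec_eq_weight:
  "c \<le> k \<Longrightarrow> transfer_vec k (Suc n) c = weight (int (k - c) # replicate n (int k))"
proof (induction n arbitrary: c)
  case 0
  have "(\<Sum>b\<le>k. smult (transfer k c b) (transfer_vec k 0 b)) = [:transfer k c 0:]"
    by (subst sum.remove[of _ 0]) (auto intro!: sum.neutral)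
  then show ?case by (simp add: divided_power_def transfer_def mult_monom flip: monom_0)
next
  case (Suc n)
  have product: "divided_power_neg (int b) * divided_power (int (k - c) - int b) =
      smult (transfer k c b) (monom 1 (k - c))" if "b \<le> k - c" for b
  proof -
    have "nat (int (k - c) - int b) = k - c - b" by simp
    moreover have "b + (k - c - b) = k - c" using that by simp
    ultimately show ?thesis using that
      by (simp add: divided_power_neg_def divided_power_def transfer_def mult_monom smult_monom
          del: diff_diff_left)
  qed
  have "weight (int (k - c) # replicate (Suc n) (int k)) =
      (\<Sum>b\<in>{0..int (k - c)}. divided_power_neg b * divided_power (int (k - c) - b) *
        weight ((int k - b) # replicate n (int k)))"
    by simp
  also have "\<dots> = (\<Sum>b\<le>k - c. divided_power_neg (int b) * divided_power (int (k - c) - int b) *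
        weight ((int k - int b) # replicate n (int k)))"
    by (rule sum.reindex_bij_witness[of _ int nat]) auto
  also have "\<dots> = (\<Sum>b\<le>k - c. smult (transfer k c b) (monom 1 (k - c)) * transfer_vec k (Suc n) b)"
  proof (intro sum.cong refl)
    fix b assume b: "b \<in> {..k - c}"
    then have "int k - int b = int (k - b)" by (simp add: of_nat_diff)
    then show "divided_power_neg (int b) * divided_power (int (k - c) - int b) *
        weight ((int k - int b) # replicate n (int k)) =
        smult (transfer k c b) (monom 1 (k - c)) * transfer_vec k (Suc n) b"
      using b Suc.IH[of b] by (simp only: product atMost_iff)
  qed
  also have "\<dots> = (\<Sum>b\<le>k. smult (transfer k c b) (monom 1 (k - c)) * transfer_vec k (Suc n) b)"
    by (intro sum.mono_neutral_left) (auto simp: transfer_def)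
  also have "\<dots> = transfer_vec k (Suc (Suc n)) c"
    unfolding transfer_vec.simps(2)[of k "Suc n"] sum_distrib_left by (intro sum.cong refl) simp
  finally show ?case ..
qed

lemma num_classes_eq_laplace: "of_nat (num_classes n k) = laplace (transfer_vec k n 0)"
proof (cases n)
  case 0
  then show ?thesis by (simp add: num_classes_0 laplace_def)
next
  case (Suc m)
  have "content (replicate n (int k)) = (\<Sum>i=1..n. replicate_mset k i)"
    by (simp add: content_def sum.atLeast1_atMost_eq)
  then have "int (num_classes n k) = class_count (replicate n (int k))"
    by (simp add: class_count_def num_classes_eq)
  then have "of_nat (num_classes n k) = (of_int (class_count (replicate n (int k))) :: complex)"
    by (metis of_int_of_nat_eq)
  then show ?thesis
    using Suc by (simp only: of_int_class_count transfer_vec_eq_weight[OF le0] diff_zero replicate_Suc)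
qed

text \<open>Hence a given power of x meets only finitely many powers of t, which later makes the sum
  over m converge x-adically.\<close>

lemma degree_transfer_vec: "degree (transfer_vec k n c) \<le> n * k"
proof (induction n arbitrary: c)
  case (Suc n)
  have "degree (\<Sum>b\<le>k. smult (transfer k c b) (transfer_vec k n b)) \<le> n * k"
    by (intro degree_sum_le) (auto intro: order.trans[OF degree_smult_le] Suc)
  then have "degree (monom (1::complex) (k - c)) + degree (\<Sum>b\<le>k. smult (transfer k c b) (transfer_vec k n b)) \<le> k + n * k"
    using degree_monom_le[of "1::complex" "k - c"] by linarith
  then show ?case using degree_mult_le[of "monom 1 (k - c)" "\<Sum>b\<le>k. smult (transfer k c b) (transfer_vec k n b)"]
    by simp
qed simp


section \<open>The Newton--Puiseux theorem\<close>

lemma map_poly_mult_hom: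
  fixes f :: "'a::comm_ring_1 \<Rightarrow> 'b::comm_ring_1"
  assumes "f 0 = 0" "\<And>x y. f (x + y) = f x + f y" "\<And>x y. f (x * y) = f x * f y"
  shows "map_poly f (p * q) = map_poly f p * map_poly f q"
proof (rule poly_eqI)
  fix n
  have f_sum: "f (sum g A) = (\<Sum>x\<in>A. f (g x))" for g and A :: "nat set"
    by (induction A rule: infinite_finite_induct) (simp_all add: assms)
  show "coeff (map_poly f (p * q)) n = coeff (map_poly f p * map_poly f q) n"
    by (simp add: coeff_map_poly assms coeff_mult f_sum)
qed

text \<open>Reducing one Bezout cofactor modulo \<open>g\<close> bounds its degree; the bound on
  \<open>r\<close> then forces the bound on the other.\<close>

lemma coprime_poly_bezout_degree:
  fixes g h r :: "'a::field_gcd poly"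
  assumes "coprime g h" "degree g > 0" "degree h > 0" "degree r < degree g + degree h"
  obtains a b where "r = g * a + h * b" "degree a < degree h" "degree b < degree g"
proof -
  obtain s t where "s * g + t * h = 1"
    using bezout_coefficients_fst_snd[of g h] assms(1) by (auto simp: coprime_iff_gcd_eq_1)
  define b where "b = (r * t) mod g"
  define q where "q = (r * t) div g"
  define a where "a = r * s + h * q"
  have rt: "g * q + b = r * t" by (simp add: q_def b_def)
  have "g * a + h * b = g * r * s + h * (g * q + b)"
    by (simp add: a_def algebra_simps)
  also have "\<dots> = r * (s * g + t * h)" by (simp only: rt) (simp add: algebra_simps)
  finally have r: "r = g * a + h * b" using \<open>s * g + t * h = 1\<close> by simp
  have b: "degree b < degree g"
  proof (cases "r * t mod g = 0")
    case False
    then show ?thesis using degree_mod_less[of g "r * t"] assms(2) by (metis b_def degree_0 less_numeral_extra(3))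
  qed (use assms(2) in \<open>simp add: b_def\<close>)
  have "degree (h * b) < degree g + degree h"
    using degree_mult_le[of h b] b by simp
  then have "degree (g * a) < degree g + degree h"
    using assms(4) r degree_diff_less[of r "degree g + degree h" "h * b"] by (simp add: algebra_simps)
  moreover have "g \<noteq> 0" using assms(2) by auto
  ultimately have "degree a < degree h"
    using assms(3) by (cases "a = 0") (auto simp: degree_mult_eq)
  then show thesis using that r b by blast
qed

text \<open>At order \<open>k\<close> the new unknowns enter only through
  \<open>g * H k + h * G k\<close>; all other products involve earlier terms. Coprimality solves
  this linear equation with degrees below those of \<open>g\<close> and \<open>h\<close>, so the
  degrees of the lifts stay bounded.\<close>

lemma hensel_sequences:
  fixes P :: "nat \<Rightarrow> 'a::field_gcd poly"
  assumes "coprime g h" "degree g > 0" "degree h > 0" "P 0 = g * h"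
    and deg: "\<And>k. k > 0 \<Longrightarrow> degree (P k) < degree g + degree h"
  obtains G H where "G 0 = g" "H 0 = h" "\<And>k. P k = (\<Sum>i\<le>k. G i * H (k - i))"
    "\<And>k. k > 0 \<Longrightarrow> degree (G k) < degree g" "\<And>k. k > 0 \<Longrightarrow> degree (H k) < degree h"
proof -
  define R where "R = (\<lambda>f k (x, y). if k = 0 then x = g \<and> y = h else
      degree x < degree g \<and> degree y < degree h \<and>
      P k = g * y + h * x + (\<Sum>i\<in>{0<..<k}. fst (f i) * snd (f (k - i))))"
  have "\<exists>f. \<forall>k. R f k (f k)"
  proof (rule dependent_wellorder_choice)
    fix f f' :: "nat \<Rightarrow> 'a poly \<times> 'a poly" and k :: nat and r
    assume eq: "\<And>i. i < k \<Longrightarrow> f i = f' i"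
    have "(\<Sum>i\<in>{0<..<k}. fst (f i) * snd (f (k - i))) = (\<Sum>i\<in>{0<..<k}. fst (f' i) * snd (f' (k - i)))"
      by (intro sum.cong) (auto simp: eq)
    then show "R f k r = R f' k r" unfolding R_def by simp
  next
    fix k :: nat and f :: "nat \<Rightarrow> 'a poly \<times> 'a poly"
    assume IH: "\<And>i. i < k \<Longrightarrow> R f i (f i)"
    show "\<exists>r. R f k r"
    proof (cases "k = 0")
      case True
      then show ?thesis by (auto simp: R_def)
    next
      case False
      let ?S = "\<Sum>i\<in>{0<..<k}. fst (f i) * snd (f (k - i))"
      have "degree ?S < degree g + degree h"
      proof (rule degree_sum_less)
        fix i assume "i \<in> {0<..<k}"
        then have "degree (fst (f i)) < degree g" "degree (snd (f (k - i))) < degree h"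
          using IH[of i] IH[of "k - i"] by (auto simp: R_def split: prod.splits)
        then show "degree (fst (f i) * snd (f (k - i))) < degree g + degree h"
          using degree_mult_le[of "fst (f i)" "snd (f (k - i))"] by linarith
      qed (use assms in auto)
      then have "degree (P k - ?S) < degree g + degree h"
        using deg[of k] False by (intro degree_diff_less) auto
      then obtain a b where "P k - ?S = g * a + h * b" "degree a < degree h" "degree b < degree g"
        by (rule coprime_poly_bezout_degree[OF assms(1-3)])
      then have "P k = g * a + h * b + ?S" by (simp only: diff_eq_eq)
      \<comment> \<open>The cofactor of \<open>g\<close> is the correction to \<open>h\<close> and
        conversely, hence the exchanged order.\<close>
      then have "R f k (b, a)"
        using False \<open>degree a < degree h\<close> \<open>degree b < degree g\<close> by (simp add: R_def)
      then show ?thesis ..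
    qed
  qed
  then obtain f where f: "R f k (f k)" for k by blast
  define G H where "G = (\<lambda>k. fst (f k))" and "H = (\<lambda>k. snd (f k))"
  have GH0: "G 0 = g" "H 0 = h" using f[of 0] by (auto simp: R_def G_def H_def split: prod.splits)
  have GH: "degree (G k) < degree g" "degree (H k) < degree h"
    "P k = g * H k + h * G k + (\<Sum>i\<in>{0<..<k}. G i * H (k - i))" if "k > 0" for k
    using f[of k] that by (auto simp: R_def G_def H_def split: prod.splits)
  have "P k = (\<Sum>i\<le>k. G i * H (k - i))" for k
  proof (cases "k = 0")
    case False
    have "(\<Sum>i\<le>k. G i * H (k - i)) = (\<Sum>i\<in>insert 0 (insert k {0<..<k}). G i * H (k - i))"
      using False by (intro sum.cong) auto
    then show ?thesis using False GH(3)[of k] by (simp add: GH0 mult.commute)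
  qed (simp add: GH0 assms)
  then show thesis using that[of G H] GH0 GH by blast
qed

text \<open>The polynomial over power series is read as a power series with polynomial coefficients
  \<open>P k\<close>, which \<open>hensel_sequences\<close> factors order by order.\<close>

lemma hensel_fps_poly:
  fixes p :: "'a::field_gcd fps poly"
  assumes "lead_coeff p = 1" "map_poly (\<lambda>f. fps_nth f 0) p = g * h"
    "coprime g h" "degree g > 0" "degree h > 0"
  obtains a b where "p = a * b" "degree a > 0" "degree b > 0"
proof -
  define P where "P = (\<lambda>k. map_poly (\<lambda>f. fps_nth f k) p)"
  have coeff_P: "coeff (P k) i = fps_nth (coeff p i) k" for k i
    by (simp add: P_def coeff_map_poly)
  have "degree (P 0) = degree p"
    unfolding P_def using assms(1) by (intro map_poly_degree_eq) auto
  moreover have "g \<noteq> 0" "h \<noteq> 0" using assms(4,5) by auto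
  ultimately have deg: "degree p = degree g + degree h"
    using assms(2) by (simp add: P_def degree_mult_eq)
  \<comment> \<open>The leading coefficient is the constant series 1 and contributes to order 0
    only.\<close>
  have "degree (P k) < degree g + degree h" if "k > 0" for k
    unfolding deg[symmetric]
  proof (rule degree_lessI)
    show "P k \<noteq> 0 \<or> degree p > 0" using deg assms(4) by simp
    show "\<forall>i\<ge>degree p. coeff (P k) i = 0"
    proof (intro allI impI)
      fix i assume "i \<ge> degree p"
      then show "coeff (P k) i = 0"
        using assms(1) that unfolding coeff_P by (cases "i = degree p") (simp_all add: coeff_eq_0)
    qed
  qed
  then obtain G H where GH0: "G 0 = g" "H 0 = h" and GH: "\<And>k. P k = (\<Sum>i\<le>k. G i * H (k - i))"
    "\<And>k. k > 0 \<Longrightarrow> degree (G k) < degree g" "\<And>k. k > 0 \<Longrightarrow> degree (H k) < degree h"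
    using hensel_sequences[of g h P] assms by (auto simp: P_def)
  \<comment> \<open>The way back from a sequence of polynomials to a polynomial over power series;
    it needs a degree bound that is uniform in \<open>k\<close>.\<close>
  define lift where "lift = (\<lambda>G :: nat \<Rightarrow> 'a poly. Abs_poly (\<lambda>i. Abs_fps (\<lambda>k. coeff (G k) i)))"
  have coeff_lift: "fps_nth (coeff (lift F) i) k = coeff (F k) i"
    if "\<And>k. degree (F k) \<le> n" for F :: "nat \<Rightarrow> 'a poly" and n i k
  proof -
    have "coeff (lift F) = (\<lambda>i. Abs_fps (\<lambda>k. coeff (F k) i))"
      unfolding lift_def
    proof (rule coeff_Abs_poly)
      fix i assume "i > n"
      then show "Abs_fps (\<lambda>k. coeff (F k) i) = 0"
        by (intro fps_ext) (auto intro!: coeff_eq_0 le_less_trans[OF that])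
    qed
    then show ?thesis by simp
  qed
  have degG: "degree (G k) \<le> degree g" and degH: "degree (H k) \<le> degree h" for k
    using GH0 GH(2)[of k] GH(3)[of k] by (cases "k = 0"; simp)+
  note coeff_G = coeff_lift[of G, OF degG] and coeff_H = coeff_lift[of H, OF degH]
  show thesis
  proof (rule that)
    show "p = lift G * lift H"
    proof (intro poly_eqI fps_ext)
      fix n k
      have "fps_nth (coeff (lift G * lift H) n) k =
          (\<Sum>i\<le>n. \<Sum>j\<le>k. coeff (G j) i * coeff (H (k - j)) (n - i))"
        by (simp add: coeff_mult fps_sum_nth fps_mult_nth coeff_G coeff_H atLeast0AtMost)
      also have "\<dots> = coeff (P k) n"
        unfolding GH(1) coeff_sum coeff_mult by (rule sum.swap)
      finally show "fps_nth (coeff p n) k = fps_nth (coeff (lift G * lift H) n) k"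
        by (simp add: coeff_P)
    qed
    have "fps_nth (coeff (lift G) (degree g)) 0 \<noteq> 0" "fps_nth (coeff (lift H) (degree h)) 0 \<noteq> 0"
      using assms by (auto simp: coeff_G coeff_H GH0)
    then show "degree (lift G) > 0" "degree (lift H) > 0"
      using le_degree[of "lift G" "degree g"] le_degree[of "lift H" "degree h"] assms by fastforce+
  qed
qed

section \<open>Monomials, leading exponents and integral series\<close>

lift_definition puiseux_monom :: "rat \<Rightarrow> 'a::zero_neq_one puiseux" is
  "\<lambda>r e. if e = r then 1 else 0"
proof -
  fix r :: rat
  obtain a b where "quotient_of r = (a, b)" by fastforce
  then have "r = of_int a / of_nat (nat b)" "nat b > 0"
    using quotient_of_div quotient_of_denom_pos by fastforce+
  then show "\<exists>N>0. \<exists>j0. \<forall>e::rat. (if e = r then 1 else 0::'a) \<noteq> 0 \<longrightarrow> (\<exists>j\<ge>j0. e = of_int j / of_nat N)"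
    by (intro exI[of _ "nat b"] conjI exI[of _ a]) auto
qed

lemma puiseux_nth_monom_mult:
  fixes f :: "'a::comm_ring_1 puiseux"
  shows "puiseux_nth (puiseux_monom r * f) e = puiseux_nth f (e - r)"
proof -
  have "{a. puiseux_nth (puiseux_monom r :: 'a puiseux) a \<noteq> 0 \<and> puiseux_nth f (e - a) \<noteq> 0} =
      (if puiseux_nth f (e - r) = 0 then {} else {r})"
    by (auto simp: puiseux_monom.rep_eq split: if_splits)
  then show ?thesis by (simp add: times_puiseux.rep_eq) (simp add: puiseux_monom.rep_eq)
qed

lemma puiseux_monom_mult:
  "puiseux_monom r * puiseux_monom s = (puiseux_monom (r + s) :: 'a::comm_ring_1 puiseux)"
  by (rule puiseux_eqI) (auto simp: puiseux_nth_monom_mult puiseux_monom.rep_eq)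

lemma puiseux_monom_0: "puiseux_monom 0 = 1"
  by (rule puiseux_eqI) (simp add: puiseux_monom.rep_eq one_puiseux.rep_eq)

lemma puiseux_monom_power:
  "puiseux_monom r ^ n = (puiseux_monom (of_nat n * r) :: 'a::comm_ring_1 puiseux)"
  by (induction n) (simp_all add: puiseux_monom_0 puiseux_monom_mult algebra_simps)

lemma puiseux_leading_exponent:
  fixes f :: "'a::comm_ring_1 puiseux"
  assumes "f \<noteq> 0"
  obtains e where "puiseux_nth f e \<noteq> 0" "\<And>e'. e' < e \<Longrightarrow> puiseux_nth f e' = 0"
proof -
  obtain N F where N: "N > 0" "f = puiseux_of_fls N F" by (rule puiseux_common1)
  with assms have F: "F \<noteq> 0" by (auto simp: puiseux_of_fls_0)
  show thesis
  proof (rule that)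
    show "puiseux_nth f (of_int (fls_subdegree F) / of_nat N) \<noteq> 0"
      using N F by (simp add: puiseux_nth_of_fls)
    show "puiseux_nth f e = 0" if "e < of_int (fls_subdegree F) / of_nat N" for e
    proof -
      have "of_nat N * e < of_int (fls_subdegree F)" using that N by (simp add: field_simps)
      then have "\<lfloor>of_nat N * e\<rfloor> < fls_subdegree F" by (simp add: floor_less_iff)
      then show ?thesis by (simp add: N puiseux_of_fls.rep_eq)
    qed
  qed
qed

definition puiseux_of_fps_root :: "nat \<Rightarrow> 'a::zero fps \<Rightarrow> 'a puiseux" where
  "puiseux_of_fps_root N F = puiseux_of_fls N (fps_to_fls F)"

lemma puiseux_of_fps_root_hom:
  "puiseux_of_fps_root N 0 = (0 :: 'a::zero puiseux)"
  "N > 0 \<Longrightarrow> puiseux_of_fps_root N 1 = (1 :: 'b::comm_ring_1 puiseux)"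
  "puiseux_of_fps_root N (f + g) = puiseux_of_fps_root N f + (puiseux_of_fps_root N g :: 'b puiseux)"
  "puiseux_of_fps_root N (f * g) = puiseux_of_fps_root N f * (puiseux_of_fps_root N g :: 'b puiseux)"
  by (simp_all add: puiseux_of_fps_root_def puiseux_of_fls_hom fls_times_fps_to_fls)

lemma puiseux_nth_of_fps_root_0:
  "N > 0 \<Longrightarrow> puiseux_nth (puiseux_of_fps_root N f) 0 = fps_nth f 0"
  by (simp add: puiseux_of_fps_root_def puiseux_of_fls.rep_eq)

lemma finite_puiseux_common:
  assumes "finite A"
  shows "\<exists>N>0. \<forall>M>0. \<forall>f\<in>A. \<exists>F. f = puiseux_of_fls (N * M) F"
  using assms
proof (induction A rule: finite_induct)
  case (insert f A)
  obtain N where N: "N > 0" "\<And>M. M > 0 \<Longrightarrow> \<forall>f\<in>A. \<exists>F. f = puiseux_of_fls (N * M) F"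
    using insert by blast
  obtain N' where N': "N' > 0" "\<And>M. M > 0 \<Longrightarrow> \<exists>F. f = puiseux_of_fls (N' * M) F"
    using puiseux_denominator by blast
  have "\<forall>g\<in>insert f A. \<exists>F. g = puiseux_of_fls (N * N' * M) F" if "M > 0" for M
    using N(2)[of "N' * M"] N'(2)[of "N * M"] that N(1) N'(1) by (simp add: mult_ac)
  then show ?case using N(1) N'(1) by (metis nat_0_less_mult_iff)
qed auto

lemma integral_puiseux_of_fps_root:
  assumes "N > 0" "f = puiseux_of_fls N F" "\<And>e. e < 0 \<Longrightarrow> puiseux_nth f e = 0"
  shows "f = puiseux_of_fps_root N (fls_regpart F)"
proof -
  have "fls_nth F j = 0" if "j < 0" for j
    using assms puiseux_nth_of_fls[of N F j] that
    by (metis divide_neg_pos of_int_less_0_iff of_nat_0_less_iff)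
  then have "F = fps_to_fls (fls_regpart F)" by (intro fls_eqI) simp
  then show ?thesis using assms(2) by (simp add: puiseux_of_fps_root_def)
qed

text \<open>With a single root x the polynomial would be (X - x)^n. Its subleading coefficient -n x
  vanishes only for x = 0 in characteristic 0, and X^n has no nonzero lower coefficient.\<close>

lemma poly_two_roots:
  fixes p :: "'a::{alg_closed_field, field_char_0} poly"
  assumes "lead_coeff p = 1" "degree p > 0" "coeff p (degree p - 1) = 0"
    "i < degree p" "coeff p i \<noteq> 0"
  obtains x y where "poly p x = 0" "poly p y = 0" "x \<noteq> y"
proof -
  define n where "n = degree p"
  have "p \<noteq> 0" using assms(1) by auto
  then obtain A where A: "size A = n" "p = (\<Prod>x\<in>#A. [:-x, 1:])"
    using alg_closed_imp_factorization[of p] assms(1) n_def by auto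
  have root: "poly p x = 0" if "x \<in># A" for x
    using that by (auto simp: A(2) poly_prod_mset dest!: multi_member_split)
  have "A \<noteq> {#}" using A(1) assms(2) n_def by auto
  then obtain x where x: "x \<in># A" by blast
  have "\<exists>y. y \<in># A \<and> y \<noteq> x"
  proof (rule ccontr)
    assume "\<not> (\<exists>y. y \<in># A \<and> y \<noteq> x)"
    then have "A = replicate_mset n x"
      using A(1) by (metis set_mset_subset_singletonD singletonI subsetI)
    then have p: "p = [:-x, 1:] ^ n" using A(2) by simp
    have "coeff p (n - 1) = of_nat (n choose (n - 1)) * (- x)"
      unfolding p using assms(2) n_def by (subst coeff_linear_poly_power) (auto simp: Suc_diff_Suc)
    moreover have "n choose (n - 1) = n"
      using assms(2) n_def binomial_symmetric[of 1 n] by simp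
    ultimately have "x = 0"
      using assms(2,3) n_def by simp
    moreover have "i < n" using assms(4) n_def by simp
    ultimately have "coeff p i = 0" unfolding p by (simp add: coeff_linear_poly_power)
    then show False using assms(5) by simp
  qed
  then show thesis using that root x by blast
qed

text \<open>The slope of the Newton polygon: with v_i the order of the i-th coefficient and n the
  degree, \<open>r\<close> is the minimum of v_i / (n - i). Replacing X by x^r X and dividing by
  x^(n r) makes all coefficients integral, and an index attaining the minimum keeps a nonzero
  constant term.\<close>

lemma puiseux_poly_rescale:
  fixes p :: "'a::comm_ring_1 puiseux poly"
  assumes p: "lead_coeff p = 1" "degree p > 0" and low: "i < degree p" "coeff p i \<noteq> 0"
  obtains r i0 where "i0 < degree p"
    "puiseux_nth (puiseux_monom (of_nat i0 * r - of_nat (degree p) * r) * coeff p i0) 0 \<noteq> 0"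
    "\<And>i e. e < 0 \<Longrightarrow> puiseux_nth (puiseux_monom (of_nat i * r - of_nat (degree p) * r) * coeff p i) e = 0"
proof -
  define n where "n = degree p"
  define I where "I = {i. i < n \<and> coeff p i \<noteq> 0}"
  have "\<exists>v. puiseux_nth (coeff p i) v \<noteq> 0 \<and> (\<forall>e<v. puiseux_nth (coeff p i) e = 0)"
    if "coeff p i \<noteq> 0" for i
    using puiseux_leading_exponent[OF that] by metis
  then obtain v where "\<forall>i. coeff p i \<noteq> 0 \<longrightarrow>
      puiseux_nth (coeff p i) (v i) \<noteq> 0 \<and> (\<forall>e<v i. puiseux_nth (coeff p i) e = 0)" by metis
  then have v: "\<And>i. coeff p i \<noteq> 0 \<Longrightarrow> puiseux_nth (coeff p i) (v i) \<noteq> 0"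
    "\<And>i e. coeff p i \<noteq> 0 \<Longrightarrow> e < v i \<Longrightarrow> puiseux_nth (coeff p i) e = 0" by blast+
  define R where "R = (\<lambda>i. v i / of_nat (n - i)) ` I"
  have fin: "finite R" "R \<noteq> {}" using low by (auto simp: R_def I_def n_def)
  define r where "r = Min R"
  have "r \<in> R" using fin by (simp add: r_def)
  then obtain i0 where i0: "i0 < n" "coeff p i0 \<noteq> 0" "r = v i0 / of_nat (n - i0)"
    by (auto simp: R_def I_def)
  have le: "of_nat (n - i) * r \<le> v i" if "i < n" "coeff p i \<noteq> 0" for i
  proof -
    have "v i / of_nat (n - i) \<in> R" using that by (auto simp: R_def I_def)
    then have "r \<le> v i / of_nat (n - i)" using fin by (simp add: r_def)
    then show ?thesis using that by (simp add: field_simps)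
  qed
  show thesis
  proof (rule that)
    show "i0 < degree p" using i0 n_def by simp
    have "0 - (of_nat i0 * r - of_nat (degree p) * r) = v i0"
      using i0 by (simp add: n_def[symmetric] of_nat_diff field_simps)
    then show "puiseux_nth (puiseux_monom (of_nat i0 * r - of_nat (degree p) * r) * coeff p i0) 0 \<noteq> 0"
      unfolding puiseux_nth_monom_mult using v i0 by simp
    fix i and e :: rat assume e: "e < 0"
    consider "i > n" | "i = n" | "i < n" "coeff p i = 0" | "i < n" "coeff p i \<noteq> 0" by linarith
    then show "puiseux_nth (puiseux_monom (of_nat i * r - of_nat (degree p) * r) * coeff p i) e = 0"
    proof cases
      case 1 then show ?thesis by (simp add: coeff_eq_0 n_def zero_puiseux.rep_eq)
    next
      case 2 then show ?thesis using e p(1) by (simp add: n_def puiseux_nth_monom_mult one_puiseux.rep_eq puiseux_monom.rep_eq)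
    next
      case 3 then show ?thesis by (simp add: zero_puiseux.rep_eq)
    next
      case 4
      have "e - (of_nat i * r - of_nat (degree p) * r) < v i"
        using le[OF 4] e 4(1) by (simp add: n_def[symmetric] of_nat_diff algebra_simps)
      then show ?thesis unfolding puiseux_nth_monom_mult using v(2)[OF 4(2)] by blast
    qed
  qed
qed

text \<open>Newton--Puiseux: after rescaling, the reduction of the polynomial modulo the maximal ideal
  is not a power of a linear factor, so that Hensel's lemma splits it.\<close>

instance puiseux :: ("{alg_closed_field, field_char_0, field_gcd}") alg_closed_field
proof (rule alg_closedI_reducible_coeff_deg_minus_one_eq_0)
  \<comment> \<open>Only polynomials without subleading term have to be split. This property passes
    to the reduction \<open>s\<close> below and gives it two distinct roots.\<close>
  fix p :: "'a puiseux poly"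
  assume p: "degree p > 1" "lead_coeff p = 1" "coeff p (degree p - 1) = 0" "coeff p 0 \<noteq> 0"
  define n where "n = degree p"
  obtain r i0 where i0: "i0 < n"
    "puiseux_nth (puiseux_monom (of_nat i0 * r - of_nat n * r) * coeff p i0) 0 \<noteq> 0"
    and int: "\<And>i e. e < 0 \<Longrightarrow> puiseux_nth (puiseux_monom (of_nat i * r - of_nat n * r) * coeff p i) e = 0"
    using puiseux_poly_rescale[of p 0] p unfolding n_def by (metis gr_implies_not0 neq0_conv less_trans zero_less_one)
  \<comment> \<open>This is x^(-n r) p(x^r X), again monic.\<close>
  define q where "q = smult (puiseux_monom (- of_nat n * r)) (pcompose p [:0, puiseux_monom r:])"
  have coeff_q: "coeff q i = puiseux_monom (of_nat i * r - of_nat n * r) * coeff p i" for i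
    by (simp add: q_def coeff_pcompose_linear puiseux_monom_power puiseux_monom_mult flip: mult.assoc)
  have p_eq: "p = smult (puiseux_monom (of_nat n * r)) (pcompose q [:0, puiseux_monom (- r):])"
    by (rule poly_eqI)
       (simp add: coeff_pcompose_linear coeff_q puiseux_monom_power puiseux_monom_mult puiseux_monom_0
          flip: mult.assoc)
  have monom_nz: "puiseux_monom s \<noteq> (0 :: 'a puiseux)" for s
    by (metis mult_zero_left puiseux_monom_0 puiseux_monom_mult right_minus zero_neq_one)
  have deg_q: "degree q = n"
    by (simp add: q_def monom_nz n_def degree_pcompose)
  obtain N where N: "N > 0" "\<forall>f\<in>coeff q ` {..n}. \<exists>F. f = puiseux_of_fls N F"
    using finite_puiseux_common[of "coeff q ` {..n}"] by (metis finite_atMost finite_imageI mult.right_neutral zero_less_one)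
  have "\<exists>F. coeff q i = puiseux_of_fps_root N F \<and> (i > n \<longrightarrow> F = 0)" for i
  proof (cases "i \<le> n")
    case True
    then obtain F where "coeff q i = puiseux_of_fls N F" using N(2) by auto
    then have "coeff q i = puiseux_of_fps_root N (fls_regpart F)"
      using int unfolding coeff_q by (intro integral_puiseux_of_fps_root N(1)) blast+
    then show ?thesis using True by auto
  next
    case False
    then have "coeff q i = puiseux_of_fps_root N 0"
      using deg_q by (simp add: coeff_eq_0 puiseux_of_fps_root_hom)
    then show ?thesis by blast
  qed
  then obtain Q where Q: "\<And>i. coeff q i = puiseux_of_fps_root N (Q i)" "\<And>i. i > n \<Longrightarrow> Q i = 0"
    by metis
  define q' where "q' = Abs_poly Q"
  have coeff_q': "coeff q' = Q" unfolding q'_def using Q(2) by (rule coeff_Abs_poly)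
  have q_eq: "q = map_poly (puiseux_of_fps_root N) q'"
    by (rule poly_eqI) (simp add: coeff_map_poly puiseux_of_fps_root_hom Q coeff_q')
  have root_eq_iff: "puiseux_of_fps_root N f = puiseux_of_fps_root N g \<longleftrightarrow> f = g" for f g :: "'a fps"
    using N(1) by (auto simp: puiseux_of_fps_root_def puiseux_of_fls_eq_iff)
  have "coeff q n = 1" using p(2) by (simp add: coeff_q n_def puiseux_monom_0)
  then have "puiseux_of_fps_root N (Q n) = puiseux_of_fps_root N 1"
    using Q N(1) by (simp add: puiseux_of_fps_root_hom)
  then have Qn: "Q n = 1" by (simp only: root_eq_iff)
  have deg_q': "degree q' = n"
    using Q(2) Qn by (intro antisym degree_le le_degree) (auto simp: coeff_q')
  define s where "s = map_poly (\<lambda>f. fps_nth f 0) q'"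
  have coeff_s: "coeff s i = puiseux_nth (coeff q i) 0" for i
    using N(1) by (simp add: s_def coeff_map_poly coeff_q' Q puiseux_nth_of_fps_root_0)
  have deg_s: "degree s = n"
    using deg_q' Qn unfolding s_def by (subst map_poly_degree_eq) (auto simp: coeff_q')
  obtain x y where xy: "poly s x = 0" "poly s y = 0" "x \<noteq> y"
  proof (rule poly_two_roots[of s i0])
    show "lead_coeff s = 1" using \<open>coeff q n = 1\<close> by (simp add: deg_s coeff_s one_puiseux.rep_eq)
    show "coeff s (degree s - 1) = 0"
      using p(3) by (simp add: deg_s coeff_s coeff_q n_def zero_puiseux.rep_eq)
    show "coeff s i0 \<noteq> 0" using i0 by (simp add: coeff_s coeff_q)
  qed (use deg_s i0 p n_def in auto)
  then obtain g h where gh: "degree g > 0" "degree h > 0" "coprime g h" "s = g * h"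
    using alg_closed_imp_poly_splits_coprime[of s x y] deg_s p(1) n_def by metis
  obtain a b where ab: "q' = a * b" "degree a > 0" "degree b > 0"
    using hensel_fps_poly[of q' g h] gh Qn by (metis coeff_q' deg_q' s_def)
  \<comment> \<open>Undoes the rescaling on each factor; degrees are preserved, so neither factor
    becomes a unit.\<close>
  define emb where "emb = (\<lambda>a. pcompose (map_poly (puiseux_of_fps_root N) a) [:0, puiseux_monom (- r) :: 'a puiseux:])"
  have deg_emb: "degree (emb a) = degree a" for a
  proof -
    have "degree (map_poly (puiseux_of_fps_root N) a) = degree a"
      using root_eq_iff[of _ 0] by (intro degree_map_poly) (simp add: puiseux_of_fps_root_hom)
    then show ?thesis by (simp add: emb_def degree_pcompose monom_nz)
  qed
  have "p = smult (puiseux_monom (of_nat n * r)) (emb a) * emb b"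
    unfolding emb_def p_eq q_eq ab(1)
    by (simp add: map_poly_mult_hom puiseux_of_fps_root_hom pcompose_mult)
  moreover have "\<not> smult (puiseux_monom (of_nat n * r)) (emb a) dvd 1" "\<not> emb b dvd 1"
    using ab(2,3) is_unit_iff_degree[of "smult (puiseux_monom (of_nat n * r)) (emb a)"]
      is_unit_iff_degree[of "emb b"] deg_emb[of a] deg_emb[of b] monom_nz by force+
  ultimately show "\<not> irreducible p" by (metis irreducibleD)
qed


section \<open>Algebraic series form a field\<close>

lemma puiseux_of_poly_hom:
  "puiseux_of_poly 0 = (0 :: complex puiseux)"
  "puiseux_of_poly 1 = (1 :: complex puiseux)"
  "puiseux_of_poly (p + q) = puiseux_of_poly p + (puiseux_of_poly q :: complex puiseux)"
  "puiseux_of_poly (p * q) = puiseux_of_poly p * (puiseux_of_poly q :: complex puiseux)"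
  "puiseux_of_poly (- p) = - (puiseux_of_poly p :: complex puiseux)"
  by (simp_all add: puiseux_of_poly_def puiseux_of_fps_def puiseux_of_fls_hom fls_times_fps_to_fls
      fps_of_poly_simps)

lemma puiseux_of_poly_sum: "puiseux_of_poly (sum f A) = (\<Sum>x\<in>A. puiseux_of_poly (f x) :: complex puiseux)"
  by (induction A rule: infinite_finite_induct) (simp_all add: puiseux_of_poly_hom)

lemma puiseux_of_poly_eq_0_iff [simp]: "puiseux_of_poly p = (0 :: complex puiseux) \<longleftrightarrow> p = 0"
  using puiseux_of_fls_eq_iff[of 1 "fps_to_fls (fps_of_poly p)" 0]
  by (auto simp: puiseux_of_poly_def puiseux_of_fps_def puiseux_of_fls_0)

lemma poly_map_puiseux_of_poly:
  assumes "degree p \<le> n"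
  shows "poly (map_poly puiseux_of_poly p) f = (\<Sum>i\<le>n. puiseux_of_poly (coeff p i) * (f :: complex puiseux) ^ i)"
proof -
  have "degree (map_poly puiseux_of_poly p :: complex puiseux poly) = degree p"
    by (rule degree_map_poly) simp
  then have "poly (map_poly puiseux_of_poly p) f = (\<Sum>i\<le>degree p. puiseux_of_poly (coeff p i) * f ^ i)"
    by (simp add: poly_altdef coeff_map_poly puiseux_of_poly_hom)
  also have "\<dots> = (\<Sum>i\<le>n. puiseux_of_poly (coeff p i) * f ^ i)"
    by (rule sum.mono_neutral_left) (use assms in \<open>auto simp: coeff_eq_0 puiseux_of_poly_hom\<close>)
  finally show ?thesis .
qed

lemma algebraic_puiseux_iff:
  "algebraic_puiseux f \<longleftrightarrow> (\<exists>n c. (\<exists>i\<le>n. c i \<noteq> 0) \<and> (\<Sum>i\<le>n. puiseux_of_poly (c i) * f ^ i) = 0)"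
proof
  assume "algebraic_puiseux f"
  then obtain p :: "complex poly poly" where p: "p \<noteq> 0" "poly (map_poly puiseux_of_poly p) f = 0"
    unfolding algebraic_puiseux_def by blast
  then have "coeff p (degree p) \<noteq> 0" by simp
  then show "\<exists>n c. (\<exists>i\<le>n. c i \<noteq> 0) \<and> (\<Sum>i\<le>n. puiseux_of_poly (c i) * f ^ i) = 0"
    using p poly_map_puiseux_of_poly[of p "degree p" f] by (intro exI[of _ "degree p"] exI[of _ "coeff p"]) auto
next
  assume "\<exists>n c. (\<exists>i\<le>n. c i \<noteq> 0) \<and> (\<Sum>i\<le>n. puiseux_of_poly (c i) * f ^ i) = 0"
  then obtain n c i where nc: "i \<le> n" "c i \<noteq> 0" "(\<Sum>i\<le>n. puiseux_of_poly (c i) * f ^ i) = 0" by blast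
  define p where "p = (\<Sum>i\<le>n. monom (c i) i)"
  have coeff_p: "coeff p i = (if i \<le> n then c i else 0)" for i
    by (simp add: p_def coeff_sum)
  then have "degree p \<le> n" by (intro degree_le) simp
  then have "poly (map_poly puiseux_of_poly p) f = 0"
    using nc by (simp add: poly_map_puiseux_of_poly coeff_p)
  moreover have "p \<noteq> 0" using nc coeff_p[of i] by auto
  ultimately show "algebraic_puiseux f" unfolding algebraic_puiseux_def by blast
qed

text \<open>More vectors than coordinates are dependent. Elimination is carried out without
  division, so the relation has coefficients in the domain itself, here C[x].\<close>

lemma exists_linear_relation:
  fixes c :: "'i \<Rightarrow> 'j \<Rightarrow> 'a::idom"
  assumes "finite J" "finite I" "card J < card I"
  shows "\<exists>l. (\<exists>i\<in>I. l i \<noteq> 0) \<and> (\<forall>j\<in>J. (\<Sum>i\<in>I. l i * c i j) = 0)"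
  using assms
proof (induction J arbitrary: I c rule: finite_induct)
  case empty
  then obtain i where "i \<in> I" by fastforce
  then show ?case by (intro exI[of _ "\<lambda>_. 1"]) auto
next
  case (insert j J)
  show ?case
  proof (cases "\<forall>i\<in>I. c i j = 0")
    case True
    have "card J < card I" using insert by simp
    then obtain l where "\<exists>i\<in>I. l i \<noteq> 0" "\<forall>j\<in>J. (\<Sum>i\<in>I. l i * c i j) = 0"
      using insert.IH[OF insert.prems(1)] by blast
    then show ?thesis using True by (intro exI[of _ l]) auto
  next
    case False
    then obtain p where p: "p \<in> I" "c p j \<noteq> 0" by blast
    \<comment> \<open>Elimination with pivot \<open>c p j\<close>, cross-multiplied; coordinate
      \<open>j\<close> of every new row is zero.\<close>
    define c' where "c' = (\<lambda>i j'. c p j * c i j' - c i j * c p j')"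
    have "card J < card (I - {p})" "finite (I - {p})" using insert p by auto
    then obtain l' where l': "\<exists>i\<in>I - {p}. l' i \<noteq> 0" "\<forall>j\<in>J. (\<Sum>i\<in>I - {p}. l' i * c' i j) = 0"
      using insert.IH[of "I - {p}" c'] by blast
    define l where "l = (\<lambda>i. if i = p then - (\<Sum>i\<in>I - {p}. l' i * c i j) else l' i * c p j)"
    have sum_l: "(\<Sum>i\<in>I. l i * c i j') = (\<Sum>i\<in>I - {p}. l' i * c' i j')" for j'
    proof -
      have "(\<Sum>i\<in>I. l i * c i j') = l p * c p j' + (\<Sum>i\<in>I - {p}. l i * c i j')"
        using insert.prems p by (simp add: sum.remove)
      also have "(\<Sum>i\<in>I - {p}. l i * c i j') = (\<Sum>i\<in>I - {p}. l' i * c p j * c i j')"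
        by (intro sum.cong) (auto simp: l_def)
      also have "l p * c p j' = (\<Sum>i\<in>I - {p}. - (l' i * c i j * c p j'))"
        by (simp add: l_def sum_distrib_right sum_negf)
      finally show ?thesis
        by (simp add: c'_def algebra_simps sum_subtractf sum_negf)
    qed
    have "(\<Sum>i\<in>I - {p}. l' i * c' i j) = 0"
      by (intro sum.neutral) (simp add: c'_def)
    moreover have "\<exists>i\<in>I. l i \<noteq> 0" using l'(1) p by (auto simp: l_def)
    ultimately show ?thesis using l'(2) by (intro exI[of _ l]) (auto simp: sum_l)
  qed
qed

text \<open>The \<open>\<complex>(x)\<close>-linear span of the \<open>e j\<close>, with denominators cleared.\<close>

definition rational_span :: "'j set \<Rightarrow> ('j \<Rightarrow> complex puiseux) \<Rightarrow> complex puiseux set" where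
  "rational_span J e =
     {v. \<exists>g c. g \<noteq> 0 \<and> puiseux_of_poly g * v = (\<Sum>j\<in>J. puiseux_of_poly (c j) * e j)}"

lemma rational_span_0: "0 \<in> rational_span J e"
  unfolding rational_span_def
  by (intro CollectI exI[of _ 1] exI[of _ "\<lambda>_. 0"]) (simp add: puiseux_of_poly_hom)

lemma rational_span_base:
  assumes "finite J" "j \<in> J"
  shows "e j \<in> rational_span J e"
  unfolding rational_span_def
proof (intro CollectI exI[of _ 1] exI[of _ "\<lambda>i. if i = j then 1 else 0"] conjI)
  have "(\<Sum>i\<in>J. puiseux_of_poly (if i = j then 1 else 0) * e i) = (\<Sum>i\<in>J. if i = j then e i else 0)"
    by (intro sum.cong) (auto simp: puiseux_of_poly_hom)
  then show "puiseux_of_poly 1 * e j = (\<Sum>i\<in>J. puiseux_of_poly (if i = j then 1 else 0) * e i)"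
    using assms by (simp add: puiseux_of_poly_hom)
qed simp

lemma rational_span_add:
  assumes "v \<in> rational_span J e" "w \<in> rational_span J e"
  shows "v + w \<in> rational_span J e"
proof -
  obtain g c where v: "g \<noteq> 0" "puiseux_of_poly g * v = (\<Sum>j\<in>J. puiseux_of_poly (c j) * e j)"
    using assms(1) by (auto simp: rational_span_def)
  obtain h d where w: "h \<noteq> 0" "puiseux_of_poly h * w = (\<Sum>j\<in>J. puiseux_of_poly (d j) * e j)"
    using assms(2) by (auto simp: rational_span_def)
  have "puiseux_of_poly (g * h) * (v + w) =
      puiseux_of_poly h * (puiseux_of_poly g * v) + puiseux_of_poly g * (puiseux_of_poly h * w)"
    by (simp add: puiseux_of_poly_hom algebra_simps)
  also have "\<dots> = (\<Sum>j\<in>J. puiseux_of_poly (h * c j + g * d j) * e j)"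
    unfolding v(2) w(2) by (simp add: sum_distrib_left puiseux_of_poly_hom algebra_simps sum.distrib)
  finally show ?thesis using v(1) w(1) unfolding rational_span_def
    by (intro CollectI exI[of _ "g * h"] exI[of _ "\<lambda>j. h * c j + g * d j"]) auto
qed

lemma rational_span_scale:
  assumes "v \<in> rational_span J e"
  shows "puiseux_of_poly r * v \<in> rational_span J e"
proof -
  obtain g c where v: "g \<noteq> 0" "puiseux_of_poly g * v = (\<Sum>j\<in>J. puiseux_of_poly (c j) * e j)"
    using assms by (auto simp: rational_span_def)
  have "puiseux_of_poly g * (puiseux_of_poly r * v) = puiseux_of_poly r * (puiseux_of_poly g * v)"
    by (simp add: algebra_simps)
  also have "\<dots> = (\<Sum>j\<in>J. puiseux_of_poly (r * c j) * e j)"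
    unfolding v(2) by (simp add: sum_distrib_left puiseux_of_poly_hom algebra_simps)
  finally show ?thesis using v(1) unfolding rational_span_def
    by (intro CollectI exI[of _ g] exI[of _ "\<lambda>j. r * c j"]) simp
qed

lemma rational_span_unscale:
  assumes "puiseux_of_poly r * v \<in> rational_span J e" "r \<noteq> 0"
  shows "v \<in> rational_span J e"
proof -
  obtain g c where "g \<noteq> 0" "puiseux_of_poly g * (puiseux_of_poly r * v) = (\<Sum>j\<in>J. puiseux_of_poly (c j) * e j)"
    using assms(1) by (auto simp: rational_span_def)
  then show ?thesis using assms(2) unfolding rational_span_def
    by (intro CollectI exI[of _ "g * r"] exI[of _ c]) (simp add: puiseux_of_poly_hom mult.assoc)
qed

lemma rational_span_sum: "(\<And>i. i \<in> I \<Longrightarrow> v i \<in> rational_span J e) \<Longrightarrow> sum v I \<in> rational_span J e"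
  by (induction I rule: infinite_finite_induct) (auto simp: rational_span_0 rational_span_add)

lemma rational_span_mult:
  assumes "\<And>j. j \<in> J \<Longrightarrow> b * e j \<in> rational_span J e" "v \<in> rational_span J e"
  shows "b * v \<in> rational_span J e"
proof -
  obtain g c where v: "g \<noteq> 0" "puiseux_of_poly g * v = (\<Sum>j\<in>J. puiseux_of_poly (c j) * e j)"
    using assms(2) by (auto simp: rational_span_def)
  have "puiseux_of_poly g * (b * v) = b * (puiseux_of_poly g * v)" by (simp add: algebra_simps)
  also have "\<dots> = (\<Sum>j\<in>J. puiseux_of_poly (c j) * (b * e j))"
    unfolding v(2) by (simp add: sum_distrib_left algebra_simps)
  also have "\<dots> \<in> rational_span J e"
    using assms(1) by (intro rational_span_sum rational_span_scale)
  finally show ?thesis using v(1) by (rule rational_span_unscale)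
qed

text \<open>The first \<open>card J + 1\<close> powers lie in a space of dimension at most
  \<open>card J\<close>; a linear relation between their coordinates, multiplied by the cleared
  denominators, is an algebraic equation.\<close>

lemma algebraic_puiseux_of_span:
  assumes "finite J" "\<And>n. f ^ n \<in> rational_span J e"
  shows "algebraic_puiseux f"
proof -
  have "\<exists>g c. g \<noteq> 0 \<and> puiseux_of_poly g * f ^ n = (\<Sum>j\<in>J. puiseux_of_poly (c j) * e j)" for n
    using assms(2)[of n] unfolding rational_span_def by blast
  then obtain g c where gc: "\<And>n. g n \<noteq> 0"
    "\<And>n. puiseux_of_poly (g n) * f ^ n = (\<Sum>j\<in>J. puiseux_of_poly (c n j) * e j)" by metis
  obtain l where l: "\<exists>i\<in>{..card J}. l i \<noteq> 0" "\<forall>j\<in>J. (\<Sum>i\<in>{..card J}. l i * c i j) = 0"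
    using exists_linear_relation[of J "{..card J}" c] assms(1) by auto
  have "(\<Sum>i\<le>card J. puiseux_of_poly (l i * g i) * f ^ i) =
      (\<Sum>i\<le>card J. \<Sum>j\<in>J. puiseux_of_poly (l i * c i j) * e j)"
  proof (intro sum.cong refl)
    fix i
    have "puiseux_of_poly (l i * g i) * f ^ i = puiseux_of_poly (l i) * (puiseux_of_poly (g i) * f ^ i)"
      by (simp add: puiseux_of_poly_hom)
    then show "puiseux_of_poly (l i * g i) * f ^ i = (\<Sum>j\<in>J. puiseux_of_poly (l i * c i j) * e j)"
      by (simp add: gc(2) sum_distrib_left puiseux_of_poly_hom mult.assoc)
  qed
  also have "\<dots> = (\<Sum>j\<in>J. puiseux_of_poly (\<Sum>i\<le>card J. l i * c i j) * e j)"
    unfolding puiseux_of_poly_sum sum_distrib_right by (rule sum.swap)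
  also have "\<dots> = 0" using l(2) by (simp add: puiseux_of_poly_hom)
  finally have "(\<Sum>i\<le>card J. puiseux_of_poly (l i * g i) * f ^ i) = 0" .
  moreover have "\<exists>i\<le>card J. l i * g i \<noteq> 0" using l(1) gc(1) by auto
  ultimately show ?thesis unfolding algebraic_puiseux_iff
    by (intro exI[of _ "card J"] exI[of _ "\<lambda>i. l i * g i"]) simp
qed

lemma algebraic_puiseux_power_relation:
  assumes "algebraic_puiseux a"
  obtains n r c where "n > 0" "r \<noteq> 0" "puiseux_of_poly r * a ^ n = (\<Sum>i<n. puiseux_of_poly (c i) * a ^ i)"
proof -
  obtain p :: "complex poly poly" where p: "p \<noteq> 0" "poly (map_poly puiseux_of_poly p) a = 0"
    using assms unfolding algebraic_puiseux_def by blast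
  define n where "n = degree p"
  have eq: "(\<Sum>i<n. puiseux_of_poly (coeff p i) * a ^ i) + puiseux_of_poly (coeff p n) * a ^ n = 0"
    using poly_map_puiseux_of_poly[of p n a] p(2) by (simp add: n_def flip: lessThan_Suc_atMost)
  have lead: "coeff p n \<noteq> 0" using p(1) by (simp add: n_def)
  show thesis
  proof (rule that)
    show "n > 0" using eq lead by (cases n) auto
    show "coeff p n \<noteq> 0" by fact
    show "puiseux_of_poly (coeff p n) * a ^ n = (\<Sum>i<n. puiseux_of_poly (- coeff p i) * a ^ i)"
      using eq by (simp add: puiseux_of_poly_hom sum_negf eq_neg_iff_add_eq_0 add.commute)
  qed
qed

text \<open>The monomials \<open>a ^ i * b ^ j\<close> below the degrees of the two equations span a
  space that is stable under multiplication by \<open>a\<close> and by \<open>b\<close>, so it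
  contains all powers of the sum and of the product.\<close>

lemma
  assumes "algebraic_puiseux a" "algebraic_puiseux b"
  shows algebraic_puiseux_add: "algebraic_puiseux (a + b)"
    and algebraic_puiseux_mult: "algebraic_puiseux (a * b)"
proof -
  obtain n r c where a: "n > 0" "r \<noteq> 0" "puiseux_of_poly r * a ^ n = (\<Sum>i<n. puiseux_of_poly (c i) * a ^ i)"
    using assms(1) by (rule algebraic_puiseux_power_relation)
  obtain m s d where b: "m > 0" "s \<noteq> 0" "puiseux_of_poly s * b ^ m = (\<Sum>i<m. puiseux_of_poly (d i) * b ^ i)"
    using assms(2) by (rule algebraic_puiseux_power_relation)
  define J where "J = {..<n} \<times> {..<m}"
  define e where "e = (\<lambda>(i, j). a ^ i * b ^ j)"
  let ?V = "rational_span J e"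
  have base: "a ^ i * b ^ j \<in> ?V" if "i < n" "j < m" for i j
    using rational_span_base[of J "(i, j)" e] that by (simp add: J_def e_def)
  have mult_a: "a * v \<in> ?V" if "v \<in> ?V" for v
  proof (rule rational_span_mult[OF _ that])
    fix ij assume "ij \<in> J"
    then obtain i j where ij: "ij = (i, j)" "i < n" "j < m" by (auto simp: J_def)
    show "a * e ij \<in> ?V"
    proof (cases "Suc i < n")
      case True
      then show ?thesis using base[of "Suc i" j] ij by (simp add: e_def mult.assoc)
    next
      case False
      then have i: "Suc i = n" using ij by simp
      have "puiseux_of_poly r * (a * e ij) = (puiseux_of_poly r * a ^ n) * b ^ j"
        using i by (simp add: ij e_def algebra_simps flip: i)
      also have "\<dots> = (\<Sum>i<n. puiseux_of_poly (c i) * (a ^ i * b ^ j))"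
        unfolding a(3) by (simp add: sum_distrib_right mult.assoc)
      also have "\<dots> \<in> ?V" using ij(3) by (intro rational_span_sum rational_span_scale base) auto
      finally show ?thesis using a(2) by (rule rational_span_unscale)
    qed
  qed
  have mult_b: "b * v \<in> ?V" if "v \<in> ?V" for v
  proof (rule rational_span_mult[OF _ that])
    fix ij assume "ij \<in> J"
    then obtain i j where ij: "ij = (i, j)" "i < n" "j < m" by (auto simp: J_def)
    show "b * e ij \<in> ?V"
    proof (cases "Suc j < m")
      case True
      then show ?thesis using base[of i "Suc j"] ij by (simp add: e_def algebra_simps)
    next
      case False
      then have j: "Suc j = m" using ij by simp
      have "puiseux_of_poly s * (b * e ij) = (puiseux_of_poly s * b ^ m) * a ^ i"
        by (simp add: ij e_def algebra_simps flip: j)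
      also have "\<dots> = (\<Sum>j<m. puiseux_of_poly (d j) * (a ^ i * b ^ j))"
        unfolding b(3) by (simp add: sum_distrib_right sum_distrib_left algebra_simps)
      also have "\<dots> \<in> ?V" using ij(2) by (intro rational_span_sum rational_span_scale base) auto
      finally show ?thesis using b(2) by (rule rational_span_unscale)
    qed
  qed
  have one: "1 \<in> ?V" using base[of 0 0] a(1) b(1) by simp
  have fin: "finite J" by (simp add: J_def)
  have "(a + b) ^ l \<in> ?V" for l
    by (induction l) (use one mult_a mult_b in \<open>auto simp: distrib_right intro!: rational_span_add\<close>)
  then show "algebraic_puiseux (a + b)" using fin by (rule algebraic_puiseux_of_span[rotated])
  have "(a * b) ^ l \<in> ?V" for l
    by (induction l) (use one mult_a mult_b in \<open>auto simp: mult.assoc\<close>)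
  then show "algebraic_puiseux (a * b)" using fin by (rule algebraic_puiseux_of_span[rotated])
qed

lemma algebraic_puiseux_of_poly [simp]: "algebraic_puiseux (puiseux_of_poly p)"
  unfolding algebraic_puiseux_iff
  by (intro exI[of _ 1] exI[of _ "\<lambda>i. if i = 0 then - p else 1"] conjI)
     (auto simp: puiseux_of_poly_hom)

lemma algebraic_puiseux_0 [simp]: "algebraic_puiseux 0"
  using algebraic_puiseux_of_poly[of 0] by (simp add: puiseux_of_poly_hom)

lemma algebraic_puiseux_1 [simp]: "algebraic_puiseux 1"
  using algebraic_puiseux_of_poly[of 1] by (simp add: puiseux_of_poly_hom)

lemma algebraic_puiseux_uminus: "algebraic_puiseux a \<Longrightarrow> algebraic_puiseux (- a)"
  using algebraic_puiseux_mult[OF algebraic_puiseux_of_poly[of "- 1"], of a]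
  by (simp add: puiseux_of_poly_hom)

lemma algebraic_puiseux_diff: "algebraic_puiseux a \<Longrightarrow> algebraic_puiseux b \<Longrightarrow> algebraic_puiseux (a - b)"
  using algebraic_puiseux_add[of a "- b"] algebraic_puiseux_uminus[of b] by simp

lemma algebraic_puiseux_sum: "(\<And>i. i \<in> I \<Longrightarrow> algebraic_puiseux (f i)) \<Longrightarrow> algebraic_puiseux (sum f I)"
  by (induction I rule: infinite_finite_induct) (auto intro: algebraic_puiseux_add)

lemma algebraic_puiseux_power: "algebraic_puiseux a \<Longrightarrow> algebraic_puiseux (a ^ n)"
  by (induction n) (auto intro: algebraic_puiseux_mult)

lemma algebraic_puiseux_of_nat [simp]: "algebraic_puiseux (of_nat n)"
  by (induction n) (auto intro: algebraic_puiseux_add)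

text \<open>The polynomial with reversed coefficients annihilates the inverse.\<close>

lemma algebraic_puiseux_inverse:
  assumes "algebraic_puiseux a"
  shows "algebraic_puiseux (inverse a)"
proof (cases "a = 0")
  case False
  obtain n c i where c: "i \<le> n" "c i \<noteq> 0" "(\<Sum>i\<le>n. puiseux_of_poly (c i) * a ^ i) = 0"
    using assms unfolding algebraic_puiseux_iff by blast
  have "(\<Sum>i\<le>n. puiseux_of_poly (c (n - i)) * inverse a ^ i) =
      (\<Sum>i\<le>n. puiseux_of_poly (c i) * inverse a ^ (n - i))"
    by (rule sum.reindex_bij_witness[of _ "\<lambda>i. n - i" "\<lambda>i. n - i"]) auto
  also have "\<dots> = inverse a ^ n * (\<Sum>i\<le>n. puiseux_of_poly (c i) * a ^ i)"
    unfolding sum_distrib_left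
  proof (intro sum.cong refl)
    fix i assume "i \<in> {..n}"
    then have "inverse a ^ n = inverse a ^ (n - i) * inverse a ^ i" by (simp flip: power_add)
    then show "puiseux_of_poly (c i) * inverse a ^ (n - i) = inverse a ^ n * (puiseux_of_poly (c i) * a ^ i)"
      using False by (simp add: power_inverse field_simps)
  qed
  finally have "(\<Sum>i\<le>n. puiseux_of_poly (c (n - i)) * inverse a ^ i) = 0" using c(3) by simp
  moreover have "\<exists>j\<le>n. c (n - j) \<noteq> 0" using c by (intro exI[of _ "n - i"]) simp
  ultimately show ?thesis unfolding algebraic_puiseux_iff
    by (intro exI[of _ n] exI[of _ "\<lambda>i. c (n - i)"]) simp
qed simp

lemma algebraic_puiseux_divide: "algebraic_puiseux a \<Longrightarrow> algebraic_puiseux b \<Longrightarrow> algebraic_puiseux (a / b)"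
  by (simp add: divide_inverse algebraic_puiseux_mult algebraic_puiseux_inverse)


section \<open>Linear recurrences and exponential polynomials\<close>

definition algebraic_poly :: "complex puiseux poly \<Rightarrow> bool" where
  "algebraic_poly P \<longleftrightarrow> (\<forall>i. algebraic_puiseux (coeff P i))"

lemma algebraic_poly_add: "algebraic_poly P \<Longrightarrow> algebraic_poly Q \<Longrightarrow> algebraic_poly (P + Q)"
  by (simp add: algebraic_poly_def algebraic_puiseux_add)

lemma algebraic_poly_smult: "algebraic_puiseux c \<Longrightarrow> algebraic_poly P \<Longrightarrow> algebraic_poly (smult c P)"
  by (simp add: algebraic_poly_def algebraic_puiseux_mult)

lemma algebraic_poly_const [simp]: "algebraic_poly [:c:] \<longleftrightarrow> algebraic_puiseux c"
  by (auto simp: algebraic_poly_def coeff_pCons split: nat.splits dest: spec[of _ 0])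

lemma algebraic_puiseux_poly:
  "algebraic_poly P \<Longrightarrow> algebraic_puiseux x \<Longrightarrow> algebraic_puiseux (poly P x)"
  unfolding poly_altdef algebraic_poly_def
  by (intro algebraic_puiseux_sum algebraic_puiseux_mult algebraic_puiseux_power) auto

text \<open>For \<open>l = 1\<close> the degree of the solution goes up by one.\<close>

lemma poly_difference_equation:
  assumes "algebraic_poly P" "algebraic_puiseux l"
  shows "\<exists>Q. algebraic_poly Q \<and> (\<forall>x. poly Q (x + 1) - l * poly Q x = poly P x)"
proof -
  have "\<exists>Q. algebraic_poly Q \<and> (\<forall>x. poly Q (x + 1) - l * poly Q x = poly P x)"
    if "algebraic_poly P" "\<forall>i\<ge>n. coeff P i = 0" for n P
    using that
  proof (induction n arbitrary: P)
    case 0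
    then have "P = 0" by (intro poly_eqI) simp
    then show ?case by (intro exI[of _ 0]) (simp add: algebraic_poly_def)
  next
    case (Suc n)
    \<comment> \<open>\<open>N\<close> and \<open>d\<close> are chosen to match the top term of
      \<open>P\<close>: the expansion of (x + 1)^N - l x^N starts with (1 - l) x^n if
      \<open>l \<noteq> 1\<close>, and with (n + 1) x^n if \<open>l = 1\<close>.\<close>
    define N where "N = (if l = 1 then Suc n else n)"
    define d where "d = (if l = 1 then coeff P n / of_nat (Suc n) else coeff P n / (1 - l))"
    have alg_d: "algebraic_puiseux d"
      using Suc.prems(1) assms(2) unfolding d_def algebraic_poly_def
      by (auto intro!: algebraic_puiseux_divide algebraic_puiseux_diff simp del: of_nat_Suc)
    define R where "R = (\<Sum>i\<le>N. monom (d * of_nat (N choose i)) i) - monom (l * d) N"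
    have poly_R: "poly R x = poly (monom d N) (x + 1) - l * poly (monom d N) x" for x
      by (simp add: R_def poly_sum poly_monom binomial_ring sum_distrib_left mult_ac)
    have coeff_R: "coeff R i = (if i \<le> N then d * of_nat (N choose i) else 0) - (if i = N then l * d else 0)" for i
      by (auto simp: R_def coeff_sum)
    have "algebraic_poly R"
      using alg_d assms(2) unfolding algebraic_poly_def coeff_R
      by (auto intro!: algebraic_puiseux_diff algebraic_puiseux_mult)
    then have "algebraic_poly (P - R)"
      using Suc.prems(1) by (simp add: algebraic_poly_def algebraic_puiseux_diff)
    moreover have "coeff (P - R) i = 0" if "i \<ge> n" for i
    proof (cases "i = n")
      case True
      have "coeff R n = coeff P n"
      proof (cases "l = 1")
        case True
        have "Suc n choose n = Suc n" by simp
        then show ?thesis using True by (simp add: coeff_R N_def d_def del: of_nat_Suc)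
      next
        case False
        then have "coeff R n = d * (1 - l)" by (simp add: coeff_R N_def algebra_simps)
        then show ?thesis using False by (simp add: d_def)
      qed
      then show ?thesis using True by simp
    next
      case False
      then have "coeff R i = 0" using that by (auto simp: coeff_R N_def)
      then show ?thesis using Suc.prems(2) that False by simp
    qed
    ultimately obtain Q where Q: "algebraic_poly Q" "\<forall>x. poly Q (x + 1) - l * poly Q x = poly (P - R) x"
      using Suc.IH[of "P - R"] by blast
    show ?case
    proof (intro exI conjI allI)
      show "algebraic_poly (Q + monom d N)"
        using Q(1) alg_d by (intro algebraic_poly_add) (auto simp: algebraic_poly_def)
      fix x
      have "poly (Q + monom d N) (x + 1) - l * poly (Q + monom d N) x =
          (poly Q (x + 1) - l * poly Q x) + (poly (monom d N) (x + 1) - l * poly (monom d N) x)"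
        by (simp add: algebra_simps)
      then show "poly (Q + monom d N) (x + 1) - l * poly (Q + monom d N) x = poly P x"
        using Q(2) poly_R[of x] by simp
    qed
  qed
  from this[of P "Suc (degree P)"] show ?thesis using assms(1) by (simp add: coeff_eq_0)
qed

definition exp_poly :: "complex puiseux set \<Rightarrow> (nat \<Rightarrow> complex puiseux) \<Rightarrow> bool" where
  "exp_poly S e \<longleftrightarrow> (\<exists>xs. (\<forall>(P, w)\<in>set xs. algebraic_poly P \<and> w \<in> S) \<and>
     (\<forall>m. e m = (\<Sum>(P, w)\<leftarrow>xs. poly P (of_nat m) * w ^ m)))"

text \<open>For a single term P(m) w^m the ansatz Q(m) w^m leads to Q(m + 1) - (y / w) Q(m) = P(m) /
  w, which \<open>poly_difference_equation\<close> solves also in the resonant case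
  \<open>y = w\<close>.\<close>

lemma exp_poly_first_order:
  assumes S: "\<And>w. w \<in> S \<Longrightarrow> w \<noteq> 0 \<and> algebraic_puiseux w"
    and "y \<in> S" "exp_poly S g"
  shows "\<exists>h. exp_poly S h \<and> (\<forall>m. h (Suc m) - y * h m = g m)"
proof -
  obtain xs where xs: "\<forall>(P, w)\<in>set xs. algebraic_poly P \<and> w \<in> S"
    "\<And>m. g m = (\<Sum>(P, w)\<leftarrow>xs. poly P (of_nat m) * w ^ m)"
    using assms(3) by (auto simp: exp_poly_def)
  have "\<exists>zs. (\<forall>(P, w)\<in>set zs. algebraic_poly P \<and> w \<in> S) \<and>
     (\<forall>m. (\<Sum>(P, w)\<leftarrow>zs. poly P (of_nat (Suc m)) * w ^ Suc m) -
       y * (\<Sum>(P, w)\<leftarrow>zs. poly P (of_nat m) * w ^ m) = (\<Sum>(P, w)\<leftarrow>xs. poly P (of_nat m) * w ^ m))"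
    using xs(1)
  proof (induction xs)
    case Nil
    show ?case by (intro exI[of _ "[]"]) simp
  next
    case (Cons x xs)
    obtain P w where x: "x = (P, w)" by (cases x)
    have P: "algebraic_poly P" "w \<in> S" using Cons.prems x by auto
    have w: "w \<noteq> 0" "algebraic_puiseux w" using S P by auto
    have "algebraic_puiseux (y / w)" using S assms(2) w by (intro algebraic_puiseux_divide) auto
    moreover have "algebraic_poly (smult (inverse w) P)"
      using P w by (intro algebraic_poly_smult algebraic_puiseux_inverse)
    ultimately obtain Q where Q: "algebraic_poly Q"
      "\<And>x. poly Q (x + 1) - (y / w) * poly Q x = poly (smult (inverse w) P) x"
      using poly_difference_equation by blast
    obtain zs where zs: "\<forall>(P, w)\<in>set zs. algebraic_poly P \<and> w \<in> S"
      "\<And>m. (\<Sum>(P, w)\<leftarrow>zs. poly P (of_nat (Suc m)) * w ^ Suc m) -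
       y * (\<Sum>(P, w)\<leftarrow>zs. poly P (of_nat m) * w ^ m) = (\<Sum>(P, w)\<leftarrow>xs. poly P (of_nat m) * w ^ m)"
      using Cons by auto
    show ?case
    proof (intro exI[of _ "(Q, w) # zs"] conjI allI)
      fix m
      have "poly Q (of_nat (Suc m)) * w ^ Suc m - y * (poly Q (of_nat m) * w ^ m) =
          w ^ Suc m * (poly Q (of_nat m + 1) - (y / w) * poly Q (of_nat m))"
        using w(1) by (simp add: field_simps)
      also have "\<dots> = poly P (of_nat m) * w ^ m"
        unfolding Q(2) using w(1) by (simp add: field_simps)
      finally have "poly Q (of_nat (Suc m)) * w ^ Suc m - y * (poly Q (of_nat m) * w ^ m) =
        poly P (of_nat m) * w ^ m" .
      then show "(\<Sum>(P, w)\<leftarrow>(Q, w) # zs. poly P (of_nat (Suc m)) * w ^ Suc m) -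
         y * (\<Sum>(P, w)\<leftarrow>(Q, w) # zs. poly P (of_nat m) * w ^ m) =
         (\<Sum>(P, w)\<leftarrow>x # xs. poly P (of_nat m) * w ^ m)"
        using zs(2)[of m] by (simp add: x algebra_simps)
    qed (use zs(1) Q(1) P(2) in auto)
  qed
  then obtain zs where zs: "\<forall>(P, w)\<in>set zs. algebraic_poly P \<and> w \<in> S"
     "\<And>m. (\<Sum>(P, w)\<leftarrow>zs. poly P (of_nat (Suc m)) * w ^ Suc m) -
       y * (\<Sum>(P, w)\<leftarrow>zs. poly P (of_nat m) * w ^ m) = g m"
    using xs(2) by auto
  then show ?thesis unfolding exp_poly_def
    by (intro exI[of _ "\<lambda>m. \<Sum>(P, w)\<leftarrow>zs. poly P (of_nat m) * w ^ m"]) blast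
qed

lemma exp_poly_algebraic:
  assumes "exp_poly S e" "\<And>w. w \<in> S \<Longrightarrow> algebraic_puiseux w"
  shows "algebraic_puiseux (e m)"
proof -
  obtain xs where xs: "\<forall>(P, w)\<in>set xs. algebraic_poly P \<and> w \<in> S"
    "e m = (\<Sum>(P, w)\<leftarrow>xs. poly P (of_nat m) * w ^ m)"
    using assms(1) by (auto simp: exp_poly_def)
  show ?thesis unfolding xs(2) using xs(1)
  proof (induction xs)
    case (Cons x xs)
    then show ?case
      using assms(2) by (cases x) (auto intro!: algebraic_puiseux_add algebraic_puiseux_mult
          algebraic_puiseux_power algebraic_puiseux_poly)
  qed simp
qed

text \<open>The recurrence says that the product of the operators E - y, with E the shift,
  annihilates \<open>s\<close> from \<open>B\<close> on. Applying one of them leaves a shorter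
  recurrence for \<open>s'\<close>, and \<open>s\<close> is recovered from it by a first-order
  equation.\<close>

lemma recurrence_eventually_exp_poly:
  fixes s :: "nat \<Rightarrow> complex puiseux"
  assumes S: "\<And>w. w \<in> S \<Longrightarrow> w \<noteq> 0 \<and> algebraic_puiseux w"
    and "set_mset A \<subseteq> S" "\<And>m. algebraic_puiseux (s m)"
    and "Q = (\<Prod>y\<in>#A. [:-y, 1:])"
    and "\<And>m. m \<ge> B \<Longrightarrow> (\<Sum>i\<le>degree Q. coeff Q i * s (m + i)) = 0"
  shows "\<exists>e. exp_poly S e \<and> (\<forall>m\<ge>B. s m = e m)"
  using assms(2-)
proof (induction A arbitrary: s Q rule: multiset_induct)
  case empty
  then show ?case
    by (intro exI[of _ "\<lambda>_. 0"]) (auto simp: exp_poly_def intro!: exI[of _ "[]"])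
next
  case (add y A)
  define Q' where "Q' = (\<Prod>y\<in>#A. [:-y, 1:])"
  define n where "n = degree Q'"
  define s' where "s' = (\<lambda>m. s (Suc m) - y * s m)"
  have y: "y \<in> S" "y \<noteq> 0" "algebraic_puiseux y" using add.prems(1) S by auto
  have Q_mult: "Q = [:-y, 1:] * Q'" using add.prems(3) by (simp add: Q'_def)
  then have Q: "Q = pCons 0 Q' - smult y Q'" by simp
  have Q'0: "coeff Q' (Suc n) = 0" by (simp add: n_def coeff_eq_0)
  have "Q' \<noteq> 0" by (auto simp: Q'_def prod_mset_zero_iff)
  then have deg: "degree Q = Suc n"
    unfolding Q_mult n_def by (subst degree_mult_eq) auto
  have "(\<Sum>i\<le>n. coeff Q' i * s' (m + i)) = 0" if "m \<ge> B" for m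
  proof -
    have "(\<Sum>i\<le>degree Q. coeff Q i * s (m + i)) =
        (\<Sum>i\<le>Suc n. coeff (pCons 0 Q') i * s (m + i)) - (\<Sum>i\<le>Suc n. y * coeff Q' i * s (m + i))"
      unfolding deg sum_subtractf[symmetric] by (intro sum.cong refl) (simp add: Q algebra_simps)
    also have "(\<Sum>i\<le>Suc n. coeff (pCons 0 Q') i * s (m + i)) = (\<Sum>i\<le>n. coeff Q' i * s (Suc (m + i)))"
      by (subst sum.atMost_Suc_shift) simp
    also have "(\<Sum>i\<le>Suc n. y * coeff Q' i * s (m + i)) = (\<Sum>i\<le>n. y * coeff Q' i * s (m + i))"
      by (simp add: Q'0)
    finally show ?thesis
      using add.prems(4)[OF that] by (simp add: s'_def algebra_simps sum_subtractf)
  qed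
  moreover have "algebraic_puiseux (s' m)" for m
    unfolding s'_def using add.prems(2) y(3) by (intro algebraic_puiseux_diff algebraic_puiseux_mult)
  ultimately obtain g where g: "exp_poly S g" "\<forall>m\<ge>B. s' m = g m"
    using add.IH[of s' Q'] add.prems(1) by (auto simp: Q'_def n_def)
  obtain h where h: "exp_poly S h" "\<And>m. h (Suc m) - y * h m = g m"
    using exp_poly_first_order[OF S y(1) g(1)] by blast
  \<comment> \<open>Solutions of the same first-order equation differ by a multiple of
    \<open>y ^ m\<close>; this multiple gives agreement at the first index \<open>B\<close>.\<close>
  define c where "c = (s B - h B) / y ^ B"
  have alg_c: "algebraic_puiseux c"
    unfolding c_def using add.prems(2) y(3) exp_poly_algebraic[OF h(1)] S
    by (intro algebraic_puiseux_divide algebraic_puiseux_diff algebraic_puiseux_power) auto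
  have "s m = h m + c * y ^ m" if "m \<ge> B" for m
    using that
  proof (induction m rule: dec_induct)
    case base
    show ?case using y(2) by (simp add: c_def)
  next
    case (step m)
    have "s (Suc m) = g m + y * s m" using g(2) step by (simp add: s'_def flip: diff_eq_eq)
    also have "\<dots> = h (Suc m) + c * y ^ Suc m"
      using h(2)[of m] step.IH by (simp add: algebra_simps)
    finally show ?case .
  qed
  moreover have "exp_poly S (\<lambda>m. h m + c * y ^ m)"
  proof -
    obtain xs where "\<forall>(P, w)\<in>set xs. algebraic_poly P \<and> w \<in> S"
      "\<forall>m. h m = (\<Sum>(P, w)\<leftarrow>xs. poly P (of_nat m) * w ^ m)"
      using h(1) by (auto simp: exp_poly_def)
    then show ?thesis unfolding exp_poly_def using alg_c y(1)
      by (intro exI[of _ "([:c:], y) # xs"]) auto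
  qed
  ultimately show ?case by blast
qed


section \<open>Rationality of the bivariate generating function\<close>

text \<open>The last unknown is eliminated by cross-multiplication, since pivots need not be
  invertible among the polynomials embedded by \<open>E\<close>. The matrix stays congruent to the
  identity modulo \<open>t\<close>, and so does the final coefficient \<open>D\<close>. In the
  application the modulus \<open>t\<close> is the variable x, not the variable of the
  exponential.\<close>

lemma linear_system_elimination:
  fixes E :: "'a::comm_ring_1 \<Rightarrow> 'b::comm_ring_1" and n :: nat
  assumes hom: "\<And>a b. E (a + b) = E a + E b" "\<And>a b. E (a * b) = E a * E b" "\<And>a. E (- a) = - E a"
    and system: "\<And>i. i \<le> n \<Longrightarrow> (\<Sum>j\<le>n. E (A i j) * U j) = E (N i)"
    and unimodular: "\<And>i j. i \<le> n \<Longrightarrow> j \<le> n \<Longrightarrow> t dvd A i j - (if i = j then 1 else 0)"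
  shows "\<exists>D M. t dvd D - 1 \<and> E D * U 0 = E M"
  using system unimodular
proof (induction n arbitrary: A N)
  case 0
  show ?case using 0(1)[of 0] 0(2)[of 0 0] by (intro exI[of _ "A 0 0"] exI[of _ "N 0"]) simp
next
  case (Suc n)
  let ?l = "Suc n"
  define A' where "A' = (\<lambda>i j. A ?l ?l * A i j + - (A i ?l * A ?l j))"
  define N' where "N' = (\<lambda>i. A ?l ?l * N i + - (A i ?l * N ?l))"
  have row: "(\<Sum>j\<le>n. E (A i j) * U j) = E (N i) - E (A i ?l) * U ?l" if "i \<le> ?l" for i
    using Suc.prems(1)[OF that] by (simp add: eq_diff_eq)
  have "(\<Sum>j\<le>n. E (A' i j) * U j) = E (N' i)" if "i \<le> n" for i
  proof -
    have "(\<Sum>j\<le>n. E (A' i j) * U j) =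
        E (A ?l ?l) * (\<Sum>j\<le>n. E (A i j) * U j) - E (A i ?l) * (\<Sum>j\<le>n. E (A ?l j) * U j)"
      unfolding sum_distrib_left sum_subtractf[symmetric] A'_def hom
      by (intro sum.cong refl) (simp add: algebra_simps)
    also have "\<dots> = E (N' i)"
    proof -
      have "E (N' i) = E (A ?l ?l) * E (N i) - E (A i ?l) * E (N ?l)" unfolding N'_def hom by simp
      then show ?thesis using that by (simp add: row right_diff_distrib mult.left_commute)
    qed
    finally show ?thesis .
  qed
  moreover have "t dvd A' i j - (if i = j then 1 else 0)" if "i \<le> n" "j \<le> n" for i j
  proof -
    have "A' i j - (if i = j then 1 else 0) =
        (A ?l ?l - 1) * A i j + (A i j - (if i = j then 1 else 0)) - A i ?l * A ?l j"
      by (simp add: A'_def algebra_simps)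
    moreover have "t dvd A ?l ?l - 1" "t dvd A i ?l" "t dvd A i j - (if i = j then 1 else 0)"
      using Suc.prems(2)[of ?l ?l] Suc.prems(2)[of i ?l] Suc.prems(2)[of i j] that by auto
    ultimately show ?thesis by (metis dvd_add dvd_diff dvd_mult2)
  qed
  ultimately show ?case by (rule Suc.IH)
qed

text \<open>The outer variable is t, the inner one x.\<close>

definition bivariate_fps :: "complex poly poly \<Rightarrow> complex fps fps" where
  "bivariate_fps p = fps_of_poly (map_poly fps_of_poly p)"

lemma bivariate_fps_nth: "fps_nth (bivariate_fps p) m = fps_of_poly (coeff p m)"
  by (simp add: bivariate_fps_def coeff_map_poly)

lemma bivariate_fps_hom:
  "bivariate_fps (p + q) = bivariate_fps p + bivariate_fps q"
  "bivariate_fps (p * q) = bivariate_fps p * bivariate_fps q"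
  "bivariate_fps (- p) = - bivariate_fps p"
proof -
  show "bivariate_fps (p + q) = bivariate_fps p + bivariate_fps q"
    by (rule fps_ext) (simp add: bivariate_fps_nth fps_of_poly_simps)
  show "bivariate_fps (- p) = - bivariate_fps p"
    by (rule fps_ext) (simp add: bivariate_fps_nth fps_of_poly_simps)
  show "bivariate_fps (p * q) = bivariate_fps p * bivariate_fps q"
    unfolding bivariate_fps_def
    by (subst map_poly_mult_hom) (simp_all add: fps_of_poly_simps)
qed

text \<open>The generating function of \<open>transfer_vec k n c\<close>, as a series in \<open>t\<close> whose coefficients are
  series in \<open>x\<close>.\<close>

definition transfer_series :: "nat \<Rightarrow> nat \<Rightarrow> complex fps fps" where
  "transfer_series k c = Abs_fps (\<lambda>m. Abs_fps (\<lambda>n. coeff (transfer_vec k n c) m))"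

lemma transfer_series_nth: "fps_nth (fps_nth (transfer_series k c) m) n = coeff (transfer_vec k n c) m"
  by (simp add: transfer_series_def)

lemma bivariate_fps_monom_mult_nth:
  "fps_nth (fps_nth (bivariate_fps (monom [:0, a:] r) * F) m) n =
     (if r \<le> m \<and> n > 0 then a * fps_nth (fps_nth F (m - r)) (n - 1) else 0)"
proof -
  have "bivariate_fps (monom [:0, a:] r) = fps_const (fps_const a * fps_X) * fps_X ^ r"
  proof (rule fps_ext)
    fix i
    have "fps_of_poly [:0, a:] = fps_const a * fps_X"
      by (simp add: fps_of_poly_pCons mult.commute)
    then show "fps_nth (bivariate_fps (monom [:0, a:] r)) i = fps_nth (fps_const (fps_const a * fps_X) * fps_X ^ r) i"
      by (simp add: bivariate_fps_nth)
  qed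
  then show ?thesis by (simp add: mult.assoc fps_X_power_mult_nth)
qed

text \<open>The recursion of \<open>transfer_vec\<close>, multiplied by powers of x and summed over
  \<open>n\<close>: the matrix is the identity minus x t^(k - c) \<open>transfer k c b\<close>, and
  the right-hand side is the initial vector.\<close>

lemma transfer_series_system:
  assumes "c \<le> k"
  shows "(\<Sum>b\<le>k. bivariate_fps ((if c = b then 1 else 0) + - monom [:0, transfer k c b:] (k - c)) *
      transfer_series k b) = bivariate_fps (if c = 0 then 1 else 0)"
proof -
  have "bivariate_fps 1 = 1" by (simp add: bivariate_fps_def)
  moreover have "bivariate_fps 0 = 0" by (simp add: bivariate_fps_def)
  ultimately have "(\<Sum>b\<le>k. bivariate_fps ((if c = b then 1 else 0) + - monom [:0, transfer k c b:] (k - c)) *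
      transfer_series k b) = (\<Sum>b\<le>k. (if c = b then transfer_series k b else 0) -
        bivariate_fps (monom [:0, transfer k c b:] (k - c)) * transfer_series k b)"
    unfolding bivariate_fps_hom by (intro sum.cong refl) (simp add: algebra_simps)
  also have "\<dots> = transfer_series k c - (\<Sum>b\<le>k. bivariate_fps (monom [:0, transfer k c b:] (k - c)) * transfer_series k b)"
    using assms by (simp add: sum_subtractf)
  also have "\<dots> = bivariate_fps (if c = 0 then 1 else 0)"
  proof (intro fps_ext)
    fix m n
    show "fps_nth (fps_nth (transfer_series k c - (\<Sum>b\<le>k. bivariate_fps (monom [:0, transfer k c b:] (k - c)) *
        transfer_series k b)) m) n = fps_nth (fps_nth (bivariate_fps (if c = 0 then 1 else 0)) m) n"
      by (cases n) (auto simp: fps_sum_nth bivariate_fps_monom_mult_nth transfer_series_nth coeff_monom_mult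
          coeff_sum bivariate_fps_nth)
  qed
  finally show ?thesis .
qed

lemma transfer_series_rational:
  "\<exists>D M. [:[:0, 1:]:] dvd D - 1 \<and> bivariate_fps D * transfer_series k 0 = bivariate_fps M"
proof (rule linear_system_elimination[OF bivariate_fps_hom transfer_series_system])
  fix c b
  have "monom [:0, transfer k c b:] (k - c) = [:[:0, 1:]:] * monom [:transfer k c b:] (k - c)"
    by (simp add: smult_monom)
  then have "[:[:0, 1:]:] dvd monom [:0, transfer k c b:] (k - c)" by (metis dvd_triv_left)
  then show "[:[:0, 1:]:] dvd (if c = b then 1 else 0) + - monom [:0, transfer k c b:] (k - c) - (if c = b then 1 else 0)"
    by simp
qed


section \<open>Orders and convergence\<close>

text \<open>A lower bound for the order instead of the order itself, so that zero and cancellation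
  need no separate treatment.\<close>

definition vanishes_below :: "rat \<Rightarrow> 'a::zero puiseux \<Rightarrow> bool" where
  "vanishes_below b f \<longleftrightarrow> (\<forall>e<b. puiseux_nth f e = 0)"

lemma vanishes_below_mono: "vanishes_below b f \<Longrightarrow> c \<le> b \<Longrightarrow> vanishes_below c f"
  by (auto simp: vanishes_below_def)

lemma vanishes_below_0 [simp]: "vanishes_below b 0"
  by (simp add: vanishes_below_def zero_puiseux.rep_eq)

lemma vanishes_below_1 [simp]: "vanishes_below 0 1"
  by (simp add: vanishes_below_def one_puiseux.rep_eq)

lemma vanishes_below_add:
  fixes f g :: "'a::comm_ring_1 puiseux"
  shows "vanishes_below b f \<Longrightarrow> vanishes_below b g \<Longrightarrow> vanishes_below b (f + g)"
  by (simp add: vanishes_below_def plus_puiseux.rep_eq)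

lemma puiseux_nth_sum:
  fixes f :: "'i \<Rightarrow> 'a::comm_ring_1 puiseux"
  shows "puiseux_nth (sum f I) e = (\<Sum>i\<in>I. puiseux_nth (f i) e)"
  by (induction I rule: infinite_finite_induct) (simp_all add: zero_puiseux.rep_eq plus_puiseux.rep_eq)

lemma vanishes_below_sum:
  fixes f :: "'i \<Rightarrow> 'a::comm_ring_1 puiseux"
  shows "(\<And>i. i \<in> I \<Longrightarrow> vanishes_below b (f i)) \<Longrightarrow> vanishes_below b (sum f I)"
  by (induction I rule: infinite_finite_induct) (auto intro: vanishes_below_add)

lemma vanishes_below_mult:
  fixes f g :: "'a::comm_ring_1 puiseux"
  assumes "vanishes_below b f" "vanishes_below c g"
  shows "vanishes_below (b + c) (f * g)"
  unfolding vanishes_below_def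
proof (intro allI impI)
  fix e assume e: "e < b + c"
  have "{a. puiseux_nth f a \<noteq> 0 \<and> puiseux_nth g (e - a) \<noteq> 0} = {}"
  proof safe
    fix a assume "puiseux_nth f a \<noteq> 0" "puiseux_nth g (e - a) \<noteq> 0"
    then have "a \<ge> b" "e - a \<ge> c" using assms unfolding vanishes_below_def by (meson not_le)+
    then show "a \<in> {}" using e by linarith
  qed
  then show "puiseux_nth (f * g) e = 0" by (simp only: times_puiseux.rep_eq sum.empty)
qed

lemma vanishes_below_power:
  fixes f :: "'a::comm_ring_1 puiseux"
  shows "vanishes_below b f \<Longrightarrow> vanishes_below (of_nat n * b) (f ^ n)"
proof (induction n)
  case (Suc n)
  then show ?case using vanishes_below_mult[of b f "of_nat n * b" "f ^ n"] by (simp add: algebra_simps)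
qed simp

lemma vanishes_below_of_nat [simp]: "vanishes_below 0 (of_nat n :: 'a::comm_ring_1 puiseux)"
  by (induction n) (auto intro: vanishes_below_add)

lemma vanishes_below_ex: "\<exists>b. vanishes_below b f"
proof -
  obtain N j0 where N: "N > 0" "\<forall>e. puiseux_nth f e \<noteq> 0 \<longrightarrow> (\<exists>j\<ge>j0. e = of_int j / of_nat N)"
    using puiseux_support[of f] by blast
  have "puiseux_nth f e = 0" if "e < of_int j0 / of_nat N" for e
  proof (rule ccontr)
    assume "puiseux_nth f e \<noteq> 0"
    then obtain j where "j \<ge> j0" "e = of_int j / of_nat N" using N(2) by blast
    then have "e \<ge> of_int j0 / of_nat N" by (simp add: divide_right_mono)
    then show False using that by simp
  qed
  then show ?thesis unfolding vanishes_below_def by blast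
qed

definition positive_order :: "'a::zero puiseux \<Rightarrow> bool" where
  "positive_order f \<longleftrightarrow> (\<forall>e\<le>0. puiseux_nth f e = 0)"

lemma positive_order_mult:
  fixes f g :: "'a::comm_ring_1 puiseux"
  assumes "positive_order f" "vanishes_below 0 g"
  shows "positive_order (f * g)"
  unfolding positive_order_def
proof (intro allI impI)
  fix e :: rat assume e: "e \<le> 0"
  have "{a. puiseux_nth f a \<noteq> 0 \<and> puiseux_nth g (e - a) \<noteq> 0} = {}"
  proof safe
    fix a assume "puiseux_nth f a \<noteq> 0" "puiseux_nth g (e - a) \<noteq> 0"
    then have "a > 0" "e - a \<ge> 0"
      using assms unfolding vanishes_below_def positive_order_def by (meson not_le)+
    then show "a \<in> {}" using e by linarith
  qed
  then show "puiseux_nth (f * g) e = 0" by (simp only: times_puiseux.rep_eq sum.empty)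
qed

text \<open>The leading terms of \<open>y\<close> and its inverse multiply to the leading term of 1,
  so their exponents add up to 0.\<close>

lemma inverse_integral_of_not_positive_order:
  fixes y :: "'a::field puiseux"
  assumes "y \<noteq> 0" "\<not> positive_order y"
  shows "vanishes_below 0 (inverse y)"
proof -
  define w where "w = inverse y"
  have "w \<noteq> 0" using assms by (simp add: w_def)
  obtain a where a: "puiseux_nth y a \<noteq> 0" "\<And>e. e < a \<Longrightarrow> puiseux_nth y e = 0"
    using puiseux_leading_exponent[OF assms(1)] by metis
  obtain b where b: "puiseux_nth w b \<noteq> 0" "\<And>e. e < b \<Longrightarrow> puiseux_nth w e = 0"
    using puiseux_leading_exponent[OF \<open>w \<noteq> 0\<close>] by metis
  have "{e. puiseux_nth y e \<noteq> 0 \<and> puiseux_nth w (a + b - e) \<noteq> 0} = {a}"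
  proof (intro equalityI subsetI)
    fix e assume "e \<in> {e. puiseux_nth y e \<noteq> 0 \<and> puiseux_nth w (a + b - e) \<noteq> 0}"
    then have "e \<ge> a" "a + b - e \<ge> b" using a(2) b(2) by (auto simp: not_less[symmetric])
    then show "e \<in> {a}" by simp
  qed (use a(1) b(1) in auto)
  then have "puiseux_nth (y * w) (a + b) = puiseux_nth y a * puiseux_nth w b"
    by (simp add: times_puiseux.rep_eq)
  then have "puiseux_nth (1 :: 'a puiseux) (a + b) \<noteq> 0"
    using a(1) b(1) assms(1) by (simp add: w_def)
  then have "a + b = 0" by (simp add: one_puiseux.rep_eq split: if_splits)
  moreover obtain e where "e \<le> 0" "puiseux_nth y e \<noteq> 0"
    using assms(2) by (auto simp: positive_order_def)
  then have "a \<le> 0" using a(2) by force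
  ultimately have "b \<ge> 0" by linarith
  then show ?thesis using b(2) by (auto simp: vanishes_below_def w_def)
qed

text \<open>Otherwise the inverse of \<open>y\<close> is integral. Dividing the equation by
  \<open>y ^ n\<close> then leaves \<open>d 0\<close> plus terms of positive order, whose
  coefficient at exponent 0 is not zero.\<close>

lemma positive_order_root:
  fixes y :: "'a::field puiseux"
  assumes "y \<noteq> 0" "(\<Sum>i\<le>n. d i * y ^ (n - i)) = 0"
    and "vanishes_below 0 (d 0)" "puiseux_nth (d 0) 0 \<noteq> 0"
    and pos: "\<And>i. i > 0 \<Longrightarrow> positive_order (d i)"
  shows "positive_order y"
proof (rule ccontr)
  assume "\<not> positive_order y"
  with assms(1) have w: "vanishes_below 0 (inverse y)"
    by (rule inverse_integral_of_not_positive_order)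
  have w': "vanishes_below 0 (inverse y ^ i)" for i
    using vanishes_below_power[OF w, of i] by simp
  have "(\<Sum>i\<le>n. d i * inverse y ^ i) = inverse y ^ n * (\<Sum>i\<le>n. d i * y ^ (n - i))"
    unfolding sum_distrib_left
  proof (intro sum.cong refl)
    fix i assume "i \<in> {..n}"
    then have "inverse y ^ n = inverse y ^ i * inverse y ^ (n - i)" by (simp flip: power_add)
    then show "d i * inverse y ^ i = inverse y ^ n * (d i * y ^ (n - i))"
      using assms(1) by (simp add: power_inverse field_simps)
  qed
  then have "(\<Sum>i\<le>n. d i * inverse y ^ i) = 0" using assms(2) by simp
  moreover have "(\<Sum>i\<le>n. d i * inverse y ^ i) = d 0 + (\<Sum>i\<in>{1..n}. d i * inverse y ^ i)"
    by (simp add: sum.atLeast_Suc_atMost[of 0 n, simplified atLeast0AtMost])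
  moreover have "positive_order (\<Sum>i\<in>{1..n}. d i * inverse y ^ i)"
  proof -
    have "positive_order (d i * inverse y ^ i)" if "i \<in> {1..n}" for i
      using that by (intro positive_order_mult pos w') auto
    then show ?thesis by (simp add: positive_order_def puiseux_nth_sum)
  qed
  ultimately have "puiseux_nth (d 0 + (\<Sum>i\<in>{1..n}. d i * inverse y ^ i)) 0 = 0"
    by (simp add: zero_puiseux.rep_eq)
  then show False
    using assms(4) \<open>positive_order (\<Sum>i\<in>{1..n}. d i * inverse y ^ i)\<close>
    by (simp add: plus_puiseux.rep_eq positive_order_def)
qed

section \<open>Common denominators and summability\<close>

definition has_denominator :: "nat \<Rightarrow> 'a::zero puiseux \<Rightarrow> bool" where
  "has_denominator N f \<longleftrightarrow> (\<exists>F. f = puiseux_of_fls N F)"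

lemma has_denominator_add:
  fixes f g :: "'a::comm_ring_1 puiseux"
  shows "has_denominator N f \<Longrightarrow> has_denominator N g \<Longrightarrow> has_denominator N (f + g)"
  unfolding has_denominator_def by (metis puiseux_of_fls_add)

lemma has_denominator_mult:
  fixes f g :: "'a::comm_ring_1 puiseux"
  shows "has_denominator N f \<Longrightarrow> has_denominator N g \<Longrightarrow> has_denominator N (f * g)"
  unfolding has_denominator_def by (metis puiseux_of_fls_mult)

lemma has_denominator_0_1:
  "has_denominator N 0" "N > 0 \<Longrightarrow> has_denominator N (1 :: 'a::comm_ring_1 puiseux)"
  unfolding has_denominator_def by (metis puiseux_of_fls_0) (metis puiseux_of_fls_1)

lemma has_denominator_power:
  fixes f :: "'a::comm_ring_1 puiseux"
  shows "N > 0 \<Longrightarrow> has_denominator N f \<Longrightarrow> has_denominator N (f ^ n)"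
  by (induction n) (auto intro: has_denominator_0_1 has_denominator_mult)

lemma has_denominator_of_nat:
  "N > 0 \<Longrightarrow> has_denominator N (of_nat n :: 'a::comm_ring_1 puiseux)"
  by (induction n) (auto intro: has_denominator_0_1 has_denominator_add)

lemma has_denominator_sum:
  fixes f :: "'i \<Rightarrow> 'a::comm_ring_1 puiseux"
  shows "(\<And>i. i \<in> I \<Longrightarrow> has_denominator N (f i)) \<Longrightarrow> has_denominator N (sum f I)"
  by (induction I rule: infinite_finite_induct) (auto intro: has_denominator_0_1 has_denominator_add)

text \<open>Fractional Laurent series are not complete: the common denominator cannot be dropped.\<close>

lemma puiseux_summableI:
  fixes f :: "nat \<Rightarrow> 'a::comm_ring_1 puiseux"
  assumes "N > 0" "\<And>m. has_denominator N (f m)" "\<And>m. vanishes_below b (f m)"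
    and small: "\<And>c. \<exists>M. \<forall>m\<ge>M. vanishes_below c (f m)"
  shows "summable f"
proof -
  obtain M where M: "\<And>c m. m \<ge> M c \<Longrightarrow> vanishes_below c (f m)" using small by metis
  \<comment> \<open>The bound is taken at \<open>e + 1\<close> because vanishing below
    \<open>e\<close> says nothing about the exponent \<open>e\<close> itself.\<close>
  define g where "g = (\<lambda>e. \<Sum>m<M (e + 1). puiseux_nth (f m) e)"
  have g: "(\<Sum>m<n. puiseux_nth (f m) e) = g e" if "n \<ge> M c" "e < c" for n c e
  proof -
    have zero: "puiseux_nth (f m) e = 0" if "m \<ge> M (e + 1) \<or> m \<ge> M c" for m
    proof -
      have "vanishes_below (e + 1) (f m) \<or> vanishes_below c (f m)" using that M by blast
      then show ?thesis using \<open>e < c\<close> by (auto simp: vanishes_below_def)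
    qed
    have "(\<Sum>m<n. puiseux_nth (f m) e) = (\<Sum>m<max n (M (e + 1)). puiseux_nth (f m) e)"
      by (rule sum.mono_neutral_left) (use zero that in \<open>auto simp: not_less intro: zero dest: order.trans\<close>)
    also have "\<dots> = g e"
      unfolding g_def by (rule sum.mono_neutral_right) (use zero in \<open>auto simp: not_less\<close>)
    finally show ?thesis .
  qed
  have supp: "\<exists>j\<ge>\<lfloor>b * of_nat N\<rfloor>. e = of_int j / of_nat N" if "g e \<noteq> 0" for e
  proof -
    obtain m where m: "puiseux_nth (f m) e \<noteq> 0"
      using \<open>g e \<noteq> 0\<close> unfolding g_def by (metis sum.neutral)
    then have "b \<le> e" using assms(3)[of m] by (auto simp: vanishes_below_def not_less[symmetric])
    obtain F where "f m = puiseux_of_fls N F" using assms(2) by (auto simp: has_denominator_def)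
    then have "of_nat N * e \<in> \<int>" using m by (auto simp: puiseux_of_fls.rep_eq split: if_splits)
    then obtain j where "of_nat N * e = of_int j" by (auto elim: Ints_cases)
    then have e: "e = of_int j / of_nat N" using assms(1) by (simp add: field_simps)
    have "b * of_nat N \<le> of_int j"
      using mult_right_mono[OF \<open>b \<le> e\<close>, of "of_nat N"] \<open>of_nat N * e = of_int j\<close>
      by (simp add: mult.commute)
    then have "\<lfloor>b * of_nat N\<rfloor> \<le> j" by (metis floor_mono floor_of_int)
    then show ?thesis using e by blast
  qed
  define l where "l = Abs_puiseux g"
  have l: "puiseux_nth l = g"
    unfolding l_def by (rule Abs_puiseux_inverse) (use assms(1) supp in blast)
  have "f sums l"
    unfolding sums_def tendsto_puiseux_iff
  proof
    fix c
    show "\<forall>\<^sub>F n in sequentially. \<forall>e\<le>c. puiseux_nth (sum f {..<n}) e = puiseux_nth l e"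
      using eventually_ge_at_top[of "M (c + 1)"]
      by eventually_elim (auto simp: puiseux_nth_sum l intro!: g[of "c + 1"])
  qed
  then show ?thesis by (rule sums_summable)
qed

text \<open>With denominator \<open>N\<close>, positive order means order at least 1 / N. Factorials
  and values of \<open>of_nat\<close> are constants, so the m-th term has order at least a fixed
  bound plus m / N.\<close>

lemma summable_fact_poly_power:
  fixes w :: "'a::{comm_ring_1, ring_char_0} puiseux"
  assumes "positive_order w"
  shows "summable (\<lambda>m. fact m * poly P (of_nat m) * w ^ m)"
proof -
  obtain N where N: "N > 0" "\<forall>f\<in>insert w (coeff P ` {..degree P}). \<exists>F. f = puiseux_of_fls N F"
    using finite_puiseux_common[of "insert w (coeff P ` {..degree P})"]
    by (metis finite_atMost finite_imageI finite_insert mult.right_neutral zero_less_one)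
  then have den: "has_denominator N w" "\<And>i. i \<le> degree P \<Longrightarrow> has_denominator N (coeff P i)"
    by (auto simp: has_denominator_def)
  obtain W where W: "w = puiseux_of_fls N W" using N(2) by blast
  have w: "vanishes_below (1 / of_nat N) w"
    unfolding vanishes_below_def
  proof (intro allI impI)
    fix e :: rat assume e: "e < 1 / of_nat N"
    then have "of_nat N * e < 1" using N(1) by (simp add: field_simps)
    show "puiseux_nth w e = 0"
    proof (cases "of_nat N * e \<in> \<int>")
      case True
      then obtain j where j: "of_nat N * e = of_int j" by (auto elim: Ints_cases)
      then have "j \<le> 0" using \<open>of_nat N * e < 1\<close> by simp
      then have "of_nat N * e \<le> 0" using j by simp
      then have "e \<le> 0" using N(1) by (simp add: mult_le_0_iff)
      then show ?thesis using assms by (simp add: positive_order_def)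
    next
      case False
      then show ?thesis by (simp add: W puiseux_of_fls.rep_eq)
    qed
  qed
  have "\<forall>i. \<exists>b. vanishes_below b (coeff P i)" using vanishes_below_ex by blast
  then obtain b where b: "\<And>i. vanishes_below (b i) (coeff P i)" by metis
  define b0 where "b0 = Min (b ` {..degree P})"
  have b0: "vanishes_below b0 (coeff P i)" if "i \<le> degree P" for i
    using b[of i] that by (rule_tac vanishes_below_mono) (auto simp: b0_def)
  have poly_b0: "vanishes_below b0 (poly P (of_nat m))" for m
    unfolding poly_altdef
  proof (rule vanishes_below_sum)
    fix i assume "i \<in> {..degree P}"
    then show "vanishes_below b0 (coeff P i * of_nat m ^ i)"
      using vanishes_below_mult[OF b0 vanishes_below_of_nat[of "m ^ i"], of i] by simp
  qed
  have poly_den: "has_denominator N (poly P (of_nat m))" for m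
    unfolding poly_altdef
    by (intro has_denominator_sum has_denominator_mult has_denominator_power has_denominator_of_nat
        den N(1)) auto
  have order_term: "vanishes_below (b0 + of_nat m / of_nat N) (fact m * poly P (of_nat m) * w ^ m)" for m
    using vanishes_below_mult[OF vanishes_below_mult[OF vanishes_below_of_nat[of "fact m"] poly_b0[of m]]
        vanishes_below_power[OF w, of m]] by (simp add: mult.assoc)
  show ?thesis
  proof (rule puiseux_summableI[OF N(1)])
    show "has_denominator N (fact m * poly P (of_nat m) * w ^ m)" for m
    proof -
      have "has_denominator N (of_nat (fact m) :: 'a puiseux)" by (rule has_denominator_of_nat[OF N(1)])
      then have "has_denominator N (fact m :: 'a puiseux)" by simp
      then show ?thesis by (intro has_denominator_mult poly_den has_denominator_power den N(1))
    qed
    show "vanishes_below b0 (fact m * poly P (of_nat m) * w ^ m)" for m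
      by (rule vanishes_below_mono[OF order_term]) simp
    fix c
    show "\<exists>M. \<forall>m\<ge>M. vanishes_below c (fact m * poly P (of_nat m) * w ^ m)"
    proof (intro exI[of _ "nat \<lceil>of_nat N * (c - b0)\<rceil>"] allI impI)
      fix m assume "m \<ge> nat \<lceil>of_nat N * (c - b0)\<rceil>"
      then have "of_nat m \<ge> of_nat N * (c - b0)" by linarith
      then have "c - b0 \<le> of_nat m / of_nat N"
        using N(1) by (simp add: pos_le_divide_eq mult.commute)
      then have "c \<le> b0 + of_nat m / of_nat N" by linarith
      then show "vanishes_below c (fact m * poly P (of_nat m) * w ^ m)"
        by (rule vanishes_below_mono[OF order_term])
    qed
  qed
qed

lemma puiseux_sums_add:
  fixes f g :: "nat \<Rightarrow> 'a::comm_ring_1 puiseux"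
  assumes "f sums a" "g sums b"
  shows "(\<lambda>m. f m + g m) sums (a + b)"
  unfolding sums_def tendsto_puiseux_iff
proof
  fix c
  have "\<forall>\<^sub>F n in sequentially. \<forall>e\<le>c. puiseux_nth (sum f {..<n}) e = puiseux_nth a e"
    "\<forall>\<^sub>F n in sequentially. \<forall>e\<le>c. puiseux_nth (sum g {..<n}) e = puiseux_nth b e"
    using assms by (simp_all add: sums_def tendsto_puiseux_iff)
  then show "\<forall>\<^sub>F n in sequentially. \<forall>e\<le>c. puiseux_nth (\<Sum>m<n. f m + g m) e = puiseux_nth (a + b) e"
    by eventually_elim (simp add: sum.distrib plus_puiseux.rep_eq)
qed

lemma puiseux_sums_sum_list:
  fixes f :: "'i \<Rightarrow> nat \<Rightarrow> 'a::comm_ring_1 puiseux"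
  assumes "\<And>x. x \<in> set xs \<Longrightarrow> summable (f x)"
  shows "(\<lambda>m. \<Sum>x\<leftarrow>xs. f x m) sums (\<Sum>x\<leftarrow>xs. \<Sum>m. f x m)"
  using assms by (induction xs) (auto intro!: puiseux_sums_add summable_sums)


section \<open>The generating function\<close>

lemma puiseux_of_fps_hom:
  "puiseux_of_fps 0 = (0 :: 'a::comm_ring_1 puiseux)"
  "puiseux_of_fps 1 = (1 :: 'a puiseux)"
  "puiseux_of_fps (f + g) = puiseux_of_fps f + (puiseux_of_fps g :: 'a puiseux)"
  "puiseux_of_fps (f * g) = puiseux_of_fps f * (puiseux_of_fps g :: 'a puiseux)"
  by (simp_all add: puiseux_of_fps_def puiseux_of_fls_hom fls_times_fps_to_fls)

lemma puiseux_of_fps_sum: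
  fixes f :: "'i \<Rightarrow> 'a::comm_ring_1 fps"
  shows "puiseux_of_fps (sum f I) = (\<Sum>i\<in>I. puiseux_of_fps (f i))"
  by (induction I rule: infinite_finite_induct) (simp_all add: puiseux_of_fps_hom)

lemma puiseux_of_fps_of_nat: "puiseux_of_fps (of_nat n) = (of_nat n :: 'a::comm_ring_1 puiseux)"
  by (induction n) (simp_all add: puiseux_of_fps_hom)

lemma puiseux_nth_of_fps:
  "puiseux_nth (puiseux_of_fps f) e = (if e \<in> \<int> \<and> e \<ge> 0 then fps_nth f (nat \<lfloor>e\<rfloor>) else 0)"
  by (auto simp: puiseux_of_fps_def puiseux_of_fls.rep_eq)

text \<open>For fixed \<open>n\<close> only m up to n k contribute to x^n, and these terms add up to
  the functional applied to \<open>transfer_vec k n 0\<close>. Summation over m and over n is thus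
  interchanged by finite sums.\<close>

lemma laplace_transfer_sums:
  "(\<lambda>m. fact m * puiseux_of_fps (fps_nth (transfer_series k 0) m)) sums
     puiseux_of_fps (Abs_fps (\<lambda>n. of_nat (num_classes n k)))"
  unfolding sums_def tendsto_puiseux_iff
proof
  fix c :: rat
  have fact_mult: "fact m * puiseux_of_fps f = puiseux_of_fps (of_nat (fact m) * f)"
    for m and f :: "complex fps"
    by (simp only: puiseux_of_fps_hom puiseux_of_fps_of_nat) (simp only: of_nat_fact)
  have nth_fact_mult: "fps_nth (of_nat (fact m) * f) n = fact m * fps_nth f n" for m n and f :: "complex fps"
  proof -
    have "of_nat (fact m) * f = fps_const (of_nat (fact m)) * f" by (simp only: fps_of_nat)
    then show ?thesis by (simp only: fps_mult_left_const_nth of_nat_fact)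
  qed
  have partial: "(\<Sum>m<M. fact m * puiseux_of_fps (fps_nth (transfer_series k 0) m)) =
      puiseux_of_fps (\<Sum>m<M. of_nat (fact m) * fps_nth (transfer_series k 0) m)" for M
    by (simp only: puiseux_of_fps_sum fact_mult)
  have eq: "fps_nth (\<Sum>m<M. of_nat (fact m) * fps_nth (transfer_series k 0) m) n = of_nat (num_classes n k)"
    if "n * k < M" for n M
  proof -
    have "M \<noteq> 0" using that by simp
    then obtain M' where M': "M = Suc M'" by (auto simp: gr0_conv_Suc)
    then have "degree (transfer_vec k n 0) \<le> M'"
      using degree_transfer_vec[of k n 0] that by simp
    then have "of_nat (num_classes n k) = (\<Sum>m\<le>M'. fact m * coeff (transfer_vec k n 0) m)"
      by (simp add: num_classes_eq_laplace laplace_eq)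
    then show ?thesis
      by (simp only: fps_sum_nth nth_fact_mult transfer_series_nth M' lessThan_Suc_atMost)
  qed
  show "\<forall>\<^sub>F M in sequentially. \<forall>e\<le>c.
      puiseux_nth (\<Sum>m<M. fact m * puiseux_of_fps (fps_nth (transfer_series k 0) m)) e =
      puiseux_nth (puiseux_of_fps (Abs_fps (\<lambda>n. of_nat (num_classes n k)))) e"
    \<comment> \<open>This single bound serves all exponents up to \<open>c\<close>.\<close>
    using eventually_gt_at_top[of "nat \<lceil>c\<rceil> * k"]
  proof eventually_elim
    case (elim M)
    have "fps_nth (\<Sum>m<M. of_nat (fact m) * fps_nth (transfer_series k 0) m) (nat \<lfloor>e\<rfloor>) =
        of_nat (num_classes (nat \<lfloor>e\<rfloor>) k)" if "e \<le> c" for e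
    proof (rule eq)
      have "nat \<lfloor>e\<rfloor> \<le> nat \<lceil>c\<rceil>" using that by linarith
      then have "nat \<lfloor>e\<rfloor> * k \<le> nat \<lceil>c\<rceil> * k" by (rule mult_right_mono) simp
      then show "nat \<lfloor>e\<rfloor> * k < M" using elim by (rule le_less_trans)
    qed
    then show ?case unfolding partial by (simp add: puiseux_nth_of_fps)
  qed
qed

text \<open>Comparing coefficients of t^m in D times the series equal to M gives, beyond the degree
  of M, a linear recurrence in m whose coefficients \<open>d i\<close> do not depend on m.\<close>

lemma transfer_series_coeff_exp_poly:
  fixes k :: nat
  defines "s \<equiv> \<lambda>m. puiseux_of_fps (fps_nth (transfer_series k 0) m)"
  shows "\<exists>B e. exp_poly {w. w \<noteq> 0 \<and> algebraic_puiseux w \<and> positive_order w} e \<and>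
    (\<forall>m\<ge>B. s m = e m) \<and> (\<forall>m. algebraic_puiseux (s m))"
proof -
  define S where "S = {w. w \<noteq> 0 \<and> algebraic_puiseux w \<and> positive_order w}"
  obtain D M where DM: "[:[:0, 1:]:] dvd D - 1"
    "bivariate_fps D * transfer_series k 0 = bivariate_fps M"
    using transfer_series_rational by blast
  obtain D' where D': "D - 1 = [:[:0, 1:]:] * D'" using DM(1) by (elim dvdE)
  \<comment> \<open>Reduction of D modulo x: \<open>d 0\<close> has constant term 1, and all other
    \<open>d i\<close> have positive order.\<close>
  have D0: "coeff (coeff D i) 0 = (if i = 0 then 1 else 0)" for i
  proof -
    have "coeff (D - 1) i = [:0, 1:] * coeff D' i" unfolding D' by simp
    then have "coeff (coeff (D - 1) i) 0 = 0" by simp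
    then show ?thesis by (simp add: coeff_pCons one_pCons split: nat.splits)
  qed
  define d where "d = (\<lambda>i. puiseux_of_poly (coeff D i) :: complex puiseux)"
  define N where "N = degree D"
  have conv: "(\<Sum>i\<le>m. d i * s (m - i)) = puiseux_of_poly (coeff M m)" for m
  proof -
    have "fps_nth (bivariate_fps D * transfer_series k 0) m = fps_of_poly (coeff M m)"
      unfolding DM(2) by (rule bivariate_fps_nth)
    then have "puiseux_of_fps (\<Sum>i\<le>m. fps_of_poly (coeff D i) * fps_nth (transfer_series k 0) (m - i)) =
        puiseux_of_poly (coeff M m)"
      by (simp add: fps_mult_nth bivariate_fps_nth puiseux_of_poly_def atLeast0AtMost)
    then show ?thesis
      by (simp add: puiseux_of_fps_sum puiseux_of_fps_hom d_def s_def puiseux_of_poly_def)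
  qed
  have alg_d: "algebraic_puiseux (d i)" for i by (simp add: d_def)
  have d0: "d 0 \<noteq> 0" using D0[of 0] by (auto simp: d_def)
  have alg_s: "algebraic_puiseux (s m)" for m
  proof (induction m rule: less_induct)
    case (less m)
    have "(\<Sum>i\<le>m. d i * s (m - i)) = d 0 * s m + (\<Sum>i\<in>{1..m}. d i * s (m - i))"
      by (simp add: sum.atLeast_Suc_atMost[of 0 m, simplified atLeast0AtMost])
    then have "s m = (puiseux_of_poly (coeff M m) - (\<Sum>i\<in>{1..m}. d i * s (m - i))) / d 0"
      using d0 conv[of m] by (simp add: field_simps)
    also have "algebraic_puiseux \<dots>"
      using less by (intro algebraic_puiseux_divide algebraic_puiseux_diff algebraic_puiseux_sum
          algebraic_puiseux_mult alg_d algebraic_puiseux_of_poly) auto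
    finally show ?case .
  qed
  have pos_d: "positive_order (d i)" if "i > 0" for i
    using D0[of i] that
    by (auto simp: positive_order_def d_def puiseux_of_poly_def puiseux_nth_of_fps)
  have d0_integral: "vanishes_below 0 (d 0)" "puiseux_nth (d 0) 0 \<noteq> 0"
    using D0[of 0] by (auto simp: vanishes_below_def d_def puiseux_of_poly_def puiseux_nth_of_fps)
  \<comment> \<open>The reversal of D in t, made monic. Its roots are the y in the factors 1 - y t
    of D, and it is the characteristic polynomial of the recurrence.\<close>
  define Q where "Q = (\<Sum>i\<le>N. monom (d (N - i) / d 0) i)"
  have coeff_Q: "coeff Q i = (if i \<le> N then d (N - i) / d 0 else 0)" for i
    by (simp add: Q_def coeff_sum)
  have "coeff Q N = 1" using d0 by (simp add: coeff_Q)
  then have deg_Q: "degree Q = N"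
    by (intro antisym degree_le le_degree) (auto simp: coeff_Q)
  have poly_Q: "d 0 * poly Q y = (\<Sum>i\<le>N. d i * y ^ (N - i))" for y
  proof -
    have "d 0 * poly Q y = (\<Sum>i\<le>N. d (N - i) * y ^ i)"
      using d0 unfolding poly_altdef deg_Q sum_distrib_left by (intro sum.cong) (auto simp: coeff_Q)
    also have "\<dots> = (\<Sum>i\<le>N. d i * y ^ (N - i))"
      by (rule sum.reindex_bij_witness[of _ "\<lambda>i. N - i" "\<lambda>i. N - i"]) auto
    finally show ?thesis .
  qed
  have "Q \<noteq> 0" using \<open>coeff Q N = 1\<close> by auto
  then obtain A where A: "Q = (\<Prod>y\<in>#A. [:-y, 1:])"
    using alg_closed_imp_factorization[of Q] \<open>coeff Q N = 1\<close> deg_Q by auto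
  have "set_mset A \<subseteq> S"
  proof
    fix y assume "y \<in># A"
    then have "poly Q y = 0"
      by (auto simp: A poly_prod_mset dest!: multi_member_split)
    then have root: "(\<Sum>i\<le>N. d i * y ^ (N - i)) = 0" using poly_Q[of y] by simp
    \<comment> \<open>The constant coefficient of \<open>Q\<close> is \<open>d N / d 0\<close>,
      which is nonzero because \<open>N\<close> is the degree of \<open>D\<close>; so 0 is not a
      root.\<close>
    have "D \<noteq> 0" using D0[of 0] by auto
    then have "d N \<noteq> 0" by (simp add: d_def N_def)
    have "y \<noteq> 0"
    proof
      assume "y = 0"
      then have "(\<Sum>i\<le>N. d i * y ^ (N - i)) = (\<Sum>i\<le>N. if i = N then d i else 0)"
        by (intro sum.cong) (auto simp: power_0_left)
      then show False using root \<open>d N \<noteq> 0\<close> by simp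
    qed
    moreover have "positive_order y"
      using \<open>y \<noteq> 0\<close> root d0_integral pos_d by (rule positive_order_root)
    moreover have "algebraic_puiseux y"
      unfolding algebraic_puiseux_iff
    proof (intro exI conjI)
      have "(\<Sum>i\<le>N. d (N - i) * y ^ i) = (\<Sum>i\<le>N. d i * y ^ (N - i))"
        by (rule sum.reindex_bij_witness[of _ "\<lambda>i. N - i" "\<lambda>i. N - i"]) auto
      then show "(\<Sum>i\<le>N. puiseux_of_poly (coeff D (N - i)) * y ^ i) = 0"
        using root by (simp add: d_def)
      show "N \<le> N" "coeff D (N - N) \<noteq> 0" using d0 by (auto simp: d_def)
    qed
    ultimately show "y \<in> S" by (simp add: S_def)
  qed
  \<comment> \<open>Up to the factor \<open>d 0\<close> this is the convolution at index
    \<open>m + N\<close>, where the coefficient of \<open>M\<close> vanishes.\<close>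
  moreover have "(\<Sum>i\<le>degree Q. coeff Q i * s (m + i)) = 0" if "m \<ge> Suc (degree M)" for m
  proof -
    have "d 0 * (\<Sum>i\<le>degree Q. coeff Q i * s (m + i)) = (\<Sum>i\<le>N. d (N - i) * s (m + i))"
      using d0 unfolding deg_Q sum_distrib_left by (intro sum.cong) (auto simp: coeff_Q)
    also have "\<dots> = (\<Sum>i\<le>N. d i * s (m + N - i))"
      by (rule sum.reindex_bij_witness[of _ "\<lambda>i. N - i" "\<lambda>i. N - i"]) auto
    also have "\<dots> = (\<Sum>i\<le>m + N. d i * s (m + N - i))"
      by (rule sum.mono_neutral_left) (auto simp: d_def N_def coeff_eq_0 puiseux_of_poly_hom)
    also have "\<dots> = 0"
      using that by (simp add: conv coeff_eq_0 puiseux_of_poly_hom)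
    finally show ?thesis using d0 by simp
  qed
  ultimately have "\<exists>e. exp_poly S e \<and> (\<forall>m\<ge>Suc (degree M). s m = e m)"
    using alg_s A by (intro recurrence_eventually_exp_poly[of S A s Q]) (auto simp: S_def)
  then show ?thesis using alg_s unfolding S_def by blast
qed

text \<open>Summability is asserted separately because \<open>suminf\<close> of a series without a
  limit is an unspecified value, and the identity would then say nothing.\<close>

theorem theorem2p5:
  fixes k :: nat
  assumes "k \<ge> 1"
  shows "\<exists>(q :: nat) (y :: nat \<Rightarrow> complex puiseux) (z :: nat \<Rightarrow> complex puiseux)
           (P :: nat \<Rightarrow> complex puiseux poly).
           (\<forall>j\<in>{1..q}. algebraic_puiseux (y j) \<and> algebraic_puiseux (z j) \<and>
              (\<forall>i. algebraic_puiseux (coeff (P j) i))) \<and>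
           (\<forall>j\<in>{1..q}. summable (\<lambda>m. fact m * poly (P j) (of_nat m) * y j ^ m)) \<and>
           puiseux_of_fps (Abs_fps (\<lambda>n. of_nat (num_classes n k))) =
             (\<Sum>j=1..q. z j * (\<Sum>m. fact m * poly (P j) (of_nat m) * y j ^ m))"
proof -
  define s where "s = (\<lambda>m. puiseux_of_fps (fps_nth (transfer_series k 0) m) :: complex puiseux)"
  define term_of where "term_of = (\<lambda>(P, w) m. fact m * poly P (of_nat m) * w ^ m :: complex puiseux)"
  obtain B e where e: "exp_poly {w. w \<noteq> 0 \<and> algebraic_puiseux w \<and> positive_order w} e"
    "\<forall>m\<ge>B. s m = e m" "\<And>m. algebraic_puiseux (s m)"
    using transfer_series_coeff_exp_poly[of k] unfolding s_def by blast
  obtain xs where xs: "\<forall>(P, w)\<in>set xs. algebraic_poly P \<and>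
      w \<in> {w. w \<noteq> 0 \<and> algebraic_puiseux w \<and> positive_order w}"
    "\<And>m. e m = (\<Sum>(P, w)\<leftarrow>xs. poly P (of_nat m) * w ^ m)"
    using e(1) by (auto simp: exp_poly_def)
  have summable: "summable (term_of x)" if "x \<in> set xs" for x
    using xs(1) that by (auto simp: term_of_def split: prod.splits intro!: summable_fact_poly_power)
  have fact_e: "fact m * e m = (\<Sum>x\<leftarrow>xs. term_of x m)" for m
    unfolding xs(2) by (induction xs) (auto simp: term_of_def algebra_simps)
  text \<open>The finitely many exceptional coefficients are absorbed by the series with \<open>y = 0\<close>,
    \<open>P = 1\<close>, where \<open>0 ^ 0 = 1\<close>.\<close>
  define c where "c = (\<Sum>m<B. fact m * (s m - e m))"
  have "(\<lambda>m. fact m * (s m - e m)) sums c"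
    unfolding c_def by (rule sums_finite) (use e(2) in auto)
  moreover have "(\<lambda>m. fact m * e m) sums (\<Sum>x\<leftarrow>xs. suminf (term_of x))"
    unfolding fact_e using summable by (rule puiseux_sums_sum_list)
  ultimately have "(\<lambda>m. fact m * (s m - e m) + fact m * e m) sums (c + (\<Sum>x\<leftarrow>xs. suminf (term_of x)))"
    by (rule puiseux_sums_add)
  then have "(\<lambda>m. fact m * s m) sums (c + (\<Sum>x\<leftarrow>xs. suminf (term_of x)))"
    by (simp add: algebra_simps)
  then have total: "puiseux_of_fps (Abs_fps (\<lambda>n. of_nat (num_classes n k))) =
      c + (\<Sum>x\<leftarrow>xs. suminf (term_of x))"
    using laplace_transfer_sums[of k] unfolding s_def by (rule sums_unique2[rotated])
  have alg_fact: "algebraic_puiseux (fact m)" for m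
    using algebraic_puiseux_of_nat[of "fact m"] by simp
  have alg_c: "algebraic_puiseux c"
    unfolding c_def using e(3) exp_poly_algebraic[OF e(1)] alg_fact
    by (intro algebraic_puiseux_sum algebraic_puiseux_mult algebraic_puiseux_diff) auto
  have "term_of ([:1:], 0) sums (\<Sum>m\<in>{0}. term_of ([:1:], 0) m)"
    by (rule sums_finite) (auto simp: term_of_def)
  then have one: "term_of ([:1:], 0) sums 1" by (simp add: term_of_def)
  define q where "q = Suc (length xs)"
  define x where "x = (\<lambda>j. (([:1:], 0) # xs) ! (j - 1))"
  \<comment> \<open>Only the first series, whose sum is 1, carries the correction \<open>c\<close>;
    the factors of the exponential polynomials are already inside the \<open>P\<close>.\<close>
  define z where "z = (\<lambda>j :: nat. if j = 1 then c else 1 :: complex puiseux)"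
  have x_cases: "x j = ([:1:], 0) \<or> x j \<in> set xs" if "j \<in> {1..q}" for j
    using that nth_mem[of "j - 1" "([:1:], 0) # xs"] by (auto simp: x_def q_def)
  show ?thesis
  proof (rule exI[of _ q], rule exI[of _ "\<lambda>j. snd (x j)"], rule exI[of _ z],
      rule exI[of _ "\<lambda>j. fst (x j)"], intro conjI ballI)
    fix j assume j: "j \<in> {1..q}"
    have "algebraic_puiseux (snd (x j)) \<and> algebraic_poly (fst (x j))"
      using x_cases[OF j] xs(1) by auto
    then show "algebraic_puiseux (snd (x j))" "\<forall>i. algebraic_puiseux (coeff (fst (x j)) i)"
      by (auto simp: algebraic_poly_def)
    show "algebraic_puiseux (z j)" using alg_c by (simp add: z_def)
    have "summable (term_of (x j))"
      using x_cases[OF j] summable sums_summable[OF one] by metis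
    then show "summable (\<lambda>m. fact m * poly (fst (x j)) (of_nat m) * snd (x j) ^ m)"
      by (simp add: term_of_def case_prod_beta)
  next
    have "(\<Sum>j=1..q. z j * (\<Sum>m. fact m * poly (fst (x j)) (of_nat m) * snd (x j) ^ m)) =
        (\<Sum>j=1..q. z j * suminf (term_of (x j)))"
      by (simp add: term_of_def case_prod_beta)
    also have "\<dots> = (\<Sum>j<q. z (Suc j) * suminf (term_of (x (Suc j))))"
      by (simp add: sum.atLeast1_atMost_eq)
    also have "\<dots> = c + (\<Sum>j<length xs. suminf (term_of (xs ! j)))"
      using sums_unique[OF one] unfolding q_def
      by (subst sum.lessThan_Suc_shift) (simp add: z_def x_def)
    also have "(\<Sum>j<length xs. suminf (term_of (xs ! j))) = (\<Sum>x\<leftarrow>xs. suminf (term_of x))"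
      by (simp add: sum_list_sum_nth atLeast0LessThan)
    finally show "puiseux_of_fps (Abs_fps (\<lambda>n. of_nat (num_classes n k))) =
        (\<Sum>j=1..q. z j * (\<Sum>m. fact m * poly (fst (x j)) (of_nat m) * snd (x j) ^ m))"
      using total by simp
  qed
qed


end
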